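(* Let $F$ be a dyadic local field, $n\ge 2$ an even integer, and $M$ an integral $\mathcal{O}_F$-lattice of rank $n+1$. Then $M$ is $n$-ADC if and only if $M$ is $\mathcal{O}_F$-maximal.
   Context: A dyadic local field is a finite extension of $\mathbb{Q}_2$. An integral $\mathcal{O}_F$-lattice is a finitely generated $\mathcal{O}_F$-submodule of a non-degenerate quadratic space with norm ideal $\mathfrak{n}(M)\subseteq\mathcal{O}_F$. $M$ is $n$-ADC if for every integral $\mathcal{O}_F$-lattice $N$ of rank $n$ with $FN$ represented by $FM$, $M$ represents $N$. $M$ is $\mathcal{O}_F$-maximal if $\mathfrak{n}(M)\subseteq\mathcal{O}_F$ and $M$ contains every lattice on $FM$ whose norm is contained in $\mathcal{O}_F$.
   Formalization: "O_F-maximal" is taken in the standard sense: n(M) ⊆ O_F and no integral lattice on FM properly contains M (M containing every integral lattice on FM fails for isotropic FM). FM and FN are assumed non-degenerate; N is taken, up to isometry, inside a space of sequences over F. *)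

theory Defs
  imports
    Complex_Main
    "HOL-Library.Function_Algebras"
    "HOL-Computational_Algebra.Polynomial"
    "HOL-Computational_Algebra.Primes"
begin

section \<open>Dyadic local fields\<close>

definition dyadic_abs :: "rat \<Rightarrow> real" where
  "dyadic_abs r =
     (if r = 0 then 0
      else (1/2) powi (int (multiplicity 2 (fst (quotient_of r)))
                       - int (multiplicity 2 (snd (quotient_of r)))))"

definition subset_span :: "'a::field set \<Rightarrow> ('a \<Rightarrow> 'v::ab_group_add \<Rightarrow> 'v) \<Rightarrow> 'v set \<Rightarrow> 'v set" where
  "subset_span R scale S = {(\<Sum>x\<in>T. scale (c x) x) | T c. finite T \<and> T \<subseteq> S \<and> c ` T \<subseteq> R}"

text \<open>
  The library has no field of 2-adic numbers. Here \<open>K\<close>, with the absolute value \<open>v\<close>, is a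
  subfield of the ambient field which is a completion of the rationals with respect to the 2-adic
  absolute value; this determines \<open>(K, v)\<close> up to a unique isomorphism. The values of
  \<open>v\<close> outside \<open>K\<close> are irrelevant.
\<close>

locale dyadic_numbers =
  fixes K :: "'a::field_char_0 set" and v :: "'a \<Rightarrow> real"
  assumes one_mem: "1 \<in> K"
    and diff_mem: "x \<in> K \<Longrightarrow> y \<in> K \<Longrightarrow> x - y \<in> K"
    and mult_mem: "x \<in> K \<Longrightarrow> y \<in> K \<Longrightarrow> x * y \<in> K"
    and inverse_mem: "x \<in> K \<Longrightarrow> inverse x \<in> K"
    and abs_nonneg: "x \<in> K \<Longrightarrow> 0 \<le> v x"
    and abs_eq_0_iff: "x \<in> K \<Longrightarrow> v x = 0 \<longleftrightarrow> x = 0"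
    and abs_mult: "x \<in> K \<Longrightarrow> y \<in> K \<Longrightarrow> v (x * y) = v x * v y"
    and abs_triangle: "x \<in> K \<Longrightarrow> y \<in> K \<Longrightarrow> v (x + y) \<le> v x + v y"
    and abs_of_rat: "v (of_rat r) = dyadic_abs r"
    and dense: "x \<in> K \<Longrightarrow> e > 0 \<Longrightarrow> \<exists>r. v (x - of_rat r) < e"
    and complete:
      "(\<And>i. X i \<in> K) \<Longrightarrow>
       (\<And>e. e > 0 \<Longrightarrow> \<exists>N. \<forall>i\<ge>N. \<forall>j\<ge>N. v (X i - X j) < e) \<Longrightarrow>
       \<exists>l\<in>K. (\<lambda>i. v (X i - l)) \<longlonglongrightarrow> 0"

text \<open>The extension field is the whole type \<open>'a\<close>.\<close>

locale dyadic_local_field = dyadic_numbers +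
  assumes finite_extension: "\<exists>S. finite S \<and> subset_span K (*) S = UNIV"

definition ring_of_integers :: "'a::field_char_0 set \<Rightarrow> ('a \<Rightarrow> real) \<Rightarrow> 'a set" where
  "ring_of_integers K v =
     {x. \<exists>p. lead_coeff p = 1 \<and> (\<forall>i. coeff p i \<in> K \<and> v (coeff p i) \<le> 1) \<and> poly p x = 0}"


section \<open>Quadratic spaces and lattices\<close>

text \<open>
  The quadratic form is \<open>Q x = B x x\<close>; the values of \<open>B\<close> outside \<open>V\<close> are irrelevant.
\<close>

locale quadratic_space = vector_space scale
  for scale :: "'a::field_char_0 \<Rightarrow> 'v::ab_group_add \<Rightarrow> 'v" +
  fixes V :: "'v set" and B :: "'v \<Rightarrow> 'v \<Rightarrow> 'a"
  assumes subspace_V: "subspace V"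
    and finite_dim: "\<exists>S. finite S \<and> span S = V"
    and form_sym: "x \<in> V \<Longrightarrow> y \<in> V \<Longrightarrow> B x y = B y x"
    and form_add: "x \<in> V \<Longrightarrow> y \<in> V \<Longrightarrow> z \<in> V \<Longrightarrow> B (x + y) z = B x z + B y z"
    and form_scale: "x \<in> V \<Longrightarrow> y \<in> V \<Longrightarrow> B (scale c x) y = c * B x y"
    and nondegenerate: "x \<in> V \<Longrightarrow> (\<And>y. y \<in> V \<Longrightarrow> B x y = 0) \<Longrightarrow> x = 0"

text \<open>
  In what follows \<open>R\<close> is the ring of integers of the field, and the space \<open>FM\<close> spanned by a
  lattice \<open>M\<close> is \<open>module.span scale M\<close>. As usual, a lattice is required to span a
  non-degenerate space.
\<close>

definition lattice_in ::
  "'a::field_char_0 set \<Rightarrow> ('a \<Rightarrow> 'v::ab_group_add \<Rightarrow> 'v) \<Rightarrow> ('v \<Rightarrow> 'v \<Rightarrow> 'a) \<Rightarrow> 'v set \<Rightarrow> bool" where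
  "lattice_in R scale B M \<longleftrightarrow>
     quadratic_space scale (module.span scale M) B \<and>
     (\<exists>S. finite S \<and> M = subset_span R scale S)"

definition lattice_rank :: "('a::field \<Rightarrow> 'v::ab_group_add \<Rightarrow> 'v) \<Rightarrow> 'v set \<Rightarrow> nat" where
  "lattice_rank scale M = vector_space.dim scale M"

definition norm_ideal :: "'a::field set \<Rightarrow> ('v \<Rightarrow> 'v \<Rightarrow> 'a) \<Rightarrow> 'v set \<Rightarrow> 'a set" where
  "norm_ideal R B M = subset_span R (*) {B x x | x. x \<in> M}"

definition integral_lattice ::
  "'a::field_char_0 set \<Rightarrow> ('a \<Rightarrow> 'v::ab_group_add \<Rightarrow> 'v) \<Rightarrow> ('v \<Rightarrow> 'v \<Rightarrow> 'a) \<Rightarrow> 'v set \<Rightarrow> bool" where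
  "integral_lattice R scale B M \<longleftrightarrow> lattice_in R scale B M \<and> norm_ideal R B M \<subseteq> R"

definition is_representation ::
  "('a::field \<Rightarrow> 'v::ab_group_add \<Rightarrow> 'v) \<Rightarrow> ('v \<Rightarrow> 'v \<Rightarrow> 'a) \<Rightarrow> 'v set \<Rightarrow>
   ('a \<Rightarrow> 'w::ab_group_add \<Rightarrow> 'w) \<Rightarrow> ('w \<Rightarrow> 'w \<Rightarrow> 'a) \<Rightarrow> 'w set \<Rightarrow> ('w \<Rightarrow> 'v) \<Rightarrow> bool" where
  "is_representation scale B V scale' C W \<sigma> \<longleftrightarrow>
     Vector_Spaces.linear scale' scale \<sigma> \<and> \<sigma> ` W \<subseteq> V \<and> (\<forall>x\<in>W. B (\<sigma> x) (\<sigma> x) = C x x)"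

definition space_represents ::
  "('a::field \<Rightarrow> 'v::ab_group_add \<Rightarrow> 'v) \<Rightarrow> ('v \<Rightarrow> 'v \<Rightarrow> 'a) \<Rightarrow> 'v set \<Rightarrow>
   ('a \<Rightarrow> 'w::ab_group_add \<Rightarrow> 'w) \<Rightarrow> ('w \<Rightarrow> 'w \<Rightarrow> 'a) \<Rightarrow> 'w set \<Rightarrow> bool" where
  "space_represents scale B V scale' C W \<longleftrightarrow> (\<exists>\<sigma>. is_representation scale B V scale' C W \<sigma>)"

definition lattice_represents ::
  "('a::field \<Rightarrow> 'v::ab_group_add \<Rightarrow> 'v) \<Rightarrow> ('v \<Rightarrow> 'v \<Rightarrow> 'a) \<Rightarrow> 'v set \<Rightarrow>
   ('a \<Rightarrow> 'w::ab_group_add \<Rightarrow> 'w) \<Rightarrow> ('w \<Rightarrow> 'w \<Rightarrow> 'a) \<Rightarrow> 'w set \<Rightarrow> bool" where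
  "lattice_represents scale B M scale' C N \<longleftrightarrow>
     (\<exists>\<sigma>. is_representation scale B (module.span scale M) scale' C (module.span scale' N) \<sigma> \<and>
          \<sigma> ` N \<subseteq> M)"

text \<open>
  A definition cannot quantify over types, so arbitrary finite-dimensional quadratic spaces are
  taken inside the space of all sequences; by \<open>quadratic_space_iso_sequences\<close> below this loses
  none of them up to isometry.
\<close>

definition seq_scale :: "'a::field \<Rightarrow> (nat \<Rightarrow> 'a) \<Rightarrow> (nat \<Rightarrow> 'a)" where
  "seq_scale c f = (\<lambda>i. c * f i)"

definition ADC ::
  "nat \<Rightarrow> 'a::field_char_0 set \<Rightarrow> ('a \<Rightarrow> 'v::ab_group_add \<Rightarrow> 'v) \<Rightarrow> ('v \<Rightarrow> 'v \<Rightarrow> 'a) \<Rightarrow> 'v set \<Rightarrow> bool" where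
  "ADC n R scale B M \<longleftrightarrow>
     (\<forall>C (N :: (nat \<Rightarrow> 'a) set).
        integral_lattice R seq_scale C N \<and> lattice_rank seq_scale N = n \<and>
        space_represents scale B (module.span scale M) seq_scale C (module.span seq_scale N) \<longrightarrow>
        lattice_represents scale B M seq_scale C N)"

text \<open>Maximality is with respect to inclusion among the integral lattices on \<open>FM\<close>.\<close>

definition maximal_lattice ::
  "'a::field_char_0 set \<Rightarrow> ('a \<Rightarrow> 'v::ab_group_add \<Rightarrow> 'v) \<Rightarrow> ('v \<Rightarrow> 'v \<Rightarrow> 'a) \<Rightarrow> 'v set \<Rightarrow> bool" where
  "maximal_lattice R scale B M \<longleftrightarrow>
     lattice_in R scale B M \<and> norm_ideal R B M \<subseteq> R \<and>
     (\<forall>L. lattice_in R scale B L \<and> module.span scale L = module.span scale M \<and>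
          norm_ideal R B L \<subseteq> R \<and> M \<subseteq> L \<longrightarrow> L = M)"

lemma vector_space_seq_scale: "vector_space (seq_scale :: 'a::field \<Rightarrow> _)"
  by unfold_locales (auto simp: seq_scale_def fun_eq_iff algebra_simps)

lemma quadratic_space_iso_sequences:
  fixes scale :: "'a::field_char_0 \<Rightarrow> 'v::ab_group_add \<Rightarrow> 'v"
  assumes "quadratic_space scale V B"
  shows "\<exists>W C \<phi>. quadratic_space (seq_scale :: 'a \<Rightarrow> _) W C \<and>
           Vector_Spaces.linear scale seq_scale \<phi> \<and> bij_betw \<phi> V W \<and>
           (\<forall>x\<in>V. \<forall>y\<in>V. C (\<phi> x) (\<phi> y) = B x y)"
proof -
  interpret Q: quadratic_space scale V B by (rule assms)
  interpret S: vector_space "seq_scale :: 'a \<Rightarrow> _" by (rule vector_space_seq_scale)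
  interpret P: vector_space_pair scale "seq_scale :: 'a \<Rightarrow> _" ..
  obtain S where S: "finite S" "Q.span S = V" using Q.finite_dim by blast
  obtain b where b: "b \<subseteq> S" "Q.independent b" "S \<subseteq> Q.span b"
    using Q.maximal_independent_subset[of S] by blast
  have spb: "Q.span b = V"
    using S b by (metis Q.span_mono Q.span_minimal Q.subspace_span subset_antisym)
  have fb: "finite b" using b S finite_subset by blast
  obtain e :: "'v \<Rightarrow> nat" where e: "inj_on e b"
    using fb finite_imp_inj_to_nat_seg by metis
  define u :: "'v \<Rightarrow> nat \<Rightarrow> 'a" where "u x = (\<lambda>i. if i = e x then 1 else 0)" for x
  obtain \<phi> where \<phi>: "Vector_Spaces.linear scale seq_scale \<phi>" "\<forall>x\<in>b. \<phi> x = u x"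
    using P.linear_independent_extend[OF b(2), of u] by blast
  interpret L: Vector_Spaces.linear scale seq_scale \<phi> by (rule \<phi>(1))
  have inj: "inj_on \<phi> V"
    unfolding L.inj_on_iff_eq_0[OF Q.subspace_V]
  proof (intro ballI impI)
    fix x assume x: "x \<in> V" "\<phi> x = 0"
    obtain r where r: "x = (\<Sum>a\<in>b. scale (r a) a)"
      using x(1) unfolding spb[symmetric] Q.span_finite[OF fb] by blast
    have "\<phi> x = (\<Sum>a\<in>b. seq_scale (r a) (u a))"
      using \<phi>(2) by (simp add: r L.sum L.scale)
    then have *: "(\<Sum>a\<in>b. seq_scale (r a) (u a)) = 0" using x by simp
    have "r a = 0" if a: "a \<in> b" for a
    proof -
      have gen: "(\<Sum>a\<in>A. seq_scale (r a) (u a)) i = (\<Sum>a\<in>A. r a * u a i)" for A i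
        by (induction A rule: infinite_finite_induct) (auto simp: seq_scale_def)
      have "0 = (\<Sum>a'\<in>b. r a' * u a' (e a))" using * gen[of b "e a"] by simp
      also have "\<dots> = (\<Sum>a'\<in>b. if a' = a then r a else 0)"
        using e a by (intro sum.cong) (auto simp: u_def inj_on_def)
      also have "\<dots> = r a" using fb a by simp
      finally show ?thesis by simp
    qed
    then show "x = 0" by (simp add: r)
  qed
  define \<psi> where "\<psi> = inv_into V \<phi>"
  have \<psi>: "\<psi> (\<phi> x) = x" if "x \<in> V" for x using inj that by (simp add: \<psi>_def)
  define C where "C x y = B (\<psi> x) (\<psi> y)" for x y
  have CB: "C (\<phi> x) (\<phi> y) = B x y" if "x \<in> V" "y \<in> V" for x y
    using that by (simp add: C_def \<psi>)
  have "quadratic_space seq_scale (\<phi> ` V) C"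
  proof unfold_locales
    show "S.subspace (\<phi> ` V)" by (rule L.subspace_image[OF Q.subspace_V])
    show "\<exists>S. finite S \<and> S.span S = \<phi> ` V"
      by (rule exI[of _ "\<phi> ` S"]) (use S L.span_image in auto)
  next
    fix x y assume "x \<in> \<phi> ` V" "y \<in> \<phi> ` V"
    then show "C x y = C y x" using CB Q.form_sym by auto
  next
    fix x y z assume "x \<in> \<phi> ` V" "y \<in> \<phi> ` V" "z \<in> \<phi> ` V"
    then obtain x' y' z' where *: "x = \<phi> x'" "y = \<phi> y'" "z = \<phi> z'" "x' \<in> V" "y' \<in> V" "z' \<in> V"
      by blast
    then have "x + y = \<phi> (x' + y')" "x' + y' \<in> V"
      by (auto simp: L.add Q.subspace_add[OF Q.subspace_V])
    then show "C (x + y) z = C x z + C y z" using * CB Q.form_add by simp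
  next
    fix x y c assume "x \<in> \<phi> ` V" "y \<in> \<phi> ` V"
    then obtain x' y' where *: "x = \<phi> x'" "y = \<phi> y'" "x' \<in> V" "y' \<in> V"
      by blast
    then have "seq_scale c x = \<phi> (scale c x')" "scale c x' \<in> V"
      by (auto simp: L.scale Q.subspace_scale[OF Q.subspace_V])
    then show "C (seq_scale c x) y = c * C x y" using * CB Q.form_scale by simp
  next
    fix x assume x: "x \<in> \<phi> ` V" and 0: "\<And>y. y \<in> \<phi> ` V \<Longrightarrow> C x y = 0"
    then obtain x' where x': "x = \<phi> x'" "x' \<in> V" by blast
    have "B x' y = 0" if "y \<in> V" for y
      using 0[of "\<phi> y"] CB[of x' y] x' that by simp
    then have "x' = 0" using x' Q.nondegenerate by blast
    then show "x = 0" using x' L.zero by simp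
  qed
  moreover have "bij_betw \<phi> V (\<phi> ` V)" using inj by (simp add: bij_betw_def)
  ultimately show ?thesis using \<phi>(1) CB by blast
qed

end

theory Submission
  imports Defs "HOL-Library.Diagonal_Subsequence" "Jordan_Normal_Form.Char_Poly"
begin

text \<open>
  Write \<open>Q x = B x x\<close>, \<open>b = 2 B\<close> and let \<open>p\<close> be a uniformizer. All that is used of the field is that
  its ring of integers is a discrete valuation ring with finite residue field of characteristic 2
  in which \<open>s\<^sup>2 + s + c = 0\<close> is solvable for every non-unit \<open>c\<close>. These facts come from the sequential
  compactness of an order in the field: it makes the 2-adic filtration of the order multiplicative up
  to a bounded error, and the power-bounded elements are exactly the integral ones.

  If \<open>M\<close> is maximal and \<open>N\<close> is an integral lattice in \<open>FM\<close>, then \<open>N\<close> lies in a maximal lattice on \<open>FM\<close>,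
  and all maximal lattices on \<open>FM\<close> are isometric: split off hyperbolic planes until the space is
  anisotropic, where the maximal lattice is the set of all vectors with integral norm.

  Conversely, let \<open>M\<close> be properly contained in a maximal lattice \<open>L\<close>. A copy in \<open>M\<close> of a maximal lattice
  \<open>N\<close> of rank \<open>n\<close> is a direct summand of \<open>L\<close> of corank 1, so its reduction is the image of \<open>M\<close> in
  \<open>L/pL\<close>. Hence the reductions of all maximal lattices of rank \<open>n\<close> in \<open>FM\<close> are isometric. But the
  Jordan decomposition of \<open>L\<close> yields two such lattices, one in which \<open>Q\<close> vanishes modulo \<open>p\<close> on the
  radical of \<open>b\<close> modulo \<open>p\<close>, and one in which it does not.
\<close>

section \<open>The 2-adic integers\<close>

text \<open>Integrality of norms controls only the polar form \<open>b\<close> of \<open>Q\<close>,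
  and \<open>b x x = 2 * Q x\<close>. So modulo \<open>p\<close> the form \<open>b\<close> is
  alternating, and on its radical \<open>Q\<close> is additive and homogeneous of degree 2. Over a
  perfect residue field of characteristic 2 this makes unit norms cancellable against each other,
  which is the source of most vectors constructed below. The parity of \<open>n\<close> enters
  through ranks: unimodular planes fill an even rank of a space of dimension n + 1, so their
  orthogonal complement in \<open>L\<close> is never zero. A vector left over there allows one plane
  to be exchanged for two orthogonal lines whose norms have valuations 0 and 1, and this exchange is
  what changes the behaviour of \<open>Q\<close> on the radical. The absolute value is never
  extended to the larger field. A multiplicatively closed module spanned by a multiple of a basis
  inherits compactness coordinatewise, and pigeonhole arguments in it replace norms and uniqueness
  of extensions. Maximality is handled through single adjoined vectors, because this criterion
  passes easily to isometric images and orthogonal summands.\<close>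

lemma subset_span_finite:
  assumes "finite S" "0 \<in> R" "\<And>x. scale 0 x = 0"
  shows "subset_span R scale S = {(\<Sum>x\<in>S. scale (c x) x) | c. \<forall>x. c x \<in> R}"
proof (intro subset_antisym subsetI)
  fix y assume "y \<in> subset_span R scale S"
  then obtain T c where T: "finite T" "T \<subseteq> S" "c ` T \<subseteq> R" "y = (\<Sum>x\<in>T. scale (c x) x)"
    by (auto simp: subset_span_def)
  let ?d = "\<lambda>x. if x \<in> T then c x else 0"
  have "y = (\<Sum>x\<in>S. scale (?d x) x)"
    unfolding T(4) using T assms by (intro sum.mono_neutral_cong_left) auto
  then show "y \<in> {(\<Sum>x\<in>S. scale (c x) x) | c. \<forall>x. c x \<in> R}"
    using T assms by (intro CollectI exI[of _ ?d]) auto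
next
  fix y assume "y \<in> {(\<Sum>x\<in>S. scale (c x) x) | c. \<forall>x. c x \<in> R}"
  then show "y \<in> subset_span R scale S"
    using assms by (auto simp: subset_span_def intro!: exI[of _ S])
qed

text \<open>Used to find one power of 2 that serves finitely many elements at once.\<close>

lemma uniform_eventual_bound:
  assumes "finite S" and mono: "\<And>s k. P s k \<Longrightarrow> P s (Suc k)" and ex: "\<And>s. s \<in> S \<Longrightarrow> \<exists>k. P s k"
  shows "\<exists>k::nat. \<forall>s\<in>S. P s k"
  using assms(1) ex
proof (induction S)
  case empty
  then show ?case by simp
next
  case (insert s S)
  then obtain i j where ij: "P s i" "\<forall>s\<in>S. P s j" by blast
  have mono': "P s k" if "P s i" "i \<le> k" for s i k
    using that(2,1) by (induction rule: dec_induct) (auto intro: mono)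
  show ?case
    using ij mono'[of _ i "max i j"] mono'[of _ j "max i j"] by (intro exI[of _ "max i j"]) auto
qed

text \<open>Each \<open>f k\<close> colours the indices with finitely many colours. The pigeonhole
  principle thins the sequence once per colouring, and the diagonal sequence serves all of
  them.\<close>

lemma subsequence_constant_classes:
  fixes f :: "nat \<Rightarrow> nat \<Rightarrow> 'b"
  assumes fin: "\<And>k. finite (range (f k))"
  shows "\<exists>r::nat \<Rightarrow> nat. strict_mono r \<and> (\<forall>k. \<forall>i\<ge>k. f k (r i) = f k (r k))"
proof -
  interpret subseqs "\<lambda>k s. \<forall>i j. f k (s i) = f k (s j)"
  proof
    fix k and s :: "nat \<Rightarrow> nat" assume s: "strict_mono s"
    have "finite ((\<lambda>i. f k (s i)) ` UNIV)"
      using fin[of k] by (rule rev_finite_subset) auto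
    then obtain i0 where i0: "infinite {i. f k (s i) = f k (s i0)}"
      using pigeonhole_infinite[of UNIV "\<lambda>i. f k (s i)"] by auto
    then obtain r :: "nat \<Rightarrow> nat"
      where r: "strict_mono r" "\<forall>i. r i \<in> {i. f k (s i) = f k (s i0)}"
      using infinite_enumerate by blast
    have "\<forall>i j. f k ((s \<circ> r) i) = f k ((s \<circ> r) j)" using r(2) by simp
    then show "\<exists>r'::nat \<Rightarrow> nat. strict_mono r' \<and> (\<forall>i j. f k ((s \<circ> r') i) = f k ((s \<circ> r') j))"
      using r(1) by blast
  qed
  have *: "\<forall>i j. f k (diagseq (Suc k + i)) = f k (diagseq (Suc k + j))" for k
  proof (intro allI)
    fix i j
    have "(\<forall>i j. f k ((diagseq \<circ> (+) (Suc k)) i) = f k ((diagseq \<circ> (+) (Suc k)) j))"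
      by (rule diagseq_holds) auto
    then show "f k (diagseq (Suc k + i)) = f k (diagseq (Suc k + j))" by (metis comp_apply)
  qed
  \<comment> \<open>The diagonal sequence is constant for the \<open>k\<close>-th colouring from
    index \<open>Suc k\<close> on; the shift turns this into index \<open>k\<close>.\<close>
  define r where "r i = diagseq (Suc i)" for i
  have "f k (r i) = f k (r k)" if "i \<ge> k" for i k
    using *[of k, rule_format, of "i - k" 0] that by (simp add: r_def)
  moreover have "strict_mono r"
    using subseq_diagseq by (auto simp: r_def strict_mono_def)
  ultimately show ?thesis by blast
qed

section \<open>The 2-adic absolute value and the strong triangle inequality\<close>

context dyadic_numbers
begin

lemma zero_mem: "0 \<in> K"
  using diff_mem[OF one_mem one_mem] by simp

lemma uminus_mem: "x \<in> K \<Longrightarrow> - x \<in> K"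
  using diff_mem[OF zero_mem] by simp

lemma add_mem: "x \<in> K \<Longrightarrow> y \<in> K \<Longrightarrow> x + y \<in> K"
  using diff_mem[OF _ uminus_mem] by fastforce

lemma divide_mem: "x \<in> K \<Longrightarrow> y \<in> K \<Longrightarrow> x / y \<in> K"
  by (simp add: divide_inverse mult_mem inverse_mem)

lemma of_nat_mem: "of_nat j \<in> K"
  by (induction j) (auto intro: zero_mem one_mem add_mem)

lemma of_int_mem: "of_int j \<in> K"
  by (cases j rule: int_cases2) (auto intro: of_nat_mem uminus_mem)

lemma two_power_mem: "2 ^ k \<in> K"
  using of_nat_mem[of "2 ^ k"] by simp

lemma of_rat_mem: "of_rat r \<in> K"
proof -
  obtain a b where "quotient_of r = (a, b)" by (cases "quotient_of r")
  then have "r = of_int a / of_int b" by (rule quotient_of_div)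
  then show ?thesis by (simp add: of_rat_divide divide_mem of_int_mem)
qed

lemma abs_of_int: "m \<noteq> 0 \<Longrightarrow> v (of_int m) = (1/2) ^ multiplicity 2 m"
  using abs_of_rat[of "of_int m"] by (simp add: dyadic_abs_def)

lemma abs_of_int_le_1: "v (of_int m) \<le> 1"
  using abs_of_int[of m] abs_eq_0_iff[OF zero_mem] by (cases "m = 0") (auto simp: power_le_one)

lemma abs_odd: "odd m \<Longrightarrow> v (of_int m) = 1"
  using abs_of_int[of m] by (cases "m = 0") (auto simp: not_dvd_imp_multiplicity_0)

lemma abs_one: "v 1 = 1"
  using abs_odd[of 1] by simp

lemma abs_two: "v 2 = 1/2"
  using abs_of_int[of 2] by simp

lemma abs_two_power: "v (2 ^ k) = (1/2) ^ k"
proof (induction k)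
  case 0
  then show ?case by (simp add: abs_one)
next
  case (Suc k)
  then show ?case using abs_mult[of 2 "2^k"] two_power_mem[of 1] two_power_mem[of k]
    by (simp add: abs_two)
qed

lemma abs_dvd_le: "2 ^ k dvd m \<Longrightarrow> v (of_int m) \<le> (1/2) ^ k"
proof -
  assume "2 ^ k dvd m"
  then obtain j where j: "m = 2 ^ k * j" by blast
  have "v (of_int m) = (1/2) ^ k * v (of_int j)"
    unfolding j using abs_mult[OF two_power_mem of_int_mem] by (simp add: abs_two_power)
  also have "\<dots> \<le> (1/2) ^ k * 1"
    by (intro mult_left_mono abs_of_int_le_1) auto
  finally show ?thesis by simp
qed

lemma abs_uminus: "x \<in> K \<Longrightarrow> v (- x) = v x"
  using abs_mult[of "-1" x] abs_odd[of "-1"] uminus_mem[OF one_mem] by simp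

lemma abs_minus_commute: "x \<in> K \<Longrightarrow> y \<in> K \<Longrightarrow> v (x - y) = v (y - x)"
  using abs_uminus[OF diff_mem[of x y]] by simp

lemma abs_divide: "x \<in> K \<Longrightarrow> y \<in> K \<Longrightarrow> y \<noteq> 0 \<Longrightarrow> v (x / y) = v x / v y"
  using abs_mult[of "x / y" y] divide_mem[of x y] abs_eq_0_iff[of y] by (simp add: field_simps)

text \<open>An even denominator in lowest terms would make the absolute value at least 2.\<close>

lemma odd_denominator:
  assumes "v (of_rat r) < 2"
  shows "\<exists>a b. odd b \<and> of_rat r = (of_int a / of_int b :: 'a)"
proof -
  obtain a b where ab: "quotient_of r = (a, b)" by (cases "quotient_of r")
  then have r: "r = of_int a / of_int b" by (rule quotient_of_div)
  have b0: "b > 0" using ab by (rule quotient_of_denom_pos)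
  have cop: "coprime a b" using ab by (rule quotient_of_coprime)
  have "odd b"
  proof
    assume e: "even b"
    then have a: "odd a" using cop by (metis coprime_common_divisor odd_one)
    then have "r \<noteq> 0" using r b0 by auto
    then have "v (of_rat r) = (1/2) powi (- int (multiplicity 2 b))"
      using ab a by (simp add: abs_of_rat dyadic_abs_def not_dvd_imp_multiplicity_0)
    also have "\<dots> = 2 ^ multiplicity 2 b"
      by (simp add: power_int_def power_divide)
    finally have eq: "v (of_rat r) = 2 ^ multiplicity 2 b" .
    have "1 \<le> multiplicity 2 b" using e b0 by (simp add: multiplicity_gt_zero_iff Suc_leI)
    then have "(2::real) ^ 1 \<le> 2 ^ multiplicity 2 b" by (intro power_increasing) auto
    then show False using eq assms by simp
  qed
  moreover have "of_rat r = (of_int a / of_int b :: 'a)" by (simp add: r of_rat_divide)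
  ultimately show ?thesis by blast
qed

text \<open>A rational at distance less than 1 from an element of absolute value at most 1 has
  absolute value less than 2, hence an odd denominator.\<close>

lemma dense_odd:
  assumes "x \<in> K" "v x \<le> 1" "0 < e" "e \<le> 1"
  shows "\<exists>a b. odd b \<and> v (x - of_int a / of_int b) < e"
proof -
  obtain r where r: "v (x - of_rat r) < e" using dense assms by blast
  have "v (of_rat r) = v (x + (of_rat r - x))" by simp
  also have "\<dots> \<le> v x + v (of_rat r - x)"
    using assms by (intro abs_triangle diff_mem of_rat_mem)
  also have "\<dots> < 2" using r assms abs_minus_commute[of x "of_rat r"] of_rat_mem[of r] by simp
  finally show ?thesis using odd_denominator[of r] r by metis
qed

text \<open>The axioms give the ordinary triangle inequality only. For rationals with odd
  denominator the strong one holds because \<open>b + a\<close> is again an integer, and density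
  carries it over to K.\<close>

lemma abs_one_plus_le:
  assumes "x \<in> K" "v x \<le> 1"
  shows "v (1 + x) \<le> 1"
proof (rule field_le_epsilon)
  fix e :: real assume "e > 0"
  then obtain a b where ab: "odd b" "v (x - of_int a / of_int b) < min e 1"
    using dense_odd[OF assms, of "min e 1"] by auto
  let ?r = "of_int a / of_int b :: 'a"
  have rK: "?r \<in> K" by (intro divide_mem of_int_mem)
  have b0: "b \<noteq> 0" using ab by auto
  have "v (1 + x) = v ((1 + ?r) + (x - ?r))" by simp
  also have "\<dots> \<le> v (1 + ?r) + v (x - ?r)"
    using assms rK by (intro abs_triangle add_mem diff_mem one_mem)
  also have "1 + ?r = of_int (b + a) / of_int b" using b0 by (simp add: field_simps)
  also have "v \<dots> = v (of_int (b + a))"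
    using abs_divide[OF of_int_mem of_int_mem, of b "b+a"] ab b0 by (simp add: abs_odd del: of_int_add)
  finally show "v (1 + x) \<le> 1 + e" using abs_of_int_le_1[of "b+a"] ab by simp
qed

lemma abs_ultrametric:
  assumes "x \<in> K" "y \<in> K"
  shows "v (x + y) \<le> max (v x) (v y)"
proof -
  have *: "v (x + y) \<le> v y" if "x \<in> K" "y \<in> K" "v x \<le> v y" for x y
  proof (cases "y = 0")
    case True
    then show ?thesis using that abs_eq_0_iff[of x] abs_eq_0_iff[of y] abs_nonneg[of x] by auto
  next
    case False
    then have vy: "v y > 0" using that abs_nonneg[of y] abs_eq_0_iff[of y] by force
    have "v (1 + x / y) \<le> 1"
      using that False vy by (intro abs_one_plus_le) (auto simp: abs_divide divide_mem)
    moreover have "v (x + y) = v y * v (1 + x / y)"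
      using that False abs_mult[of y "1 + x / y"] by (simp add: distrib_left add_mem one_mem divide_mem add.commute)
    ultimately show ?thesis using vy by (simp add: mult_left_le)
  qed
  show ?thesis using *[of x y] *[of y x] assms by (cases "v x \<le> v y") (auto simp: add.commute max_def)
qed

section \<open>The ring of 2-adic integers and its sequential compactness\<close>

definition val_ring :: "'a set" where "val_ring = {x \<in> K. v x \<le> 1}"

lemma val_ringD: "x \<in> val_ring \<Longrightarrow> x \<in> K"
  by (simp add: val_ring_def)

lemma val_ring_zero: "0 \<in> val_ring"
  using zero_mem abs_eq_0_iff[of 0] by (simp add: val_ring_def)

lemma val_ring_one: "1 \<in> val_ring"
  by (simp add: val_ring_def abs_one one_mem)

lemma val_ring_mult: "x \<in> val_ring \<Longrightarrow> y \<in> val_ring \<Longrightarrow> x * y \<in> val_ring"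
  by (auto simp: val_ring_def abs_mult mult_mem abs_nonneg intro!: mult_le_one)

lemma val_ring_add: "x \<in> val_ring \<Longrightarrow> y \<in> val_ring \<Longrightarrow> x + y \<in> val_ring"
  using abs_ultrametric[of x y] by (auto simp: val_ring_def add_mem)

lemma val_ring_uminus: "x \<in> val_ring \<Longrightarrow> - x \<in> val_ring"
  by (auto simp: val_ring_def abs_uminus uminus_mem)

lemma val_ring_diff: "x \<in> val_ring \<Longrightarrow> y \<in> val_ring \<Longrightarrow> x - y \<in> val_ring"
  using val_ring_add[OF _ val_ring_uminus] by fastforce

lemma val_ring_of_nat: "of_nat j \<in> val_ring"
  by (induction j) (auto intro: val_ring_zero val_ring_one val_ring_add)

lemma val_ring_two_power: "2 ^ k \<in> val_ring"
  using val_ring_of_nat[of "2 ^ k"] by simp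

lemma val_ring_sum: "(\<And>s. s \<in> S \<Longrightarrow> f s \<in> val_ring) \<Longrightarrow> sum f S \<in> val_ring"
  by (induction S rule: infinite_finite_induct) (auto intro: val_ring_zero val_ring_add)

lemma val_ring_div_iff: "x \<in> K \<Longrightarrow> x / 2 ^ k \<in> val_ring \<longleftrightarrow> v x \<le> (1/2) ^ k"
  by (simp add: val_ring_def abs_divide two_power_mem divide_mem abs_two_power field_simps)

text \<open>Natural numbers represent all residue classes: \<open>x\<close> is close to some
  quotient a/b with \<open>b\<close> odd, and \<open>b\<close> is invertible modulo
  \<open>2 ^ k\<close>.\<close>

lemma val_ring_residue:
  assumes "x \<in> val_ring"
  shows "\<exists>j::nat. j < 2 ^ k \<and> (x - of_nat j) / 2 ^ k \<in> val_ring"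
proof -
  have x: "x \<in> K" "v x \<le> 1" using assms by (auto simp: val_ring_def)
  obtain a b where ab: "odd b" "v (x - of_int a / of_int b) < (1/2) ^ k"
    using dense_odd[OF x, of "(1/2) ^ k"] by (auto simp: power_le_one)
  have b0: "b \<noteq> 0" using ab by auto
  have "coprime b (2 ^ k)" using ab by simp
  then obtain u w where uw: "u * b + w * 2 ^ k = 1"
    by (metis bezout_int coprime_iff_gcd_eq_1)
  \<comment> \<open>By the Bezout relation \<open>u\<close> inverts \<open>b\<close> modulo
    \<open>2 ^ k\<close>.\<close>
  define j where "j = nat ((a * u) mod 2 ^ k)"
  have jint: "int j = (a * u) mod 2 ^ k" by (simp add: j_def)
  have "int j < 2 ^ k" by (simp add: jint)
  then have j_less: "j < 2 ^ k" by (metis of_nat_less_iff of_nat_numeral of_nat_power)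
  have "a - b * (a * u) = a * w * 2 ^ k"
  proof -
    have "a = a * (u * b + w * 2 ^ k)" using uw by simp
    then show ?thesis by (simp add: algebra_simps)
  qed
  moreover have "2 ^ k dvd a * u - int j" by (simp add: jint minus_mod_eq_mult_div)
  ultimately have "2 ^ k dvd a - b * int j"
  proof -
    assume 1: "a - b * (a * u) = a * w * 2 ^ k" and 2: "2 ^ k dvd a * u - int j"
    have "a - b * int j = a * w * 2 ^ k + b * (a * u - int j)"
      using 1 by (simp add: algebra_simps)
    then show ?thesis using 2 by (simp add: dvd_add dvd_mult)
  qed
  then have "v (of_int (a - b * int j)) \<le> (1/2) ^ k" by (rule abs_dvd_le)
  moreover have "of_int a / of_int b - of_nat j = (of_int (a - b * int j) / of_int b :: 'a)"
    using b0 by (simp add: field_simps)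
  ultimately have 1: "v (of_int a / of_int b - of_nat j) \<le> (1/2) ^ k"
    using abs_divide[OF of_int_mem of_int_mem, of b "a - b * int j"] ab b0
    by (simp add: abs_odd del: of_int_diff)
  have "v (x - of_nat j) = v ((x - of_int a / of_int b) + (of_int a / of_int b - of_nat j))"
    by simp
  also have "\<dots> \<le> max (v (x - of_int a / of_int b)) (v (of_int a / of_int b - of_nat j))"
    using x by (intro abs_ultrametric diff_mem divide_mem of_int_mem of_nat_mem)
  also have "\<dots> \<le> (1/2) ^ k" using 1 ab by simp
  finally show ?thesis
    using j_less x val_ring_div_iff[of "x - of_nat j" k] diff_mem of_nat_mem by blast
qed

text \<open>A subsequence whose residue modulo \<open>2 ^ k\<close> is constant from index
  \<open>k\<close> on is Cauchy with an explicit rate. The rate is kept in the conclusion, so that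
  later arguments need divisibility only and no topology.\<close>

lemma val_ring_seq_compact:
  assumes X: "\<And>i. X i \<in> val_ring"
  shows "\<exists>r l. strict_mono (r :: nat \<Rightarrow> nat) \<and> l \<in> val_ring \<and> (\<forall>i. (X (r i) - l) / 2 ^ i \<in> val_ring)"
proof -
  obtain g :: "nat \<Rightarrow> nat \<Rightarrow> nat"
    where g: "\<And>k i. g k i < 2 ^ k \<and> (X i - of_nat (g k i)) / 2 ^ k \<in> val_ring"
    using val_ring_residue[OF X] by metis
  have "finite (range (g k))" for k
    using g by (intro finite_subset[of "range (g k)" "{..<2^k}"]) auto
  then have "\<exists>r::nat \<Rightarrow> nat. strict_mono r \<and> (\<forall>k. \<forall>i\<ge>k. g k (r i) = g k (r k))"
    by (rule subsequence_constant_classes)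
  then obtain r :: "nat \<Rightarrow> nat" where r: "strict_mono r" "\<forall>k. \<forall>i\<ge>k. g k (r i) = g k (r k)"
    by blast
  have XK: "X i \<in> K" for i by (rule val_ringD[OF X])
  have near: "v (X (r i) - X (r k)) \<le> (1/2) ^ k" if "i \<ge> k" for i k
  proof -
    have "(X (r i) - of_nat (g k (r i))) / 2 ^ k - (X (r k) - of_nat (g k (r k))) / 2 ^ k \<in> val_ring"
      using g by (intro val_ring_diff) auto
    moreover have "g k (r i) = g k (r k)" using r that by blast
    ultimately have "(X (r i) - X (r k)) / 2 ^ k \<in> val_ring"
      by (simp add: diff_divide_distrib)
    then show ?thesis using val_ring_div_iff[OF diff_mem[OF XK XK]] by simp
  qed
  have near2: "v (X (r i) - X (r j)) \<le> (1/2) ^ k" if "i \<ge> k" "j \<ge> k" for i j k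
  proof -
    have "v ((X (r i) - X (r k)) + (X (r k) - X (r j)))
        \<le> max (v (X (r i) - X (r k))) (v (X (r k) - X (r j)))"
      by (intro abs_ultrametric diff_mem XK)
    then show ?thesis using near[OF that(1)] near[OF that(2)] abs_minus_commute[OF XK XK, of "r k" "r j"]
      by simp
  qed
  have "\<exists>l\<in>K. (\<lambda>i. v (X (r i) - l)) \<longlonglongrightarrow> 0"
  proof (rule complete)
    fix e :: real assume "e > 0"
    then obtain k where "(1/2) ^ k < e" using real_arch_pow_inv[of e "1/2"] by auto
    then show "\<exists>N. \<forall>i\<ge>N. \<forall>j\<ge>N. v (X (r i) - X (r j)) < e"
      using near2 by (intro exI[of _ k]) (metis le_less_trans)
  qed (rule XK)
  then obtain l where l: "l \<in> K" "(\<lambda>i. v (X (r i) - l)) \<longlonglongrightarrow> 0" by blast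
  have lim: "v (X (r k) - l) \<le> (1/2) ^ k" for k
  proof -
    obtain i where i: "i \<ge> k" "v (X (r i) - l) < (1/2) ^ k"
    proof -
      have "eventually (\<lambda>i. v (X (r i) - l) < (1/2) ^ k) sequentially"
        using l(2) by (rule order_tendstoD) simp
      then obtain N where "\<forall>i\<ge>N. v (X (r i) - l) < (1/2) ^ k"
        by (auto simp: eventually_sequentially)
      then show ?thesis using that[of "max k N"] by simp
    qed
    have "v ((X (r k) - X (r i)) + (X (r i) - l)) \<le> max (v (X (r k) - X (r i))) (v (X (r i) - l))"
      by (intro abs_ultrametric diff_mem XK l)
    then show ?thesis using near2[of k k i] i by simp
  qed
  have in_A: "(X (r i) - l) / 2 ^ i \<in> val_ring" for i
    using lim[of i] val_ring_div_iff[of "X (r i) - l" i] diff_mem[OF XK l(1)] by blast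
  have "l \<in> val_ring"
    using val_ring_diff[OF X[of "r 0"] in_A[of 0]] by simp
  then show ?thesis using r(1) in_A by blast
qed

lemma val_ring_family_seq_compact:
  assumes "finite S" "\<And>i s. s \<in> S \<Longrightarrow> c i s \<in> val_ring"
  shows "\<exists>r l. strict_mono (r :: nat \<Rightarrow> nat) \<and>
           (\<forall>s\<in>S. l s \<in> val_ring \<and> (\<forall>i. (c (r i) s - l s) / 2 ^ i \<in> val_ring))"
  using assms
proof (induction S)
  case empty
  then show ?case by (intro exI[of _ id]) (auto simp: strict_mono_def)
next
  case (insert t S)
  then obtain r l where r: "strict_mono (r :: nat \<Rightarrow> nat)"
    "\<And>s i. s \<in> S \<Longrightarrow> l s \<in> val_ring \<and> (c (r i) s - l s) / 2 ^ i \<in> val_ring" by blast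
  obtain r' l' where r': "strict_mono (r' :: nat \<Rightarrow> nat)" "l' \<in> val_ring"
    "\<And>i. (c (r (r' i)) t - l') / 2 ^ i \<in> val_ring"
    using val_ring_seq_compact[of "\<lambda>i. c (r i) t"] insert.prems by blast
  have "(c (r (r' i)) s - l s) / 2 ^ i \<in> val_ring" if "s \<in> S" for s i
  proof -
    \<comment> \<open>Thinning preserves the rate of convergence because \<open>r'\<close> is at
      least the identity.\<close>
    have le: "i \<le> r' i" using r'(1) by (rule seq_suble)
    have "2 ^ (r' i - i) * ((c (r (r' i)) s - l s) / 2 ^ r' i) \<in> val_ring"
      using r(2)[OF that] by (intro val_ring_mult val_ring_two_power) auto
    then show ?thesis using le by (simp add: power_diff)
  qed
  then show ?case
    using r r' insert.hyps
    by (intro exI[of _ "r \<circ> r'"] exI[of _ "l(t := l')"]) (auto simp: strict_mono_def)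
qed

end

section \<open>Compact orders and discrete valuation rings\<close>

text \<open>Quotient rings are avoided: \<open>R_finite\<close> expresses finiteness of R modulo
  \<open>2 ^ k\<close> by a colouring with finitely many colours in which equal colours imply
  congruence. \<open>R_total\<close>, \<open>p_dvd\<close> and \<open>p_separated\<close> make R a
  discrete valuation ring with uniformizer \<open>p\<close>. Hensel's lemma is kept for one
  quadratic polynomial, whose derivative 2s + 1 is a unit on R.\<close>

locale henselian_dvr =
  fixes R :: "'a::field_char_0 set" and p :: 'a
  assumes R_one: "1 \<in> R"
    and R_diff: "x \<in> R \<Longrightarrow> y \<in> R \<Longrightarrow> x - y \<in> R"
    and R_mult: "x \<in> R \<Longrightarrow> y \<in> R \<Longrightarrow> x * y \<in> R"
    and R_total: "x \<in> R \<or> inverse x \<in> R"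
    and p_mem: "p \<in> R"
    and p_nonunit: "inverse p \<notin> R"
    and p_dvd: "x \<in> R \<Longrightarrow> inverse x \<notin> R \<Longrightarrow> x / p \<in> R"
    and p_separated: "x \<noteq> 0 \<Longrightarrow> \<exists>k::nat. x / p ^ k \<notin> R"
    and two_dvd: "2 / p \<in> R"
    and R_finite: "\<exists>f :: 'a \<Rightarrow> 'a. finite (f ` R) \<and> (\<forall>x\<in>R. \<forall>y\<in>R. f x = f y \<longrightarrow> (x - y) / 2 ^ k \<in> R)"
    and perfect: "x \<in> R \<Longrightarrow> \<exists>y\<in>R. (x - y\<^sup>2) / p \<in> R"
    and hensel: "c / p \<in> R \<Longrightarrow> \<exists>s. s / p \<in> R \<and> s\<^sup>2 + s + c = 0"

text \<open>
  A bounded order \<open>U\<close> in a finite extension of the 2-adic numbers. Its 2-adic filtration is a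
  valuation only up to a bounded error; \<open>R\<close> is recovered as the set of power-bounded elements.
\<close>

locale compact_order =
  fixes U R :: "'a::field_char_0 set"
  assumes U_zero: "0 \<in> U"
    and U_diff: "x \<in> U \<Longrightarrow> y \<in> U \<Longrightarrow> x - y \<in> U"
    and U_mult: "x \<in> U \<Longrightarrow> y \<in> U \<Longrightarrow> x * y \<in> U"
    and U_absorbing: "\<exists>k::nat. 2 ^ k * x \<in> U"
    and U_separated: "(\<And>k::nat. x / 2 ^ k \<in> U) \<Longrightarrow> x = 0"
    and U_compact: "(\<And>i. X i \<in> U) \<Longrightarrow>
      \<exists>r l. strict_mono (r :: nat \<Rightarrow> nat) \<and> l \<in> U \<and> (\<forall>i. (X (r i) - l) / 2 ^ i \<in> U)"
    and U_finite: "\<exists>f :: 'a \<Rightarrow> 'a. finite (f ` U) \<and> (\<forall>x\<in>U. \<forall>y\<in>U. f x = f y \<longrightarrow> (x - y) / 2 ^ k \<in> U)"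
    and R_power_bounded: "x \<in> R \<Longrightarrow> \<exists>E::nat. \<forall>m::nat. 2 ^ E * x ^ m \<in> U"
    and R_stabilizer: "(\<And>u. u \<in> U \<Longrightarrow> y * u \<in> U) \<Longrightarrow> y \<in> R"
    and R_root: "x ^ m \<in> R \<Longrightarrow> 0 < m \<Longrightarrow> x \<in> R"
begin

section \<open>The filtration of an order by powers of 2\<close>

lemma U_uminus: "x \<in> U \<Longrightarrow> - x \<in> U"
  using U_diff[OF U_zero, of x] by simp

lemma U_add: "x \<in> U \<Longrightarrow> y \<in> U \<Longrightarrow> x + y \<in> U"
  using U_diff[OF _ U_uminus, of x y] by simp

lemma U_of_nat_mult: "x \<in> U \<Longrightarrow> of_nat k * x \<in> U"
  by (induction k) (auto simp: distrib_right U_zero intro: U_add)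

lemma U_two_power_mult: "x \<in> U \<Longrightarrow> 2 ^ k * x \<in> U"
  using U_of_nat_mult[of x "2 ^ k"] by simp

lemma U_sum: "(\<And>s. s \<in> S \<Longrightarrow> f s \<in> U) \<Longrightarrow> sum f S \<in> U"
  by (induction S rule: infinite_finite_induct) (auto simp: U_zero intro: U_add)

text \<open>The set \<open>2 ^ k * U\<close>, with integer \<open>k\<close> so that every element of
  the field occurs in some level.\<close>

definition lev :: "int \<Rightarrow> 'a set" where "lev k = {x. x * 2 powi (- k) \<in> U}"

lemma lev_0: "lev 0 = U"
  by (simp add: lev_def)

lemma lev_int: "x \<in> lev (int k) \<longleftrightarrow> x / 2 ^ k \<in> U"
  by (simp add: lev_def power_int_minus divide_inverse)

lemma lev_neg_int: "x \<in> lev (- int k) \<longleftrightarrow> 2 ^ k * x \<in> U"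
  by (simp add: lev_def mult.commute)

lemma lev_antimono: "x \<in> lev k \<Longrightarrow> j \<le> k \<Longrightarrow> x \<in> lev j"
proof -
  assume x: "x \<in> lev k" and jk: "j \<le> k"
  have "x * 2 powi (- j) = 2 ^ nat (k - j) * (x * 2 powi (- k))"
  proof -
    have "(2::'a) powi (- j) = 2 powi (k - j) * 2 powi (- k)"
      by (subst power_int_add[symmetric]) auto
    also have "(2::'a) powi (k - j) = 2 ^ nat (k - j)" using jk by (simp add: power_int_def)
    finally show ?thesis by simp
  qed
  then show ?thesis using U_two_power_mult[of "x * 2 powi (- k)" "nat (k - j)"] x
    unfolding lev_def by (simp only: mem_Collect_eq)
qed

lemma lev_zero: "0 \<in> lev k"
  by (simp add: lev_def U_zero)

lemma lev_diff: "x \<in> lev k \<Longrightarrow> y \<in> lev k \<Longrightarrow> x - y \<in> lev k"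
  by (simp add: lev_def left_diff_distrib U_diff)

lemma lev_mult: "x \<in> lev j \<Longrightarrow> y \<in> lev k \<Longrightarrow> x * y \<in> lev (j + k)"
proof -
  assume "x \<in> lev j" "y \<in> lev k"
  then have "(x * 2 powi (- j)) * (y * 2 powi (- k)) \<in> U" by (simp add: lev_def U_mult)
  moreover have "(2::'a) powi (- (j + k)) = 2 powi (- j) * 2 powi (- k)"
    by (subst power_int_add[symmetric]) auto
  ultimately show ?thesis by (simp add: lev_def mult_ac)
qed

lemma lev_separated: "(\<And>k::nat. x \<in> lev (int k)) \<Longrightarrow> x = 0"
  using U_separated by (simp add: lev_int)

text \<open>The largest \<open>k\<close> with \<open>x\<close> in level \<open>k\<close>; an
  arbitrary value at 0. By \<open>lev_mult\<close> it is superadditive on products. It need not be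
  additive, since \<open>U\<close> need not be integrally closed.\<close>

definition ord2 :: "'a \<Rightarrow> int" where "ord2 x = (SOME k. x \<in> lev k \<and> x \<notin> lev (k + 1))"

lemma ord2_iff:
  assumes "x \<noteq> 0"
  shows "x \<in> lev k \<longleftrightarrow> k \<le> ord2 x"
proof -
  obtain i where i: "x \<in> lev (- int i)" using U_absorbing[of x] lev_neg_int by blast
  obtain j where j: "x \<notin> lev (int j)" using lev_separated assms by blast
  have ex: "\<exists>n. x \<notin> lev (- int i + int n)"
  proof
    show "x \<notin> lev (- int i + int (i + j))" using j by simp
  qed
  define n where "n = (LEAST n. x \<notin> lev (- int i + int n))"
  have n: "x \<notin> lev (- int i + int n)" unfolding n_def using ex by (rule LeastI_ex)
  have "n \<noteq> 0" using n i by (metis add.right_neutral of_nat_0)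
  then obtain n' where n': "n = Suc n'" by (cases n) auto
  have "x \<in> lev (- int i + int n')" using not_less_Least[of n' "\<lambda>n. x \<notin> lev (- int i + int n)"] n'
    by (simp add: n_def)
  then have "\<exists>k. x \<in> lev k \<and> x \<notin> lev (k + 1)" using n n' by (auto simp: add_ac)
  then have "x \<in> lev (ord2 x) \<and> x \<notin> lev (ord2 x + 1)" unfolding ord2_def by (rule someI_ex)
  then show ?thesis using lev_antimono[of x k "ord2 x + 1"] lev_antimono[of x "ord2 x" k] by force
qed

text \<open>Otherwise compactness would produce zero divisors as limits.\<close>

lemma ex_mult_defect:
  "\<exists>D::nat. \<forall>x\<in>U. \<forall>y\<in>U. x \<notin> lev 1 \<longrightarrow> y \<notin> lev 1 \<longrightarrow> x * y \<notin> lev (int D)"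
proof (rule ccontr)
  assume "\<not> ?thesis"
  then have "\<forall>D::nat. \<exists>x y. x \<in> U \<and> y \<in> U \<and> x \<notin> lev 1 \<and> y \<notin> lev 1 \<and> x * y \<in> lev (int D)" by blast
  then obtain X Y where XY: "\<And>i::nat. X i \<in> U" "\<And>i. Y i \<in> U" "\<And>i. X i \<notin> lev 1"
    "\<And>i. Y i \<notin> lev 1" "\<And>i. X i * Y i \<in> lev (int i)" by metis
  obtain r1 l where r1: "strict_mono (r1::nat \<Rightarrow> nat)" "l \<in> U" "\<forall>i. (X (r1 i) - l) / 2 ^ i \<in> U"
    using U_compact[of X] XY by blast
  obtain r2 m where r2: "strict_mono (r2::nat \<Rightarrow> nat)" "m \<in> U" "\<forall>i. (Y (r1 (r2 i)) - m) / 2 ^ i \<in> U"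
    using U_compact[of "\<lambda>i. Y (r1 i)"] XY by blast
  define x y where "x i = X (r1 (r2 i))" and "y i = Y (r1 (r2 i))" for i
  have r2i: "i \<le> r2 i" for i using r2(1) by (rule seq_suble)
  have r1i: "i \<le> r1 i" for i using r1(1) by (rule seq_suble)
  have x: "x i - l \<in> lev (int i)" for i
    using r1(3) lev_int[of _ "r2 i"] lev_antimono[of _ "int (r2 i)" "int i"] r2i[of i]
    by (simp add: x_def)
  have y: "y i - m \<in> lev (int i)" for i using r2(3) lev_int by (simp add: y_def)
  have xy: "x i * y i \<in> lev (int i)" for i
    using lev_antimono[OF XY(5)[of "r1 (r2 i)"], of "int i"] r1i[of "r2 i"] r2i[of i]
    by (simp add: x_def y_def)
  \<comment> \<open>The product of the limits differs from \<open>x i * y i\<close>, itself of level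
    \<open>i\<close>, by two terms of level \<open>i\<close>.\<close>
  have "l * m \<in> lev (int i)" for i
  proof -
    have 1: "(x i - l) * y i \<in> lev (int i)"
      using lev_mult[OF x[of i], of "y i" 0] XY(2) by (simp add: lev_0 y_def)
    have 2: "l * (y i - m) \<in> lev (int i)"
      using lev_mult[of l 0 "y i - m" "int i"] y r1(2) by (simp add: lev_0)
    have "x i * y i - (x i - l) * y i - l * (y i - m) \<in> lev (int i)"
      by (intro lev_diff xy 1 2)
    then show ?thesis by (simp add: algebra_simps)
  qed
  then have "l * m = 0" by (rule lev_separated)
  moreover have "l \<noteq> 0" using x[of 1] XY(3)[of "r1 (r2 1)"] by (auto simp: x_def)
  moreover have "m \<noteq> 0" using y[of 1] XY(4)[of "r1 (r2 1)"] by (auto simp: y_def)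
  ultimately show False by simp
qed

definition defect :: int where
  "defect = int (SOME D::nat. \<forall>x\<in>U. \<forall>y\<in>U. x \<notin> lev 1 \<longrightarrow> y \<notin> lev 1 \<longrightarrow> x * y \<notin> lev (int D))"

lemma defect_nonneg: "0 \<le> defect"
  by (simp add: defect_def)

lemma lev_scale: "x * 2 powi j \<in> lev (k + j) \<longleftrightarrow> x \<in> lev k"
proof -
  have "(2::'a) powi (- (k + j)) = 2 powi (- k) * 2 powi (- j)"
    by (subst power_int_add[symmetric]) auto
  moreover have "(2::'a) powi j * 2 powi (- j) = 1"
    by (subst power_int_add[symmetric]) auto
  ultimately have "x * 2 powi j * 2 powi (- (k + j)) = x * 2 powi (- k)"
    by (metis (no_types, lifting) mult.commute mult.left_commute mult.right_neutral)
  then show ?thesis unfolding lev_def by (simp only: mem_Collect_eq)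
qed

lemma ord2_mult_le:
  assumes "x \<noteq> 0" "y \<noteq> 0"
  shows "ord2 (x * y) \<le> ord2 x + ord2 y + defect"
proof -
  have D: "\<forall>x\<in>U. \<forall>y\<in>U. x \<notin> lev 1 \<longrightarrow> y \<notin> lev 1 \<longrightarrow> x * y \<notin> lev defect"
    unfolding defect_def using someI_ex[OF ex_mult_defect] .
  \<comment> \<open>Both factors are normalised to lie in \<open>U\<close> but not in 2U, where the
    definition of \<open>defect\<close> applies.\<close>
  define x' y' where "x' = x * 2 powi (- ord2 x)" and "y' = y * 2 powi (- ord2 y)"
  have "x' \<in> U" "x' \<notin> lev 1" "y' \<in> U" "y' \<notin> lev 1"
    using lev_scale[of x "- ord2 x" "ord2 x"] lev_scale[of x "- ord2 x" "ord2 x + 1"]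
      lev_scale[of y "- ord2 y" "ord2 y"] lev_scale[of y "- ord2 y" "ord2 y + 1"] assms
    by (auto simp: x'_def y'_def ord2_iff lev_0)
  then have "x' * y' \<notin> lev defect" using D by blast
  moreover have "x' * y' = x * y * 2 powi (- ord2 x - ord2 y)"
    unfolding x'_def y'_def by (simp add: power_int_diff power_int_minus divide_inverse mult_ac)
  ultimately have "x * y * 2 powi (- ord2 x - ord2 y) \<notin> lev defect" by simp
  then have "x * y \<notin> lev (ord2 x + ord2 y + defect)"
    using lev_scale[of "x * y" "- ord2 x - ord2 y" "ord2 x + ord2 y + defect"] by simp
  then show ?thesis using assms by (simp add: ord2_iff)
qed

text \<open>The order is not assumed to contain 1, so \<open>ord2 1\<close> may be negative and
  appears in the estimates that follow.\<close>

lemma ord2_one_ge: "- defect \<le> ord2 1"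
  using ord2_mult_le[of 1 1] by simp

text \<open>Each further factor \<open>x ^ m\<close> raises the level by at most
  \<open>ord2 (x ^ m) + defect\<close>, which is at most -1.\<close>

lemma ord2_power_decreasing:
  assumes "x \<noteq> 0" "ord2 (x ^ m) < - defect"
  shows "ord2 (x ^ (m * k)) \<le> ord2 1 - int k"
proof (induction k)
  case 0
  then show ?case by simp
next
  case (Suc k)
  have "ord2 (x ^ (m * Suc k)) \<le> ord2 (x ^ m) + ord2 (x ^ (m * k)) + defect"
    using ord2_mult_le[of "x ^ m" "x ^ (m * k)"] assms(1) by (simp add: power_add)
  then show ?case using Suc assms(2) by simp
qed

section \<open>Power-bounded elements form a valuation ring\<close>

lemma U_subset_R: "x \<in> U \<Longrightarrow> x \<in> R"
  by (rule R_stabilizer) (rule U_mult)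

lemma one_minus_U_mem_R: "1 - x \<in> U \<Longrightarrow> x \<in> R"
proof (rule R_stabilizer)
  fix u assume "1 - x \<in> U" "u \<in> U"
  then have "u - (1 - x) * u \<in> U" using U_diff U_mult by blast
  then show "x * u \<in> U" by (simp add: algebra_simps)
qed

text \<open>Either a positive power of \<open>x\<close> lies in \<open>U\<close>, or all of them
  have level between \<open>- defect\<close> and -1. In the second case the powers of the inverse
  have levels bounded below as well; by pigeonhole two powers of \<open>x\<close> agree modulo a
  high power of 2, so a positive power is congruent to 1 modulo \<open>U\<close> and therefore
  stabilises \<open>U\<close>.\<close>

lemma ord2_bounded_imp_R:
  assumes x: "x \<noteq> 0" and bd: "\<And>m. - defect \<le> ord2 (x ^ m)"
  shows "x \<in> R"
proof (cases "\<exists>m>0. x ^ m \<in> U")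
  case True
  then show ?thesis using U_subset_R R_root by blast
next
  case False
  have neg: "ord2 (x ^ m) < 0" if "m > 0" for m
  proof -
    have "x ^ m \<notin> lev 0" using False that unfolding lev_0 by blast
    then show ?thesis using ord2_iff[of "x ^ m" 0] x by simp
  qed
  have inv: "ord2 1 - defect \<le> ord2 (inverse x ^ m)" if "m > 0" for m
    using ord2_mult_le[of "x ^ m" "inverse x ^ m"] neg[OF that] x by (simp add: power_inverse)
  define d where "d = nat defect"
  \<comment> \<open>The summand \<open>d\<close> pays for scaling the powers of \<open>x\<close>
    into \<open>U\<close>, the other one for the later multiplication by
    \<open>inverse x ^ i\<close>.\<close>
  define k where "k = nat (2 * defect - ord2 1) + d"
  obtain f :: "'a \<Rightarrow> 'a" where f: "finite (f ` U)" "\<forall>x\<in>U. \<forall>y\<in>U. f x = f y \<longrightarrow> (x - y) / 2 ^ k \<in> U"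
    using U_finite by blast
  define g where "g m = 2 ^ d * x ^ m" for m
  have g: "g m \<in> U" for m
  proof -
    have "- int d \<le> ord2 (x ^ m)" using bd[of m] defect_nonneg by (simp add: d_def)
    then have "x ^ m \<in> lev (- int d)" using x by (simp only: ord2_iff power_not_zero simp_thms)
    then show ?thesis unfolding g_def lev_neg_int .
  qed
  have "finite ((\<lambda>m. f (g m)) ` {0<..})"
    using f(1) by (rule rev_finite_subset) (use g in auto)
  then obtain i j where ij: "0 < i" "0 < j" "i \<noteq> j" "f (g i) = f (g j)"
    using infinite_Ioi[of "0::nat"] finite_imageD[of "\<lambda>m. f (g m)" "{0<..}"] by (auto simp: inj_on_def)
  have main: "x \<in> R" if ij: "0 < i" "i < j" "f (g i) = f (g j)" for i j
  proof -
    have "(g i - g j) / 2 ^ k \<in> U" using f(2) g ij by blast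
    then have 1: "g i - g j \<in> lev (int k)" by (simp add: lev_int)
    have "x ^ i - x ^ j = (g i - g j) * 2 powi (- int d)"
      by (simp add: g_def power_int_minus divide_inverse right_diff_distrib mult_ac)
    then have 2: "x ^ i - x ^ j \<in> lev (int k - int d)"
      using 1 lev_scale[of "g i - g j" "- int d" "int k"] by simp
    have "inverse x ^ i \<in> lev (ord2 1 - defect)"
      using inv[OF ij(1)] x by (simp add: ord2_iff)
    then have "inverse x ^ i * (x ^ i - x ^ j) \<in> lev ((ord2 1 - defect) + (int k - int d))"
      using 2 by (rule lev_mult)
    moreover have "inverse x ^ i * (x ^ i - x ^ j) = 1 - x ^ (j - i)"
      using x ij(2) by (simp add: right_diff_distrib power_inverse power_diff field_simps)
    ultimately have "1 - x ^ (j - i) \<in> lev ((ord2 1 - defect) + (int k - int d))" by simp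
    then have "1 - x ^ (j - i) \<in> lev 0"
      by (rule lev_antimono) (use defect_nonneg ord2_one_ge in \<open>simp add: k_def\<close>)
    then show ?thesis using one_minus_U_mem_R R_root[of x "j - i"] ij(2) by (simp add: lev_0)
  qed
  show ?thesis using main[of i j] main[of j i] ij by (cases i j rule: linorder_cases) auto
qed

text \<open>A single level below \<open>- defect\<close> would make the levels of the powers tend to
  minus infinity.\<close>

lemma power_bounded_imp_ord2:
  assumes "x \<noteq> 0" and bd: "\<And>m. 2 ^ E * x ^ m \<in> U"
  shows "- defect \<le> ord2 (x ^ m)"
proof (rule ccontr)
  assume "\<not> ?thesis"
  then have *: "ord2 (x ^ (m * k)) \<le> ord2 1 - int k" for k
    using ord2_power_decreasing assms(1) by simp
  have "- int E \<le> ord2 (x ^ k)" for k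
    using bd[of k] assms(1) by (simp add: lev_neg_int[symmetric] ord2_iff)
  then have "- int E \<le> ord2 1 - int k" for k using *[of k] order_trans by blast
  from this[of "nat (ord2 1 + int E + 1)"] show False by linarith
qed

lemma R_ord2: "x \<in> R \<Longrightarrow> x \<noteq> 0 \<Longrightarrow> - defect \<le> ord2 (x ^ m)"
  using R_power_bounded power_bounded_imp_ord2 by blast

lemma power_bounded_imp_R: "(\<And>m. 2 ^ E * x ^ m \<in> U) \<Longrightarrow> x \<in> R"
  using ord2_bounded_imp_R[of x] power_bounded_imp_ord2[of x] U_subset_R[OF U_zero] by (cases "x = 0") blast+

text \<open>If \<open>x\<close> fails, some power has level below \<open>- defect\<close>. The
  levels of further powers then fall without bound, those of the inverse powers rise, and an inverse
  power ends up in \<open>U\<close>.\<close>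

lemma R_valuation: "x \<in> R \<or> inverse x \<in> R"
proof (cases "x = 0 \<or> (\<forall>m. - defect \<le> ord2 (x ^ m))")
  case True
  then show ?thesis using ord2_bounded_imp_R[of x] U_subset_R[OF U_zero] by blast
next
  case False
  then obtain m where x: "x \<noteq> 0" and m: "ord2 (x ^ m) < - defect" by (auto simp: not_le)
  \<comment> \<open>The first \<open>defect\<close> steps lift the inverse power into
    \<open>U\<close>; the additional one keeps the exponent \<open>m * k\<close> positive.\<close>
  define k where "k = nat (defect + 1)"
  have "ord2 (x ^ (m * k)) \<le> ord2 1 - int k" using ord2_power_decreasing x m by blast
  moreover have "ord2 1 \<le> ord2 (x ^ (m * k)) + ord2 (inverse x ^ (m * k)) + defect"
    using ord2_mult_le[of "x ^ (m * k)" "inverse x ^ (m * k)"] x by (simp add: power_inverse)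
  ultimately have "0 \<le> ord2 (inverse x ^ (m * k))" using defect_nonneg by (simp add: k_def)
  then have "inverse x ^ (m * k) \<in> U" using x ord2_iff[of "inverse x ^ (m * k)" 0] by (simp add: lev_0)
  moreover have "m \<noteq> 0" using m ord2_one_ge by (intro notI) simp
  ultimately show ?thesis using U_subset_R R_root[of "inverse x" "m * k"] defect_nonneg
    by (simp add: k_def)
qed

lemma R_mult_mem: assumes "x \<in> R" "y \<in> R" shows "x * y \<in> R"
proof -
  obtain E F where EF: "\<And>m. 2 ^ E * x ^ m \<in> U" "\<And>m. 2 ^ F * y ^ m \<in> U"
    using R_power_bounded assms by metis
  have "2 ^ (E + F) * (x * y) ^ m \<in> U" for m
    using U_mult[OF EF(1)[of m] EF(2)[of m]] by (simp add: power_add power_mult_distrib mult_ac)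
  then show ?thesis by (rule power_bounded_imp_R)
qed

text \<open>Power-boundedness passes to sums by the binomial theorem, with the sum of the two
  exponents as the new bound.\<close>

lemma R_add_mem: assumes "x \<in> R" "y \<in> R" shows "x + y \<in> R"
proof -
  obtain E F where EF: "\<And>m. 2 ^ E * x ^ m \<in> U" "\<And>m. 2 ^ F * y ^ m \<in> U"
    using R_power_bounded assms by metis
  have "2 ^ (E + F) * (x + y) ^ m \<in> U" for m
  proof -
    have "2 ^ (E + F) * (x + y) ^ m =
        (\<Sum>k\<le>m. of_nat (m choose k) * ((2 ^ E * x ^ k) * (2 ^ F * y ^ (m - k))))"
      by (simp add: binomial_ring sum_distrib_left power_add mult_ac)
    also have "\<dots> \<in> U" by (intro U_sum U_of_nat_mult U_mult EF)
    finally show ?thesis .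
  qed
  then show ?thesis by (rule power_bounded_imp_R)
qed

lemma R_one_mem: "1 \<in> R"
  by (rule R_stabilizer) simp

lemma R_uminus_mem: "x \<in> R \<Longrightarrow> - x \<in> R"
  using R_mult_mem[of "-1" x] R_stabilizer[of "-1"] U_uminus by simp

lemma R_diff_mem: "x \<in> R \<Longrightarrow> y \<in> R \<Longrightarrow> x - y \<in> R"
  using R_add_mem[OF _ R_uminus_mem, of x y] by simp

lemma R_two_power: "2 ^ k \<in> R"
proof (induction k)
  case (Suc k)
  then show ?case using R_add_mem[OF Suc Suc] by simp
qed (simp add: R_one_mem)

lemma R_lev: "x \<in> R \<Longrightarrow> x \<in> lev (- defect)"
  using R_ord2[of x 1] by (cases "x = 0") (auto simp: lev_zero ord2_iff)

text \<open>Multiplication by \<open>2 ^ d\<close> maps R into \<open>U\<close>, so a colouring of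
  \<open>U\<close> modulo \<open>2 ^ (d + k)\<close> can be pulled back.\<close>

lemma R_finite_classes:
  "\<exists>f :: 'a \<Rightarrow> 'a. finite (f ` R) \<and> (\<forall>x\<in>R. \<forall>y\<in>R. f x = f y \<longrightarrow> (x - y) / 2 ^ k \<in> R)"
proof -
  define d where "d = nat defect"
  have d: "defect = int d" using defect_nonneg by (simp add: d_def)
  obtain f :: "'a \<Rightarrow> 'a"
    where f: "finite (f ` U)" "\<And>x y. x \<in> U \<Longrightarrow> y \<in> U \<Longrightarrow> f x = f y \<Longrightarrow> (x - y) / 2 ^ (d + k) \<in> U"
    using U_finite by metis
  have U: "2 ^ d * x \<in> U" if "x \<in> R" for x using R_lev[OF that] by (simp add: d lev_neg_int)
  have "(\<lambda>x. f (2 ^ d * x)) ` R \<subseteq> f ` U" using U by auto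
  moreover have "(x - y) / 2 ^ k \<in> R" if "x \<in> R" "y \<in> R" "f (2 ^ d * x) = f (2 ^ d * y)" for x y
    using U_subset_R[OF f(2)[OF U U]] that by (simp add: power_add right_diff_distrib[symmetric])
  ultimately show ?thesis using f(1) finite_subset by blast
qed

lemma half_notin_R: "inverse 2 \<notin> R"
proof
  assume "inverse 2 \<in> R"
  then obtain E where E: "\<And>m. 2 ^ E * inverse 2 ^ m \<in> U" using R_power_bounded by blast
  have "(2 ^ E :: 'a) = 0"
    by (rule U_separated) (use E in \<open>simp only: divide_inverse power_inverse\<close>)
  then show False by simp
qed

text \<open>Principal ideals between 2R and R are measured by the number of their residues modulo 2.
  A proper one with the most residues contains every nonunit: divisibility is total, so a nonunit
  outside it would generate a strictly larger proper ideal.\<close>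

lemma ex_uniformizer:
  "\<exists>p\<in>R. inverse p \<notin> R \<and> (\<forall>x\<in>R. inverse x \<notin> R \<longrightarrow> x / p \<in> R)"
proof -
  obtain f :: "'a \<Rightarrow> 'a"
    where f: "finite (f ` R)" "\<And>x y. x \<in> R \<Longrightarrow> y \<in> R \<Longrightarrow> f x = f y \<Longrightarrow> (x - y) / 2 \<in> R"
    using R_finite_classes[of 1] unfolding power_one_right by metis
  define I where "I z = {x. x / z \<in> R}" for z
  \<comment> \<open>The condition on \<open>2 / z\<close> makes \<open>I z\<close> a union of
    classes modulo 2, so that its set of colours determines it.\<close>
  define P where "P z \<longleftrightarrow> z \<in> R \<and> inverse z \<notin> R \<and> 2 / z \<in> R" for z
  have IR: "I z \<subseteq> R" if "P z" for z
  proof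
    fix x assume "x \<in> I z"
    then have "z * (x / z) \<in> R" using that R_mult_mem[of z "x / z"] by (simp add: I_def P_def)
    moreover have "z \<noteq> 0" using that half_notin_R U_subset_R[OF U_zero] by (auto simp: P_def)
    ultimately show "x \<in> R" by simp
  qed
  have fin: "finite (f ` I z)" "card (f ` I z) \<le> card (f ` R)" if "P z" for z
    using IR[OF that] f(1) by (auto intro: finite_subset card_mono image_mono)
  have "P 2" using R_two_power[of 1] half_notin_R by (simp add: P_def R_one_mem)
  then obtain p where p: "P p" "\<And>z. P z \<Longrightarrow> card (f ` I z) \<le> card (f ` I p)"
    using ex_has_greatest_nat[of P 2 "\<lambda>z. card (f ` I z)" "card (f ` R) + 1"] fin(2) le_imp_less_Suc
    by (metis Suc_eq_plus1)
  have p0: "p \<noteq> 0" using p(1) U_subset_R[OF U_zero] by (auto simp: P_def)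
  have "x / p \<in> R" if x: "x \<in> R" "inverse x \<notin> R" for x
  proof (rule ccontr)
    assume n: "x / p \<notin> R"
    have x0: "x \<noteq> 0" using n U_subset_R[OF U_zero] by auto
    have px: "p / x \<in> R" using R_valuation[of "x / p"] n by simp
    have "(2 / p) * (p / x) \<in> R" using px p(1) R_mult_mem unfolding P_def by blast
    moreover have "(2 / p) * (p / x) = 2 / x" using p0 by simp
    ultimately have Px: "P x" using x unfolding P_def by metis
    have "I p \<subseteq> I x"
    proof
      fix y assume "y \<in> I p"
      then have "(y / p) * (p / x) \<in> R" using px R_mult_mem unfolding I_def by blast
      moreover have "(y / p) * (p / x) = y / x" using p0 by simp
      ultimately show "y \<in> I x" unfolding I_def by (metis mem_Collect_eq)
    qed
    moreover have "f x \<notin> f ` I p"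
    proof
      assume "f x \<in> f ` I p"
      then obtain y where y: "y \<in> I p" "f x = f y" by auto
      then have "(x - y) / 2 \<in> R" using f(2) x IR[OF p(1)] by blast
      then have "(2 / p) * ((x - y) / 2) + y / p \<in> R"
        using p(1) y by (intro R_add_mem R_mult_mem) (auto simp: P_def I_def)
      moreover have "(2 / p) * ((x - y) / 2) + y / p = x / p" using p0 by (simp add: field_simps)
      ultimately show False using n by metis
    qed
    moreover have "x \<in> I x" using x0 R_one_mem by (simp add: I_def)
    ultimately have "f ` I p \<subset> f ` I x" by blast
    then have "card (f ` I p) < card (f ` I x)" using fin(1)[OF Px] by (rule psubset_card_mono[rotated])
    then show False using p(2)[OF Px] by simp
  qed
  then show ?thesis using p(1) by (auto simp: P_def)
qed

theorem ex_henselian_dvr: "\<exists>p. henselian_dvr R p"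
proof -
  obtain p where p: "p \<in> R" "inverse p \<notin> R" "\<And>x. x \<in> R \<Longrightarrow> inverse x \<notin> R \<Longrightarrow> x / p \<in> R"
    using ex_uniformizer by blast
  have R0: "0 \<in> R" by (rule U_subset_R[OF U_zero])
  have p0: "p \<noteq> 0" using p(2) R0 by auto
  have two: "2 / p \<in> R" using p(3)[of 2] R_two_power[of 1] half_notin_R by simp
  have half: "u / p \<in> R" if "u \<in> lev 1" for u
  proof -
    have "u / 2 \<in> R" using that lev_int[of u 1] U_subset_R by simp
    then have "(2 / p) * (u / 2) \<in> R" using two by (rule R_mult_mem[rotated])
    then show ?thesis by simp
  qed
  \<comment> \<open>Some power of \<open>inverse p\<close> has level below \<open>- defect\<close>,
    so the levels of suitable \<open>x / p ^ j\<close> tend to minus infinity, whereas levels on R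
    are bounded below.\<close>
  have sep: "\<exists>k::nat. x / p ^ k \<notin> R" if x: "x \<noteq> 0" for x
  proof (rule ccontr)
    assume "\<nexists>k::nat. x / p ^ k \<notin> R"
    then have all: "x / p ^ k \<in> R" for k by blast
    obtain m where m: "ord2 (inverse p ^ m) < - defect"
      using p(2) p0 ord2_bounded_imp_R[of "inverse p"] by (metis inverse_nonzero_iff_nonzero linorder_not_le)
    define k where "k = nat (ord2 x + ord2 1 + 2 * defect + 1)"
    have 1: "ord2 (inverse p ^ (m * k)) \<le> ord2 1 - int k"
      using m p0 by (intro ord2_power_decreasing) auto
    have "- defect \<le> ord2 (x / p ^ (m * k))" using R_ord2[OF all[of "m * k"], of 1] x p0 by simp
    also have "\<dots> \<le> ord2 x + ord2 (inverse p ^ (m * k)) + defect"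
      using ord2_mult_le[of x "inverse p ^ (m * k)"] x p0 by (simp add: divide_inverse power_inverse)
    also have "\<dots> \<le> ord2 x + ord2 1 - int k + defect" using 1 by simp
    finally show False unfolding k_def by linarith
  qed
  have prime: "x / p \<in> R" if x: "x \<in> R" "x\<^sup>2 / p \<in> R" for x
  proof (rule ccontr)
    assume "x / p \<notin> R"
    then have "inverse x \<in> R" "x \<noteq> 0" using p(3) x R0 by auto
    then have "(x\<^sup>2 / p) * (inverse x * inverse x) \<in> R" using x by (intro R_mult_mem)
    then show False using p(2) \<open>x \<noteq> 0\<close> by (simp add: power2_eq_square field_simps)
  qed
  \<comment> \<open>Squaring is additive modulo \<open>p\<close> because 2 is divisible by
    \<open>p\<close>. Hence it is injective on the finite residue field, and so surjective.\<close>
  have perf: "\<exists>y\<in>R. (x - y\<^sup>2) / p \<in> R" if x: "x \<in> R" for x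
  proof -
    obtain f :: "'a \<Rightarrow> 'a"
      where f: "finite (f ` R)" "\<And>x y. x \<in> R \<Longrightarrow> y \<in> R \<Longrightarrow> f x = f y \<Longrightarrow> (x - y) / 2 \<in> R"
      using R_finite_classes[of 1] unfolding power_one_right by metis
    define C where "C x = {y \<in> R. (x - y) / p \<in> R}" for x
    have Ceq: "C x = C y \<longleftrightarrow> (x - y) / p \<in> R" if "x \<in> R" "y \<in> R" for x y
    proof
      assume "C x = C y"
      moreover have "y \<in> C y" using that R0 by (simp add: C_def)
      ultimately have "y \<in> C x" by simp
      then show "(x - y) / p \<in> R" unfolding C_def by blast
    next
      assume *: "(x - y) / p \<in> R"
      have "(y - z) / p \<in> R \<longleftrightarrow> (x - z) / p \<in> R" for z
      proof -
        have "(x - y) / p + (y - z) / p = (x - z) / p" "(x - z) / p - (x - y) / p = (y - z) / p"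
          by (simp_all add: diff_divide_distrib)
        then show ?thesis using R_add_mem[OF *] R_diff_mem[OF _ *] by metis
      qed
      then show "C x = C y" unfolding C_def by blast
    qed
    have Cf: "C x = C y" if "x \<in> R" "y \<in> R" "f x = f y" for x y
    proof -
      have "(2 / p) * ((x - y) / 2) = (x - y) / p" using p0 by (simp add: field_simps)
      then show ?thesis using R_mult_mem[OF two f(2)[OF that]] Ceq[OF that(1,2)] by metis
    qed
    define T where "T = C ` R"
    have finT: "finite T"
    proof -
      define g where "g u = C (SOME x. x \<in> R \<and> f x = u)" for u
      have "C x = g (f x)" if "x \<in> R" for x
      proof -
        have "(SOME y. y \<in> R \<and> f y = f x) \<in> R \<and> f (SOME y. y \<in> R \<and> f y = f x) = f x"
          using that by (intro someI[of "\<lambda>y. y \<in> R \<and> f y = f x" x]) simp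
        then show ?thesis unfolding g_def using Cf that by metis
      qed
      then have "T \<subseteq> g ` (f ` R)" unfolding T_def by blast
      then show ?thesis using f(1) finite_subset by blast
    qed
    define rep where "rep t = (SOME x. x \<in> R \<and> C x = t)" for t
    have rep: "rep t \<in> R \<and> C (rep t) = t" if "t \<in> T" for t
      using that someI_ex[of "\<lambda>x. x \<in> R \<and> C x = t"] by (auto simp: T_def rep_def)
    define sq where "sq t = C ((rep t)\<^sup>2)" for t
    have "inj_on sq T"
    proof
      fix s t assume st: "s \<in> T" "t \<in> T" "sq s = sq t"
      let ?a = "rep s" and ?b = "rep t"
      have ab: "?a \<in> R" "?b \<in> R" using rep st by auto
      have "(?a\<^sup>2 - ?b\<^sup>2) / p \<in> R"
        using st(3) Ceq[of "?a\<^sup>2" "?b\<^sup>2"] ab by (simp add: sq_def power2_eq_square R_mult_mem)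
      then have "(?a\<^sup>2 - ?b\<^sup>2) / p - (2 / p) * (?b * (?a - ?b)) \<in> R"
        using ab two by (intro R_diff_mem R_mult_mem)
      also have "(?a\<^sup>2 - ?b\<^sup>2) / p - (2 / p) * (?b * (?a - ?b)) = (?a - ?b)\<^sup>2 / p"
        using p0 by (simp add: field_simps power2_eq_square)
      finally have "(?a - ?b) / p \<in> R" using prime ab R_diff_mem by blast
      then have "C ?a = C ?b" using Ceq ab by blast
      then show "s = t" using rep st by auto
    qed
    moreover have "sq ` T \<subseteq> T" using rep R_mult_mem by (auto simp: sq_def T_def power2_eq_square)
    ultimately have "sq ` T = T" using finT by (intro endo_inj_surj)
    moreover have "C x \<in> T" using x by (simp add: T_def)
    ultimately obtain t where t: "t \<in> T" "C x = sq t" by blast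
    have "(rep t)\<^sup>2 \<in> R" using rep[OF t(1)] R_mult_mem by (simp add: power2_eq_square)
    then have "(x - (rep t)\<^sup>2) / p \<in> R" using Ceq[OF x] t(2) unfolding sq_def by blast
    then show ?thesis using rep t by blast
  qed
  \<comment> \<open>Fixed-point iteration for \<open>s = - c - s\<^sup>2\<close>. Consecutive
    differences gain the factor \<open>s (Suc i) + s i\<close>, which is divisible by
    \<open>p\<close>.\<close>
  have hens: "\<exists>s. s / p \<in> R \<and> s\<^sup>2 + s + c = 0" if c: "c / p \<in> R" for c
  proof -
    define s where "s = rec_nat 0 (\<lambda>_ s. - c - s\<^sup>2)"
    have s0: "s 0 = 0" and sS: "s (Suc i) = - c - (s i)\<^sup>2" for i by (auto simp: s_def)
    have PR: "x \<in> R" if "x / p \<in> R" for x using R_mult_mem[OF p(1) that] p0 by simp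
    have sp: "s i / p \<in> R" for i
    proof (induction i)
      case 0
      then show ?case by (simp add: s0 R0)
    next
      case (Suc i)
      have "- (c / p) - s i * (s i / p) \<in> R"
        using Suc c PR[OF Suc] by (intro R_diff_mem R_uminus_mem R_mult_mem)
      then show ?case by (simp add: sS diff_divide_distrib power2_eq_square)
    qed
    have step: "(s (Suc i) - s i) / p ^ Suc i \<in> R" for i
    proof (induction i)
      case 0
      then show ?case using R_uminus_mem[OF c] by (simp add: s0 sS)
    next
      case (Suc i)
      have "- ((s (Suc i) - s i) / p ^ Suc i) * (s (Suc i) / p + s i / p) \<in> R"
        by (intro R_mult_mem R_uminus_mem R_add_mem Suc sp)
      moreover have "- ((s (Suc i) - s i) / p ^ Suc i) * (s (Suc i) / p + s i / p)
          = ((s i)\<^sup>2 - (s (Suc i))\<^sup>2) / p ^ Suc (Suc i)"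
        using p0 by (simp add: divide_simps) (simp add: power2_eq_square algebra_simps)
      moreover have "(s i)\<^sup>2 - (s (Suc i))\<^sup>2 = s (Suc (Suc i)) - s (Suc i)"
        using sS[of "Suc i"] sS[of i] by simp
      ultimately show ?case by metis
    qed
    have res: "((s i)\<^sup>2 + s i + c) / p ^ Suc i \<in> R" for i
    proof -
      have "(s i)\<^sup>2 + s i + c = - (s (Suc i) - s i)" by (simp add: sS)
      then have "((s i)\<^sup>2 + s i + c) / p ^ Suc i = - ((s (Suc i) - s i) / p ^ Suc i)"
        by (simp only: minus_divide_left)
      then show ?thesis using R_uminus_mem[OF step[of i]] by metis
    qed
    \<comment> \<open>Compactness is available in \<open>U\<close> only, so the iterates are first
      scaled into \<open>U\<close> by \<open>2 ^ d\<close>.\<close>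
    obtain d where d: "defect = int d" using defect_nonneg nonneg_int_cases by blast
    have "2 ^ d * s i \<in> U" for i using R_lev[OF PR[OF sp[of i]]] by (simp add: d lev_neg_int)
    then obtain r l where r: "strict_mono (r::nat \<Rightarrow> nat)" "\<And>i. (2 ^ d * s (r i) - l) / 2 ^ i \<in> U"
      using U_compact[of "\<lambda>i. 2 ^ d * s i"] by blast
    define t where "t = l / 2 ^ d"
    have st: "s (r i) - t \<in> lev (int i - int d)" for i
    proof -
      have "(2 ^ d * s (r i) - l) * 2 powi (- int d) \<in> lev (int i + - int d)"
        using r(2)[of i] lev_int lev_scale by blast
      moreover have "(2 ^ d * s (r i) - l) * 2 powi (- int d) = s (r i) - t"
        by (simp add: t_def power_int_minus field_simps)
      ultimately show ?thesis by (metis diff_conv_add_uminus)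
    qed
    have "t / p \<in> R"
    proof -
      have "(s (r (Suc d)) - t) / p \<in> R" using half[of "s (r (Suc d)) - t"] st[of "Suc d"] by simp
      then have "s (r (Suc d)) / p - (s (r (Suc d)) - t) / p \<in> R" using sp by (intro R_diff_mem)
      then show ?thesis by (simp add: diff_divide_distrib)
    qed
    moreover have "t\<^sup>2 + t + c = 0"
    proof (rule ccontr)
      assume nz: "t\<^sup>2 + t + c \<noteq> 0"
      let ?T = "t\<^sup>2 + t + c"
      obtain k where k: "?T / p ^ k \<notin> R" using sep[OF nz] by blast
      have two_k: "2 ^ k / p ^ k \<in> R"
      proof (induction k)
        case (Suc k)
        then show ?case using R_mult_mem[OF two Suc] by simp
      qed (simp add: R_one_mem)
      \<comment> \<open>Large enough to leave level \<open>k\<close> after two losses of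
        \<open>defect\<close>, one from the scaling and one from the factor
        \<open>t + s (r i) + 1\<close>.\<close>
      define i where "i = k + 2 * d + k"
      have ik: "k \<le> Suc (r i)" using seq_suble[OF r(1), of i] by (simp add: i_def)
      have "p ^ j \<in> R" for j by (induction j) (auto intro: R_one_mem R_mult_mem p(1))
      then have "p ^ (Suc (r i) - k) * (((s (r i))\<^sup>2 + s (r i) + c) / p ^ Suc (r i)) \<in> R"
        by (intro R_mult_mem res)
      then have 1: "((s (r i))\<^sup>2 + s (r i) + c) / p ^ k \<in> R"
        using ik p0 by (simp add: power_diff del: power_Suc)
      have "t + s (r i) + 1 \<in> R"
        using PR[OF \<open>t / p \<in> R\<close>] PR[OF sp] by (intro R_add_mem R_one_mem)
      then have "(s (r i) - t) * (t + s (r i) + 1) \<in> lev ((int i - int d) + (- defect))"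
        using st R_lev by (intro lev_mult)
      then have "(s (r i) - t) * (t + s (r i) + 1) \<in> lev (int k)"
        by (rule lev_antimono) (simp add: d i_def)
      then have "(s (r i) - t) * (t + s (r i) + 1) / 2 ^ k \<in> R" using U_subset_R by (simp add: lev_int)
      then have 2: "(2 ^ k / p ^ k) * ((s (r i) - t) * (t + s (r i) + 1) / 2 ^ k) \<in> R"
        using two_k by (rule R_mult_mem[rotated])
      have "((s (r i))\<^sup>2 + s (r i) + c) / p ^ k
          - (2 ^ k / p ^ k) * ((s (r i) - t) * (t + s (r i) + 1) / 2 ^ k) \<in> R"
        using 1 2 by (rule R_diff_mem)
      moreover have "((s (r i))\<^sup>2 + s (r i) + c) / p ^ k
          - (2 ^ k / p ^ k) * ((s (r i) - t) * (t + s (r i) + 1) / 2 ^ k)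
          = ((s (r i))\<^sup>2 + s (r i) + c - (s (r i) - t) * (t + s (r i) + 1)) / p ^ k"
        using p0 by (simp add: diff_divide_distrib)
      moreover have "(s (r i))\<^sup>2 + s (r i) + c - (s (r i) - t) * (t + s (r i) + 1) = ?T"
        by (simp add: power2_eq_square algebra_simps)
      ultimately show False using k by metis
    qed
    ultimately show ?thesis by blast
  qed
  show ?thesis
  proof (rule exI, unfold_locales)
    show "1 \<in> R" by (rule R_one_mem)
    show "x - y \<in> R" if "x \<in> R" "y \<in> R" for x y using that by (rule R_diff_mem)
    show "x * y \<in> R" if "x \<in> R" "y \<in> R" for x y using that by (rule R_mult_mem)
    show "x \<in> R \<or> inverse x \<in> R" for x by (rule R_valuation)
    show "\<exists>f :: 'a \<Rightarrow> 'a. finite (f ` R) \<and> (\<forall>x\<in>R. \<forall>y\<in>R. f x = f y \<longrightarrow> (x - y) / 2 ^ k \<in> R)" for k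
      by (rule R_finite_classes)
  qed (fact p sep two perf hens)+
qed

end

section \<open>The ring of integers of a dyadic local field\<close>

context dyadic_numbers
begin

lemma val_ring_power_absorbs: "c \<in> K \<Longrightarrow> \<exists>k. 2 ^ k * c \<in> val_ring"
proof -
  assume c: "c \<in> K"
  have vc: "0 < v c + 1" using abs_nonneg[OF c] by simp
  then obtain k where k: "(1/2) ^ k < 1 / (v c + 1)"
    using real_arch_pow_inv[of "1 / (v c + 1)" "1/2"] by auto
  then have "(1/2) ^ k * (v c + 1) < 1" using vc by (simp add: field_simps)
  then have "(1/2) ^ k * v c \<le> 1" by (simp add: distrib_left) (smt (verit) zero_le_power zero_le_divide_1_iff)
  then show ?thesis
    using c abs_mult[OF two_power_mem c] mult_mem[OF two_power_mem c]
    by (auto simp: val_ring_def abs_two_power)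
qed

lemma val_ring_power_absorbs_family:
  assumes "finite S" "\<And>s. s \<in> S \<Longrightarrow> c s \<in> K"
  shows "\<exists>k. \<forall>s\<in>S. 2 ^ k * c s \<in> val_ring"
proof (rule uniform_eventual_bound[OF assms(1)])
  show "2 ^ Suc k * c s \<in> val_ring" if "2 ^ k * c s \<in> val_ring" for s k
    using val_ring_mult[OF val_ring_two_power[of 1] that] by (simp add: mult.assoc)
qed (use assms val_ring_power_absorbs in blast)

text \<open>A monic equation for \<open>x ^ m\<close> becomes one for \<open>x\<close> by composing
  it with the monomial of degree \<open>m\<close>.\<close>

lemma integral_power: "x ^ m \<in> ring_of_integers K v \<Longrightarrow> 0 < m \<Longrightarrow> x \<in> ring_of_integers K v"
proof -
  assume "x ^ m \<in> ring_of_integers K v" "0 < m"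
  then obtain q where q: "lead_coeff q = 1" "\<forall>i. coeff q i \<in> val_ring" "poly q (x ^ m) = 0"
    unfolding ring_of_integers_def val_ring_def by blast
  let ?q = "pcompose q (monom 1 m)"
  have "lead_coeff ?q = 1"
    using q(1) \<open>0 < m\<close> by (subst lead_coeff_comp) (auto simp: degree_monom_eq)
  moreover have "coeff ?q i \<in> val_ring" for i
    using q(2) by (intro coeff_pcompose_semiring_closed)
      (auto simp: val_ring_zero val_ring_one intro: val_ring_add val_ring_mult)
  moreover have "poly ?q x = 0" using q(3) by (simp add: poly_pcompose poly_monom)
  ultimately show ?thesis unfolding ring_of_integers_def val_ring_def by blast
qed

lemma val_ring_poly_mult:
  "(\<And>i. coeff f i \<in> val_ring) \<Longrightarrow> (\<And>i. coeff g i \<in> val_ring) \<Longrightarrow> coeff (f * g) i \<in> val_ring"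
  by (auto simp: coeff_mult intro!: val_ring_sum val_ring_mult)

lemma val_ring_poly_prod:
  "(\<And>s i. s \<in> S \<Longrightarrow> coeff (f s) i \<in> val_ring) \<Longrightarrow> coeff (prod f S) i \<in> val_ring"
proof (induction S arbitrary: i rule: infinite_finite_induct)
  case (insert s S)
  then show ?case by (auto intro!: val_ring_poly_mult)
qed (auto simp: val_ring_zero val_ring_one)

lemma val_ring_char_poly:
  assumes "M \<in> carrier_mat d d" "\<And>i j. i < d \<Longrightarrow> j < d \<Longrightarrow> M $$ (i, j) \<in> val_ring"
  shows "coeff (char_poly M) k \<in> val_ring"
proof -
  have entry: "coeff (char_poly_matrix M $$ (i, j)) k \<in> val_ring" if "i < d" "j < d" for i j k
    using assms that
    by (auto simp: char_poly_matrix_def val_ring_zero val_ring_one val_ring_uminus coeff_pCons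
      split: nat.splits)
  have sgn: "coeff (signof q * f) k \<in> val_ring" if "\<And>i. coeff f i \<in> val_ring"
    for q :: "nat \<Rightarrow> nat" and f :: "'a poly" and k
    using that by (cases q rule: sign_cases) (auto simp: val_ring_uminus)
  show ?thesis
    unfolding char_poly_def det_def'[OF char_poly_matrix_closed[OF assms(1)]] coeff_sum
  proof (intro val_ring_sum sgn val_ring_poly_prod entry)
    fix q i assume "q \<in> {q. q permutes {0..<d}}" "i \<in> {0..<d}"
    then show "i < d" "q i < d" using permutes_in_image[of q "{0..<d}" i] by auto
  qed
qed

text \<open>The determinant trick.\<close>

lemma integral_if_stabilizes:
  assumes "finite S" and nz: "t \<in> S" "t \<noteq> 0"
    and c: "\<And>s t. c s t \<in> val_ring" "\<And>s. s \<in> S \<Longrightarrow> y * s = (\<Sum>t\<in>S. c s t * t)"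
  shows "y \<in> ring_of_integers K v"
proof -
  obtain es where es: "set es = S" "distinct es" using finite_distinct_list[OF assms(1)] by blast
  define d where "d = length es"
  define M where "M = mat d d (\<lambda>(i, j). c (es ! i) (es ! j))"
  define w where "w = vec d (\<lambda>i. es ! i)"
  have M: "M \<in> carrier_mat d d" by (simp add: M_def)
  have "bij_betw ((!) es) {0..<d} S" using es bij_betw_nth[of es "{0..<d}" S]
    by (simp add: d_def lessThan_atLeast0)
  then have sum_es: "(\<Sum>t\<in>S. f t) = (\<Sum>i = 0..<d. f (es ! i))" for f :: "'a \<Rightarrow> 'a"
    by (rule sum.reindex_bij_betw[symmetric])
  have "M *\<^sub>v w = y \<cdot>\<^sub>v w"
  proof (rule eq_vecI)
    fix i assume "i < dim_vec (y \<cdot>\<^sub>v w)"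
    then have i: "i < d" by (simp add: w_def)
    have "(M *\<^sub>v w) $ i = (\<Sum>j = 0..<d. c (es ! i) (es ! j) * es ! j)"
      using i by (simp add: M_def w_def scalar_prod_def)
    also have "\<dots> = y * es ! i"
    proof -
      have "es ! i \<in> S" using i es by (auto simp: d_def)
      then show ?thesis using c(2)[of "es ! i"] sum_es[of "\<lambda>t. c (es ! i) t * t"] by simp
    qed
    finally show "(M *\<^sub>v w) $ i = (y \<cdot>\<^sub>v w) $ i" using i by (simp add: w_def)
  qed (simp add: M_def w_def)
  moreover have "w \<noteq> 0\<^sub>v d"
  proof
    obtain i where i: "i < d" "es ! i = t" using nz es by (metis d_def in_set_conv_nth)
    assume "w = 0\<^sub>v d"
    then have "w $ i = 0" using i by simp
    then show False using i nz by (simp add: w_def)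
  qed
  ultimately have "eigenvalue M y"
    unfolding eigenvalue_def eigenvector_def by (intro exI[of _ w]) (simp add: M_def w_def)
  then have "poly (char_poly M) y = 0" using eigenvalue_root_char_poly[OF M] by blast
  moreover have "coeff (char_poly M) k \<in> val_ring" for k
    using M by (rule val_ring_char_poly) (simp add: M_def c)
  moreover have "lead_coeff (char_poly M) = 1" using degree_monic_char_poly[OF M] by simp
  ultimately show ?thesis unfolding ring_of_integers_def val_ring_def by blast
qed

end

section \<open>The order spanned by a multiple of a basis of the field\<close>

locale integral_basis = dyadic_numbers +
  fixes S :: "'a set" and m :: nat
  assumes finite_S: "finite S"
    and span_S: "\<exists>c. (\<forall>s. c s \<in> K) \<and> x = (\<Sum>s\<in>S. c s * s)"
    and indep_S: "(\<And>s. c s \<in> K) \<Longrightarrow> (\<Sum>s\<in>S. c s * s) = 0 \<Longrightarrow> s \<in> S \<Longrightarrow> c s = 0"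
    and structure_S: "s \<in> S \<Longrightarrow> t \<in> S \<Longrightarrow>
      \<exists>c. (\<forall>u. c u \<in> val_ring) \<and> 2 ^ m * (s * t) = (\<Sum>u\<in>S. c u * u)"
begin

text \<open>The factor \<open>2 ^ m\<close> makes the module closed under products: of the two
  factors occurring in a product, one remains and the other clears the denominators of the structure
  constants.\<close>

definition Ord :: "'a set" where
  "Ord = {2 ^ m * (\<Sum>s\<in>S. c s * s) | c. \<forall>s. c s \<in> val_ring}"

lemma OrdI: "(\<And>s. c s \<in> val_ring) \<Longrightarrow> 2 ^ m * (\<Sum>s\<in>S. c s * s) \<in> Ord"
  by (auto simp: Ord_def)

lemma OrdD: "x \<in> Ord \<Longrightarrow> \<exists>c. (\<forall>s. c s \<in> val_ring) \<and> x = 2 ^ m * (\<Sum>s\<in>S. c s * s)"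
  by (auto simp: Ord_def)

lemma Ord_val_ring_mult: "a \<in> val_ring \<Longrightarrow> x \<in> Ord \<Longrightarrow> a * x \<in> Ord"
proof -
  assume a: "a \<in> val_ring" and "x \<in> Ord"
  then obtain c where c: "\<And>s. c s \<in> val_ring" "x = 2 ^ m * (\<Sum>s\<in>S. c s * s)" using OrdD by meson
  have "a * x = 2 ^ m * (\<Sum>s\<in>S. a * c s * s)" by (simp add: c(2) sum_distrib_left mult_ac)
  also have "\<dots> \<in> Ord" by (intro OrdI val_ring_mult a c)
  finally show ?thesis .
qed

lemma Ord_add: "x \<in> Ord \<Longrightarrow> y \<in> Ord \<Longrightarrow> x + y \<in> Ord"
proof -
  assume "x \<in> Ord" "y \<in> Ord"
  then obtain c d where c: "\<And>s. c s \<in> val_ring" "x = 2 ^ m * (\<Sum>s\<in>S. c s * s)"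
    and d: "\<And>s. d s \<in> val_ring" "y = 2 ^ m * (\<Sum>s\<in>S. d s * s)" using OrdD by meson
  have "x + y = 2 ^ m * (\<Sum>s\<in>S. (c s + d s) * s)"
    by (simp add: c(2) d(2) sum.distrib distrib_left distrib_right)
  also have "\<dots> \<in> Ord" by (intro OrdI val_ring_add c d)
  finally show ?thesis .
qed

lemma Ord_zero: "0 \<in> Ord"
  using OrdI[of "\<lambda>_. 0"] by (simp add: val_ring_zero)

lemma Ord_diff: "x \<in> Ord \<Longrightarrow> y \<in> Ord \<Longrightarrow> x - y \<in> Ord"
  using Ord_add[of x "-1 * y"] Ord_val_ring_mult[of "-1" y] val_ring_uminus[OF val_ring_one] by simp

lemma Ord_sum: "(\<And>s. s \<in> T \<Longrightarrow> f s \<in> Ord) \<Longrightarrow> sum f T \<in> Ord"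
  by (induction T rule: infinite_finite_induct) (auto intro: Ord_zero Ord_add)

lemma Ord_mult: "x \<in> Ord \<Longrightarrow> y \<in> Ord \<Longrightarrow> x * y \<in> Ord"
proof -
  assume "x \<in> Ord" "y \<in> Ord"
  then obtain c d where c: "\<And>s. c s \<in> val_ring" "x = 2 ^ m * (\<Sum>s\<in>S. c s * s)"
    and d: "\<And>s. d s \<in> val_ring" "y = 2 ^ m * (\<Sum>s\<in>S. d s * s)" using OrdD by meson
  have "x * y = (\<Sum>s\<in>S. \<Sum>t\<in>S. (c s * d t) * (2 ^ m * (2 ^ m * (s * t))))"
  proof -
    have "x * y = 2 ^ m * 2 ^ m * ((\<Sum>s\<in>S. c s * s) * (\<Sum>t\<in>S. d t * t))"
      unfolding c(2) d(2) by (simp only: mult_ac)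
    also have "\<dots> = (\<Sum>s\<in>S. \<Sum>t\<in>S. 2 ^ m * 2 ^ m * ((c s * s) * (d t * t)))"
      unfolding sum_product by (simp only: sum_distrib_left)
    finally show ?thesis by (simp only: mult_ac)
  qed
  also have "\<dots> \<in> Ord"
  proof (rule Ord_sum, rule Ord_sum, rule Ord_val_ring_mult)
    fix s t assume "s \<in> S" "t \<in> S"
    then obtain e where "\<And>u. e u \<in> val_ring" "2 ^ m * (s * t) = (\<Sum>u\<in>S. e u * u)"
      using structure_S by blast
    then show "2 ^ m * (2 ^ m * (s * t)) \<in> Ord" using OrdI[of e] by simp
  qed (intro val_ring_mult c d)
  finally show ?thesis .
qed

lemma unique_S:
  assumes "\<And>s. c s \<in> K" "\<And>s. d s \<in> K" "(\<Sum>s\<in>S. c s * s) = (\<Sum>s\<in>S. d s * s)" "s \<in> S"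
  shows "c s = d s"
  using indep_S[of "\<lambda>s. c s - d s" s] assms by (simp add: diff_mem sum_subtractf left_diff_distrib)

lemma Ord_absorbing: "\<exists>k. 2 ^ k * x \<in> Ord"
proof -
  obtain c where c: "\<And>s. c s \<in> K" "x / 2 ^ m = (\<Sum>s\<in>S. c s * s)" using span_S[of "x / 2 ^ m"] by blast
  obtain k where k: "\<forall>s\<in>S. 2 ^ k * c s \<in> val_ring"
    using val_ring_power_absorbs_family[OF finite_S] c(1) by metis
  let ?d = "\<lambda>s. if s \<in> S then 2 ^ k * c s else 0"
  have "x = 2 ^ m * (\<Sum>s\<in>S. c s * s)" using c(2) by (simp add: field_simps)
  then have "2 ^ k * x = 2 ^ m * (\<Sum>s\<in>S. ?d s * s)"
    by (simp add: sum_distrib_left mult_ac)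
  also have "\<dots> \<in> Ord" using k by (intro OrdI) (auto simp: val_ring_zero)
  finally show ?thesis by blast
qed

text \<open>By uniqueness of coordinates, each coordinate of \<open>x / 2 ^ m\<close> is divisible
  by all powers of 2.\<close>

lemma Ord_separated:
  assumes "\<And>k. x / 2 ^ k \<in> Ord"
  shows "x = 0"
proof -
  obtain c where c: "\<And>s. c s \<in> K" "x / 2 ^ m = (\<Sum>s\<in>S. c s * s)" using span_S[of "x / 2 ^ m"] by blast
  have "c s = 0" if s: "s \<in> S" for s
  proof -
    have "v (c s) \<le> (1/2) ^ k" for k
    proof -
      obtain d where d: "\<And>s. d s \<in> val_ring" "x / 2 ^ k = 2 ^ m * (\<Sum>s\<in>S. d s * s)"
        using OrdD[OF assms[of k]] by blast
      have "x / 2 ^ m = 2 ^ k * (\<Sum>s\<in>S. d s * s)" using d(2) by (simp add: field_simps)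
      then have "(\<Sum>s\<in>S. c s * s) = (\<Sum>s\<in>S. (2 ^ k * d s) * s)"
        unfolding c(2) by (simp add: sum_distrib_left mult.assoc)
      then have "c s = 2 ^ k * d s"
        using s by (rule unique_S[OF c(1) mult_mem[OF two_power_mem val_ringD[OF d(1)]]])
      then have "v (c s) = (1/2) ^ k * v (d s)"
        using abs_mult[OF two_power_mem val_ringD[OF d(1)]] by (simp add: abs_two_power)
      also have "\<dots> \<le> (1/2) ^ k * 1" using d(1)[of s] by (intro mult_left_mono) (auto simp: val_ring_def)
      finally show ?thesis by simp
    qed
    then have "\<not> 0 < v (c s)" using real_arch_pow_inv[of "v (c s)" "1/2"]
      by (meson half_gt_zero_iff leD one_less_numeral_iff less_divide_eq_1_pos semiring_norm(76)
        divide_less_eq_1_pos zero_less_numeral)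
    then show ?thesis using abs_nonneg[OF c(1)[of s]] abs_eq_0_iff[OF c(1)[of s]] by linarith
  qed
  then have "x / 2 ^ m = 0" using c(2) by simp
  then show ?thesis by simp
qed

lemma Ord_compact:
  assumes "\<And>i. X i \<in> Ord"
  shows "\<exists>r l. strict_mono (r :: nat \<Rightarrow> nat) \<and> l \<in> Ord \<and> (\<forall>i. (X (r i) - l) / 2 ^ i \<in> Ord)"
proof -
  have "\<forall>i. \<exists>c. (\<forall>s. c s \<in> val_ring) \<and> X i = 2 ^ m * (\<Sum>s\<in>S. c s * s)"
    using assms by (auto simp: Ord_def)
  then obtain c where c: "\<And>i s. c i s \<in> val_ring" "\<And>i. X i = 2 ^ m * (\<Sum>s\<in>S. c i s * s)" by metis
  obtain r l where r: "strict_mono (r :: nat \<Rightarrow> nat)"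
    "\<And>s. s \<in> S \<Longrightarrow> l s \<in> val_ring" "\<And>s i. s \<in> S \<Longrightarrow> (c (r i) s - l s) / 2 ^ i \<in> val_ring"
    using val_ring_family_seq_compact[OF finite_S, of c] c(1) by blast
  let ?l = "2 ^ m * (\<Sum>s\<in>S. l s * s)"
  have "(\<Sum>s\<in>S. l s * s) = (\<Sum>s\<in>S. (if s \<in> S then l s else 0) * s)" by (intro sum.cong) auto
  then have 1: "?l \<in> Ord" using OrdI[of "\<lambda>s. if s \<in> S then l s else 0"] r(2) val_ring_zero by simp
  have "(X (r i) - ?l) / 2 ^ i \<in> Ord" for i
  proof -
    let ?d = "\<lambda>s. if s \<in> S then (c (r i) s - l s) / 2 ^ i else 0"
    have "(X (r i) - ?l) / 2 ^ i = 2 ^ m * (\<Sum>s\<in>S. ?d s * s)"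
      unfolding c(2) by (simp add: right_diff_distrib[symmetric] sum_subtractf[symmetric]
          sum_divide_distrib[symmetric] left_diff_distrib diff_divide_distrib[symmetric])
    also have "\<dots> \<in> Ord" using r(3) val_ring_zero by (intro OrdI) auto
    finally show ?thesis .
  qed
  then show ?thesis using r(1) 1 by blast
qed

lemma Ord_finite:
  "\<exists>f :: 'a \<Rightarrow> 'a. finite (f ` Ord) \<and> (\<forall>x\<in>Ord. \<forall>y\<in>Ord. f x = f y \<longrightarrow> (x - y) / 2 ^ k \<in> Ord)"
proof -
  \<comment> \<open>Representatives modulo \<open>2 ^ k\<close>: the elements whose coordinates are
    natural numbers below \<open>2 ^ k\<close>.\<close>
  define T where "T = (\<lambda>j. 2 ^ m * (\<Sum>s\<in>S. of_nat (j s) * s)) ` (S \<rightarrow>\<^sub>E {..<(2::nat) ^ k})"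
  have finT: "finite T" unfolding T_def by (intro finite_imageI finite_PiE finite_S) auto
  have "\<exists>y\<in>T. (x - y) / 2 ^ k \<in> Ord" if x: "x \<in> Ord" for x
  proof -
    obtain c where c: "\<And>s. c s \<in> val_ring" "x = 2 ^ m * (\<Sum>s\<in>S. c s * s)" using OrdD[OF x] by blast
    obtain j :: "'a \<Rightarrow> nat" where j: "\<And>s. j s < 2 ^ k \<and> (c s - of_nat (j s)) / 2 ^ k \<in> val_ring"
      using val_ring_residue[OF c(1)] by metis
    let ?y = "2 ^ m * (\<Sum>s\<in>S. of_nat (restrict j S s) * s)"
    have "?y = 2 ^ m * (\<Sum>s\<in>S. of_nat (j s) * s)" by simp
    then have "(x - ?y) / 2 ^ k = 2 ^ m * (\<Sum>s\<in>S. ((c s - of_nat (j s)) / 2 ^ k) * s)"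
      unfolding c(2) by (simp add: right_diff_distrib[symmetric] sum_subtractf[symmetric]
          sum_divide_distrib[symmetric] left_diff_distrib diff_divide_distrib[symmetric])
    also have "\<dots> \<in> Ord" using j by (intro OrdI) auto
    finally have "(x - ?y) / 2 ^ k \<in> Ord" .
    moreover have "?y \<in> T" unfolding T_def using j by (intro imageI) auto
    ultimately show ?thesis by blast
  qed
  then obtain f where f: "\<And>x. x \<in> Ord \<Longrightarrow> f x \<in> T \<and> (x - f x) / 2 ^ k \<in> Ord" by metis
  have "(x - y) / 2 ^ k \<in> Ord" if "x \<in> Ord" "y \<in> Ord" "f x = f y" for x y
    using Ord_diff[of "(x - f x) / 2 ^ k" "(y - f y) / 2 ^ k"] f[OF that(1)] f[OF that(2)] that(3)
    by (simp add: diff_divide_distrib)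
  moreover have "f ` Ord \<subseteq> T" using f by blast
  ultimately show ?thesis using finT finite_subset by blast
qed

text \<open>One power of 2 serves for the powers of \<open>x\<close> below the degree. The monic
  equation expresses every higher power through lower ones without new denominators.\<close>

lemma integral_power_bounded:
  assumes "x \<in> ring_of_integers K v"
  shows "\<exists>E. \<forall>j. 2 ^ E * x ^ j \<in> Ord"
proof -
  obtain q where q: "lead_coeff q = 1" "\<And>i. coeff q i \<in> val_ring" "poly q x = 0"
    using assms unfolding ring_of_integers_def val_ring_def by blast
  define d where "d = degree q"
  have "\<exists>k. \<forall>i\<in>{..<d}. 2 ^ k * x ^ i \<in> Ord"
  proof (rule uniform_eventual_bound)
    show "2 ^ Suc k * x ^ i \<in> Ord" if "2 ^ k * x ^ i \<in> Ord" for i k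
      using Ord_val_ring_mult[OF val_ring_two_power[of 1] that] by (simp add: mult.assoc)
  qed (use Ord_absorbing in auto)
  then obtain E where E: "\<And>i. i < d \<Longrightarrow> 2 ^ E * x ^ i \<in> Ord" by blast
  have "0 = (\<Sum>i\<le>d. coeff q i * x ^ i)" using q(3) by (simp add: poly_altdef d_def)
  also have "\<dots> = (\<Sum>i<d. coeff q i * x ^ i) + x ^ d"
    using q(1) by (simp add: lessThan_Suc_atMost[symmetric] d_def)
  finally have xd: "x ^ d = - (\<Sum>i<d. coeff q i * x ^ i)" by (simp add: eq_neg_iff_add_eq_0 add.commute)
  have "2 ^ E * x ^ j \<in> Ord" for j
  proof (induction j rule: less_induct)
    case (less j)
    show ?case
    proof (cases "j < d")
      case False
      then have "x ^ j = x ^ (j - d) * x ^ d" by (simp flip: power_add)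
      then have "2 ^ E * x ^ j = (\<Sum>i<d. (- coeff q i) * (2 ^ E * x ^ (j - d + i)))"
        by (simp add: xd sum_distrib_left sum_negf power_add mult_ac)
      also have "\<dots> \<in> Ord"
        using False by (intro Ord_sum Ord_val_ring_mult val_ring_uminus q less) auto
      finally show ?thesis .
    qed (use E in auto)
  qed
  then show ?thesis by blast
qed

text \<open>After cancelling \<open>2 ^ m\<close>, multiplication by \<open>y\<close> acts on the
  basis through a matrix over \<open>val_ring\<close>.\<close>

lemma integral_if_stabilizes_Ord:
  assumes "\<And>u. u \<in> Ord \<Longrightarrow> y * u \<in> Ord"
  shows "y \<in> ring_of_integers K v"
proof -
  have S0: "s \<noteq> 0" if "s \<in> S" for s
  proof
    assume "s = 0"
    then have "(\<Sum>t\<in>S. (if t = s then 1 else 0) * t) = 0" by (intro sum.neutral) auto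
    then have "(if s = s then 1 else 0 :: 'a) = 0"
      using that by (intro indep_S[of "\<lambda>t. if t = s then 1 else 0" s]) (simp_all add: zero_mem one_mem)
    then show False by simp
  qed
  have "S \<noteq> {}" using span_S[of 1] by auto
  then obtain t where t: "t \<in> S" by blast
  have "\<exists>c. (\<forall>t. c t \<in> val_ring) \<and> (s \<in> S \<longrightarrow> y * s = (\<Sum>t\<in>S. c t * t))" for s
  proof (cases "s \<in> S")
    case True
    have "2 ^ m * (\<Sum>t\<in>S. (if t = s then 1 else 0) * t) \<in> Ord"
      by (intro OrdI) (auto simp: val_ring_zero val_ring_one)
    also have "(\<Sum>t\<in>S. (if t = s then 1 else 0) * t) = s"
      using True finite_S by (simp add: if_distrib[of "\<lambda>x. x * _"] cong: if_cong)
    finally have "y * (2 ^ m * s) \<in> Ord" by (rule assms)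
    then obtain c where "\<And>t. c t \<in> val_ring" "y * (2 ^ m * s) = 2 ^ m * (\<Sum>t\<in>S. c t * t)"
      using OrdD by meson
    then show ?thesis by (intro exI[of _ c]) auto
  qed (auto intro: exI[of _ "\<lambda>_. 0"] val_ring_zero)
  then obtain c where "\<And>s t. c s t \<in> val_ring" "\<And>s. s \<in> S \<Longrightarrow> y * s = (\<Sum>t\<in>S. c s t * t)" by metis
  then show ?thesis by (rule integral_if_stabilizes[OF finite_S t S0[OF t]])
qed

sublocale order: compact_order Ord "ring_of_integers K v"
  by unfold_locales
    (fact Ord_zero Ord_diff Ord_mult Ord_absorbing Ord_separated Ord_compact Ord_finite
      integral_power_bounded integral_if_stabilizes_Ord integral_power)+

end

context dyadic_local_field
begin

text \<open>A spanning set of least cardinality is independent, since a nontrivial relation over K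
  would express one of its elements through the others.\<close>

lemma ex_basis:
  "\<exists>S. finite S \<and> (\<forall>x. \<exists>c. (\<forall>s. c s \<in> K) \<and> x = (\<Sum>s\<in>S. c s * s)) \<and>
     (\<forall>c. (\<forall>s. c s \<in> K) \<longrightarrow> (\<Sum>s\<in>S. c s * s) = 0 \<longrightarrow> (\<forall>s\<in>S. c s = 0))"
proof -
  define spans where "spans S \<longleftrightarrow> finite S \<and> (\<forall>x. \<exists>c. (\<forall>s. c s \<in> K) \<and> x = (\<Sum>s\<in>S. c s * s))"
    for S :: "'a set"
  obtain S0 where "finite S0" "subset_span K (*) S0 = UNIV" using finite_extension by blast
  then have "finite S0" "x \<in> {(\<Sum>x\<in>S0. c x * x) | c. \<forall>x. c x \<in> K}" for x
    using subset_span_finite[of S0 K "(*)"] zero_mem by auto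
  then have "spans S0" by (auto simp: spans_def)
  then obtain S where S: "spans S" "\<And>T. spans T \<Longrightarrow> card S \<le> card T"
    using ex_has_least_nat[of spans S0 card] by blast
  have "c s0 = 0" if c: "\<forall>s. c s \<in> K" "(\<Sum>s\<in>S. c s * s) = 0" "s0 \<in> S" for c s0
  proof (rule ccontr)
    assume nz: "c s0 \<noteq> 0"
    let ?T = "S - {s0}"
    have fin: "finite S" using S(1) by (simp add: spans_def)
    have split: "(\<Sum>s\<in>S. f s) = f s0 + (\<Sum>s\<in>?T. f s)" for f :: "'a \<Rightarrow> 'a"
      using fin c(3) by (rule sum.remove)
    have s0: "s0 = - (\<Sum>s\<in>?T. (c s / c s0) * s)"
    proof -
      have "c s0 * s0 + (\<Sum>s\<in>?T. c s * s) = 0" using c(2) split by metis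
      moreover have "c s0 * (\<Sum>s\<in>?T. (c s / c s0) * s) = (\<Sum>s\<in>?T. c s * s)"
        using nz by (simp add: sum_distrib_left)
      ultimately have "c s0 * (s0 + (\<Sum>s\<in>?T. (c s / c s0) * s)) = 0" by (simp add: distrib_left)
      then show ?thesis using nz by (simp add: add_eq_0_iff2)
    qed
    have "\<exists>d. (\<forall>s. d s \<in> K) \<and> x = (\<Sum>s\<in>?T. d s * s)" for x
    proof -
      obtain d where d: "\<And>s. d s \<in> K" "x = (\<Sum>s\<in>S. d s * s)" using S(1) by (auto simp: spans_def)
      have "x = d s0 * s0 + (\<Sum>s\<in>?T. d s * s)" unfolding d(2) by (rule split)
      also have "d s0 * s0 = (\<Sum>s\<in>?T. - (d s0 * (c s / c s0)) * s)"
        by (subst s0) (simp add: sum_distrib_left sum_negf mult.assoc)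
      finally have "x = (\<Sum>s\<in>?T. (- (d s0 * (c s / c s0)) + d s) * s)"
        by (simp only: sum.distrib[symmetric] distrib_right)
      moreover have "- (d s0 * (c s / c s0)) + d s \<in> K" for s
        using c(1) d(1) by (intro add_mem uminus_mem mult_mem divide_mem) auto
      ultimately show ?thesis by (intro exI[of _ "\<lambda>s. - (d s0 * (c s / c s0)) + d s"]) blast
    qed
    then have "spans ?T" using fin by (simp add: spans_def)
    then have "card S \<le> card ?T" by (rule S(2))
    then show False using fin c(3) card_Diff1_less[of S s0] by simp
  qed
  then show ?thesis using S(1) unfolding spans_def by blast
qed

theorem ring_of_integers_henselian_dvr: "\<exists>p. henselian_dvr (ring_of_integers K v) p"
proof -
  obtain S where S: "finite S" "\<And>x. \<exists>c. (\<forall>s. c s \<in> K) \<and> x = (\<Sum>s\<in>S. c s * s)"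
    "\<And>c. (\<forall>s. c s \<in> K) \<Longrightarrow> (\<Sum>s\<in>S. c s * s) = 0 \<Longrightarrow> (\<forall>s\<in>S. c s = 0)"
    using ex_basis by blast
  obtain co where co: "\<And>x s. co x s \<in> K" "\<And>x. x = (\<Sum>s\<in>S. co x s * s)" using S(2) by metis
  \<comment> \<open>Clears the coordinates of the finitely many products of basis elements.\<close>
  obtain m where m: "\<forall>(s, t, u) \<in> S \<times> S \<times> S. 2 ^ m * co (s * t) u \<in> val_ring"
    using val_ring_power_absorbs_family[of "S \<times> S \<times> S" "\<lambda>(s, t, u). co (s * t) u"] S(1) co(1) by auto
  interpret integral_basis K v S m
  proof unfold_locales
    show "finite S" by (rule S)
    show "\<exists>c. (\<forall>s. c s \<in> K) \<and> x = (\<Sum>s\<in>S. c s * s)" for x by (rule S)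
    show "c s = 0" if "\<And>s. c s \<in> K" "(\<Sum>s\<in>S. c s * s) = 0" "s \<in> S" for c s
      using S(3)[of c] that by blast
    fix s t assume st: "s \<in> S" "t \<in> S"
    let ?c = "\<lambda>u. if u \<in> S then 2 ^ m * co (s * t) u else 0"
    have "2 ^ m * (s * t) = (\<Sum>u\<in>S. ?c u * u)"
      using arg_cong[OF co(2)[of "s * t"], of "(*) (2 ^ m)"] by (simp add: sum_distrib_left mult.assoc)
    moreover have "?c u \<in> val_ring" for u using m st val_ring_zero by auto
    ultimately show "\<exists>c. (\<forall>u. c u \<in> val_ring) \<and> 2 ^ m * (s * t) = (\<Sum>u\<in>S. c u * u)"
      by (intro exI[of _ ?c]) blast
  qed
  show ?thesis by (rule order.ex_henselian_dvr)
qed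

end

section \<open>Lattices over a discrete valuation ring\<close>

context henselian_dvr
begin

lemma R_zero: "0 \<in> R"
  using R_diff[OF R_one R_one] by simp

lemma R_uminus: "x \<in> R \<Longrightarrow> - x \<in> R"
  using R_diff[OF R_zero] by simp

lemma R_add: "x \<in> R \<Longrightarrow> y \<in> R \<Longrightarrow> x + y \<in> R"
  using R_diff[OF _ R_uminus, of x y] by simp

lemma R_two: "2 \<in> R"
  using R_add[OF R_one R_one] by simp

lemma R_power: "x \<in> R \<Longrightarrow> x ^ k \<in> R"
  by (induction k) (auto intro: R_one R_mult)

lemma R_square: "x \<in> R \<Longrightarrow> x\<^sup>2 \<in> R"
  by (rule R_power)

lemma p_nonzero: "p \<noteq> 0"
  using p_nonunit R_zero by auto

text \<open>The maximal ideal pR.\<close>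

definition P :: "'a set" where "P = {x. x / p \<in> R}"

lemma P_R: "x \<in> P \<Longrightarrow> x \<in> R"
  using R_mult[OF p_mem, of "x / p"] p_nonzero by (simp add: P_def)

lemma P_zero: "0 \<in> P"
  by (simp add: P_def R_zero)

lemma P_add: "x \<in> P \<Longrightarrow> y \<in> P \<Longrightarrow> x + y \<in> P"
  by (simp add: P_def add_divide_distrib R_add)

lemma P_diff: "x \<in> P \<Longrightarrow> y \<in> P \<Longrightarrow> x - y \<in> P"
  by (simp add: P_def diff_divide_distrib R_diff)

lemma P_uminus: "x \<in> P \<Longrightarrow> - x \<in> P"
  using P_diff[OF P_zero] by simp

lemma P_mult: "x \<in> P \<Longrightarrow> y \<in> R \<Longrightarrow> x * y \<in> P"
  using R_mult[of "x / p" y] by (simp add: P_def)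

lemma P_mult': "x \<in> R \<Longrightarrow> y \<in> P \<Longrightarrow> x * y \<in> P"
  using P_mult[of y x] by (simp add: mult.commute)

lemma P_p_mult: "x \<in> R \<Longrightarrow> p * x \<in> P"
  using p_nonzero by (simp add: P_def)

lemma P_two: "2 \<in> P"
  using two_dvd by (simp add: P_def)

lemma P_one: "1 \<notin> P"
  using p_nonunit by (simp add: P_def divide_inverse)

lemma nonunit_P: "x \<in> R \<Longrightarrow> inverse x \<notin> R \<Longrightarrow> x \<in> P"
  using p_dvd by (simp add: P_def)

lemma unit_inverse: "x \<in> R \<Longrightarrow> x \<notin> P \<Longrightarrow> inverse x \<in> R"
  using nonunit_P by blast

lemma unit_nonzero: "x \<notin> P \<Longrightarrow> x \<noteq> 0"
  using P_zero by auto

lemma unit_mult: "x \<in> R \<Longrightarrow> x \<notin> P \<Longrightarrow> y \<notin> P \<Longrightarrow> x * y \<notin> P"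
proof
  assume x: "x \<in> R" "x \<notin> P" and y: "y \<notin> P" and xy: "x * y \<in> P"
  have "inverse x * (x * y) \<in> P" using P_mult'[OF unit_inverse[OF x] xy] .
  then show False using y unit_nonzero[OF x(2)] by (simp add: mult.assoc[symmetric])
qed

lemma notin_R_inverse_P: "x \<notin> R \<Longrightarrow> inverse x \<in> P"
  using R_total[of x] nonunit_P[of "inverse x"] by auto

lemma divide_notin_R: "y \<noteq> 0 \<Longrightarrow> x / y \<notin> R \<Longrightarrow> y / x \<in> P"
  using notin_R_inverse_P[of "x / y"] by simp

text \<open>Squares fill the residue field, so some \<open>t\<close> satisfies
  \<open>t\<^sup>2 = - a / c\<close> modulo \<open>p\<close>. In the applications \<open>a\<close>
  and \<open>c\<close> are norms, possibly divided by \<open>p\<close>, and \<open>t\<close> says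
  which multiple of one vector to add to another.\<close>

lemma perfect_solve:
  assumes "a \<in> R" "c \<in> R" "c \<notin> P"
  shows "\<exists>t\<in>R. a + t\<^sup>2 * c \<in> P"
proof -
  have "- a * inverse c \<in> R" using assms by (intro R_mult R_uminus unit_inverse)
  then obtain t where t: "t \<in> R" "- a * inverse c - t\<^sup>2 \<in> P"
    using perfect[of "- a * inverse c"] by (auto simp: P_def)
  have "- ((- a * inverse c - t\<^sup>2) * c) \<in> P" using t assms by (intro P_uminus P_mult)
  also have "- ((- a * inverse c - t\<^sup>2) * c) = a + t\<^sup>2 * c"
    using unit_nonzero[OF assms(3)] by (simp add: field_simps)
  finally show ?thesis using t by blast
qed

text \<open>Separatedness provides a power \<open>p ^ k\<close> that works, and \<open>2 ^ k\<close>
  is a multiple of \<open>p ^ k\<close>.\<close>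

lemma two_power_absorbs: "\<exists>k. 2 ^ k * c \<in> R"
proof (cases "c = 0")
  case False
  then obtain k where "inverse c / p ^ k \<notin> R" using p_separated[of "inverse c"] by auto
  then have "p ^ k * c \<in> R" using R_total[of "inverse c / p ^ k"] by (simp add: field_simps)
  then have "(2 / p) ^ k * (p ^ k * c) \<in> R" using R_mult[OF R_power[OF two_dvd]] by blast
  then show ?thesis using p_nonzero by (intro exI[of _ k]) (simp add: power_divide)
qed (use R_zero in auto)

text \<open>Divisibility is total, so one of finitely many elements has least valuation. This
  selects the generator for which a relation can be solved over R, or which generates a quotient of
  rank 1.\<close>

lemma ex_divides_all:
  assumes "finite S" "s \<in> S" "c s \<noteq> 0"
  shows "\<exists>t\<in>S. c t \<noteq> 0 \<and> (\<forall>s\<in>S. c s / c t \<in> R)"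
  using assms
proof (induction S arbitrary: s)
  case (insert u S)
  show ?case
  proof (cases "\<exists>s\<in>S. c s \<noteq> 0")
    case True
    then obtain t where t: "t \<in> S" "c t \<noteq> 0" "\<forall>s\<in>S. c s / c t \<in> R" using insert.IH by blast
    show ?thesis
    proof (cases "c u / c t \<in> R")
      case False
      then have cu: "c t / c u \<in> R" "c u \<noteq> 0" using R_total[of "c u / c t"] R_zero by auto
      have "c s / c u \<in> R" if "s \<in> S" for s
        using R_mult[OF cu(1), of "c s / c t"] t that by simp
      then show ?thesis using cu R_one by (intro bexI[of _ u]) auto
    qed (use t in auto)
  next
    case False
    then show ?thesis using insert.prems R_one R_zero by (intro bexI[of _ u]) auto
  qed
qed auto

end

section \<open>Dimensions of subsets of a finitely generated space\<close>

context vector_space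
begin

lemma basis_exists_in_span:
  assumes "finite S" "A \<subseteq> span S"
  shows "\<exists>E. E \<subseteq> A \<and> independent E \<and> A \<subseteq> span E \<and> finite E \<and> card E = dim A"
proof -
  obtain E where E: "E \<subseteq> A" "independent E" "A \<subseteq> span E" "card E = dim A"
    using basis_exists by blast
  then show ?thesis using independent_span_bound[OF assms(1) E(2)] assms(2) by blast
qed

lemma dim_less_if_notin_span:
  assumes "finite S" "A \<subseteq> C" "C \<subseteq> span S" "x \<in> C" "x \<notin> span A"
  shows "dim A < dim C"
proof -
  obtain E where E: "E \<subseteq> A" "independent E" "A \<subseteq> span E" "finite E" "card E = dim A"
    using basis_exists_in_span[of S A] assms by blast
  obtain D where D: "D \<subseteq> C" "C \<subseteq> span D" "finite D" "card D = dim C"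
    using basis_exists_in_span[of S C] assms by blast
  have "x \<notin> span E" using assms(5) span_mono[OF E(1)] by blast
  then have ind: "independent (insert x E)" using E(2) by (rule independent_insertI)
  have "insert x E \<subseteq> span D" using E(1) assms D(2) by blast
  then have "card (insert x E) \<le> card D" using independent_span_bound[OF D(3) ind] by blast
  moreover have "x \<notin> E" using \<open>x \<notin> span E\<close> span_base by blast
  ultimately show ?thesis using E D by simp
qed

lemma span_eq_if_dim_eq:
  assumes "finite S" "A \<subseteq> C" "C \<subseteq> span S" "dim A = dim C"
  shows "span A = span C"
proof -
  have "C \<subseteq> span A" using dim_less_if_notin_span[OF assms(1-3)] assms(4) by auto
  then show ?thesis using assms(2) by (metis span_mono span_span subset_antisym)
qed

lemma dim_linear_image_eq:
  assumes "Vector_Spaces.linear scale scale g" "finite S" "A \<subseteq> span S" "\<And>x. x \<in> span A \<Longrightarrow> g x = 0 \<Longrightarrow> x = 0"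
  shows "dim (g ` A) = dim A"
proof -
  interpret g: Vector_Spaces.linear scale scale g by fact
  obtain E where E: "E \<subseteq> A" "independent E" "A \<subseteq> span E" "finite E" "card E = dim A"
    using basis_exists_in_span[OF assms(2,3)] by blast
  have inj: "inj_on g (span E)"
    unfolding g.inj_on_iff_eq_0[OF subspace_span]
  proof (intro ballI impI)
    fix x assume "x \<in> span E" "g x = 0"
    then show "x = 0" using assms(4)[of x] subsetD[OF span_mono[OF E(1)]] by blast
  qed
  have "independent (g ` E)" using g.independent_injective_image[OF E(2) inj] .
  moreover have "g ` A \<subseteq> span (g ` E)" unfolding g.span_image using E(3) by (rule image_mono)
  moreover have "card (g ` E) = card E"
    by (rule card_image) (rule inj_on_subset[OF inj span_superset])
  ultimately show ?thesis using dim_unique[OF image_mono[OF E(1), of g]] E(5) by metis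
qed

lemma linear_inj_surj_on_subspace:
  assumes g: "Vector_Spaces.linear scale scale g" and V: "subspace V" "finite S" "V \<subseteq> span S"
    and "g ` V \<subseteq> V" "\<And>x. x \<in> V \<Longrightarrow> g x = 0 \<Longrightarrow> x = 0"
  shows "g ` V = V"
proof -
  interpret g: Vector_Spaces.linear scale scale g by fact
  have sp: "span V = V" using V(1) by (simp only: span_eq_iff)
  have "dim (g ` V) = dim V"
    by (rule dim_linear_image_eq[OF g V(2,3)]) (unfold sp, rule assms(6))
  then have "span (g ` V) = span V" by (rule span_eq_if_dim_eq[OF V(2) assms(5) V(3)])
  then show ?thesis using g.span_image[of V] sp by simp
qed

end

text \<open>The form is bilinear on the whole type; finiteness and non-degeneracy are asked only of
  the spans of individual sets.\<close>

locale dvr_quadratic = henselian_dvr R p + vector_space scale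
  for R :: "'a::field_char_0 set" and p :: 'a
    and scale :: "'a \<Rightarrow> 'v::ab_group_add \<Rightarrow> 'v" (infixr \<open>*s\<close> 75) +
  fixes B :: "'v \<Rightarrow> 'v \<Rightarrow> 'a"
  assumes B_sym: "B x y = B y x"
    and B_add: "B (x + y) z = B x z + B y z"
    and B_scale: "B (c *s x) y = c * B x y"
begin

definition Q :: "'v \<Rightarrow> 'a" where "Q x = B x x"

text \<open>The polar form of \<open>Q\<close>. Integral norms make it integral, whereas
  \<open>B\<close> itself may acquire the denominator 2.\<close>

definition b :: "'v \<Rightarrow> 'v \<Rightarrow> 'a" where "b x y = 2 * B x y"

lemma b_sym: "b x y = b y x"
  by (simp add: b_def B_sym)

lemma b_add_left: "b (x + y) z = b x z + b y z"
  by (simp add: b_def B_add distrib_left)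

lemma b_add_right: "b z (x + y) = b z x + b z y"
  using b_add_left by (simp add: b_sym)

lemma b_scale_left: "b (c *s x) y = c * b x y"
  by (simp add: b_def B_scale)

lemma b_scale_right: "b y (c *s x) = c * b y x"
  using b_scale_left by (simp add: b_sym)

lemma b_zero_left [simp]: "b 0 y = 0"
  using b_scale_left[of 0 0 y] by simp

lemma b_zero_right [simp]: "b y 0 = 0"
  by (subst b_sym) simp

lemma b_uminus_left: "b (- x) y = - b x y"
  using b_add_left[of x "- x" y] by (simp add: eq_neg_iff_add_eq_0 add.commute)

lemma b_uminus_right: "b y (- x) = - b y x"
  using b_uminus_left by (simp add: b_sym)

lemma b_diff_left: "b (x - y) z = b x z - b y z"
  using b_add_left[of x "- y" z] by (simp add: b_uminus_left)

lemma b_diff_right: "b z (x - y) = b z x - b z y"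
  using b_diff_left by (simp add: b_sym)

lemmas b_simps = b_add_left b_add_right b_scale_left b_scale_right b_uminus_left b_uminus_right
  b_diff_left b_diff_right

lemma b_self: "b x x = 2 * Q x"
  by (simp add: b_def Q_def)

lemma Q_add: "Q (x + y) = Q x + Q y + b x y"
  using B_add[of x y "x + y"] B_add[of x y x] B_add[of x y y] B_sym
  by (simp add: Q_def b_def algebra_simps)

lemma Q_scale: "Q (c *s x) = c\<^sup>2 * Q x"
  using B_scale[of c x "c *s x"] B_scale[of c x x] B_sym[of x "c *s x"]
  by (simp add: Q_def power2_eq_square mult.assoc)

lemma Q_zero [simp]: "Q 0 = 0"
  using Q_scale[of 0 0] by simp

lemma Q_uminus: "Q (- x) = Q x"
  using Q_scale[of "-1" x] by simp

lemma Q_diff: "Q (x - y) = Q x + Q y - b x y"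
  using Q_add[of x "- y"] by (simp add: Q_uminus b_uminus_right)

lemma b_eq_Q: "b x y = Q (x + y) - Q x - Q y"
  by (simp add: Q_add)

lemma b_span_eq_0:
  assumes "\<And>y. y \<in> S \<Longrightarrow> b x y = 0" "y \<in> span S"
  shows "b x y = 0"
  using assms(2) by (induction rule: span_induct_alt) (auto simp: b_simps assms(1))

definition nondeg :: "'v set \<Rightarrow> bool" where
  "nondeg V \<longleftrightarrow> (\<forall>x\<in>V. (\<forall>y\<in>V. b x y = 0) \<longrightarrow> x = 0)"

lemma nondegD: "nondeg (span S) \<Longrightarrow> x \<in> span S \<Longrightarrow> (\<And>s. s \<in> S \<Longrightarrow> b x s = 0) \<Longrightarrow> x = 0"
  unfolding nondeg_def using b_span_eq_0[of S x] by blast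

section \<open>Submodules and finitely generated lattices\<close>

definition submod :: "'v set \<Rightarrow> bool" where
  "submod L \<longleftrightarrow> 0 \<in> L \<and> (\<forall>x\<in>L. \<forall>y\<in>L. x + y \<in> L) \<and> (\<forall>c\<in>R. \<forall>x\<in>L. c *s x \<in> L)"

lemma submodI:
  "0 \<in> L \<Longrightarrow> (\<And>x y. x \<in> L \<Longrightarrow> y \<in> L \<Longrightarrow> x + y \<in> L) \<Longrightarrow> (\<And>c x. c \<in> R \<Longrightarrow> x \<in> L \<Longrightarrow> c *s x \<in> L) \<Longrightarrow> submod L"
  by (auto simp: submod_def)

lemma submod_zero: "submod L \<Longrightarrow> 0 \<in> L"
  and submod_add: "submod L \<Longrightarrow> x \<in> L \<Longrightarrow> y \<in> L \<Longrightarrow> x + y \<in> L"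
  and submod_scale: "submod L \<Longrightarrow> c \<in> R \<Longrightarrow> x \<in> L \<Longrightarrow> c *s x \<in> L"
  by (auto simp: submod_def)

lemma submod_uminus: "submod L \<Longrightarrow> x \<in> L \<Longrightarrow> - x \<in> L"
  using submod_scale[of L "-1" x] R_uminus[OF R_one] by simp

lemma submod_diff: "submod L \<Longrightarrow> x \<in> L \<Longrightarrow> y \<in> L \<Longrightarrow> x - y \<in> L"
  using submod_add[OF _ _ submod_uminus, of L x y] by simp

lemma submod_sum:
  "submod L \<Longrightarrow> (\<And>x. x \<in> S \<Longrightarrow> f x \<in> L) \<Longrightarrow> sum f S \<in> L"
  by (induction S rule: infinite_finite_induct) (auto intro: submod_zero submod_add)

abbreviation gen :: "'v set \<Rightarrow> 'v set" where "gen S \<equiv> subset_span R scale S"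

lemma gen_minimal: "submod L \<Longrightarrow> S \<subseteq> L \<Longrightarrow> gen S \<subseteq> L"
  by (auto simp: subset_span_def intro!: submod_sum submod_scale)

lemma gen_base: "x \<in> S \<Longrightarrow> x \<in> gen S"
  unfolding subset_span_def using R_one
  by (intro CollectI exI[of _ "{x}"] exI[of _ "\<lambda>_. 1"]) auto

lemma gen_finite: "finite S \<Longrightarrow> gen S = {(\<Sum>x\<in>S. c x *s x) | c. \<forall>x. c x \<in> R}"
  by (rule subset_span_finite) (auto simp: R_zero)

lemma submod_gen: "submod (gen S)"
proof (rule submodI)
  show "0 \<in> gen S" unfolding subset_span_def by (intro CollectI exI[of _ "{}"]) auto
next
  fix x y assume "x \<in> gen S" "y \<in> gen S"
  then obtain T c U d where T: "finite T" "T \<subseteq> S" "c ` T \<subseteq> R" "x = (\<Sum>x\<in>T. c x *s x)"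
    and U: "finite U" "U \<subseteq> S" "d ` U \<subseteq> R" "y = (\<Sum>x\<in>U. d x *s x)"
    by (auto simp: subset_span_def)
  have "x \<in> gen (T \<union> U)" "y \<in> gen (T \<union> U)" using T U by (auto simp: subset_span_def)
  then obtain c d where cd: "\<forall>x. c x \<in> R" "\<forall>x. d x \<in> R"
    "x = (\<Sum>x\<in>T \<union> U. c x *s x)" "y = (\<Sum>x\<in>T \<union> U. d x *s x)"
    using T U by (auto simp: gen_finite)
  have "x + y = (\<Sum>x\<in>T \<union> U. (c x + d x) *s x)"
    unfolding cd by (simp add: scale_left_distrib sum.distrib)
  then show "x + y \<in> gen S" unfolding subset_span_def using T U cd R_add
    by (intro CollectI exI[of _ "T \<union> U"] exI[of _ "\<lambda>x. c x + d x"]) auto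
next
  fix r x assume "r \<in> R" "x \<in> gen S"
  then obtain T c where T: "finite T" "T \<subseteq> S" "c ` T \<subseteq> R" "x = (\<Sum>x\<in>T. c x *s x)"
    by (auto simp: subset_span_def)
  have "r *s x = (\<Sum>x\<in>T. (r * c x) *s x)" unfolding T by (simp add: scale_sum_right)
  then show "r *s x \<in> gen S" unfolding subset_span_def using T \<open>r \<in> R\<close> R_mult
    by (intro CollectI exI[of _ T] exI[of _ "\<lambda>x. r * c x"]) auto
qed

lemma gen_mono: "S \<subseteq> T \<Longrightarrow> gen S \<subseteq> gen T"
  using gen_base by (intro gen_minimal submod_gen) auto

lemma subspace_submod: "subspace V \<Longrightarrow> submod V"
  by (intro submodI) (auto intro: subspace_0 subspace_add subspace_scale)

lemma gen_subset_span: "gen S \<subseteq> span S"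
  by (intro gen_minimal subspace_submod subspace_span) (rule span_superset)

lemma span_gen: "span (gen S) = span S"
proof
  show "span (gen S) \<subseteq> span S"
    using gen_subset_span by (intro span_minimal subspace_span)
  show "span S \<subseteq> span (gen S)" using gen_base by (intro span_mono) auto
qed

lemma gen_insert: "x \<in> gen (insert u S) \<longleftrightarrow> (\<exists>c\<in>R. \<exists>y\<in>gen S. x = c *s u + y)"
proof
  assume "x \<in> gen (insert u S)"
  moreover have "gen (insert u S) \<subseteq> {x. \<exists>c\<in>R. \<exists>y\<in>gen S. x = c *s u + y}"
  proof (rule gen_minimal)
    show "submod {x. \<exists>c\<in>R. \<exists>y\<in>gen S. x = c *s u + y}"
    proof (rule submodI)
      show "0 \<in> {x. \<exists>c\<in>R. \<exists>y\<in>gen S. x = c *s u + y}"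
        using R_zero submod_zero[OF submod_gen, of S] by (intro CollectI bexI[of _ 0]) auto
    next
      fix x y assume "x \<in> {x. \<exists>c\<in>R. \<exists>y\<in>gen S. x = c *s u + y}"
        "y \<in> {x. \<exists>c\<in>R. \<exists>y\<in>gen S. x = c *s u + y}"
      then obtain c d x' y' where *: "c \<in> R" "d \<in> R" "x' \<in> gen S" "y' \<in> gen S"
        "x = c *s u + x'" "y = d *s u + y'" by blast
      then have "x + y = (c + d) *s u + (x' + y')" by (simp add: scale_left_distrib)
      then show "x + y \<in> {x. \<exists>c\<in>R. \<exists>y\<in>gen S. x = c *s u + y}"
        using * R_add submod_add[OF submod_gen]
        by (intro CollectI bexI[of _ "c + d"] bexI[of _ "x' + y'"]) auto
    next
      fix r x assume "r \<in> R" "x \<in> {x. \<exists>c\<in>R. \<exists>y\<in>gen S. x = c *s u + y}"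
      then obtain c y where *: "c \<in> R" "y \<in> gen S" "x = c *s u + y" by blast
      then have "r *s x = (r * c) *s u + r *s y" by (simp add: scale_right_distrib)
      then show "r *s x \<in> {x. \<exists>c\<in>R. \<exists>y\<in>gen S. x = c *s u + y}"
        using * \<open>r \<in> R\<close> R_mult submod_scale[OF submod_gen]
        by (intro CollectI bexI[of _ "r * c"] bexI[of _ "r *s y"]) auto
    qed
    show "insert u S \<subseteq> {x. \<exists>c\<in>R. \<exists>y\<in>gen S. x = c *s u + y}"
    proof (intro insert_subsetI subsetI CollectI)
      show "\<exists>c\<in>R. \<exists>y\<in>gen S. u = c *s u + y"
        using R_one submod_zero[OF submod_gen] by (intro bexI[of _ 1] bexI[of _ 0]) auto
      show "\<exists>c\<in>R. \<exists>y\<in>gen S. s = c *s u + y" if "s \<in> S" for s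
        using R_zero gen_base[OF that] by (intro bexI[of _ 0] bexI[of _ s]) auto
    qed
  qed
  ultimately show "\<exists>c\<in>R. \<exists>y\<in>gen S. x = c *s u + y" by blast
next
  assume "\<exists>c\<in>R. \<exists>y\<in>gen S. x = c *s u + y"
  then show "x \<in> gen (insert u S)"
    using gen_mono[of S "insert u S"] gen_base[of u "insert u S"]
      submod_add[OF submod_gen] submod_scale[OF submod_gen] by blast
qed

lemma submod_linear_image:
  assumes "Vector_Spaces.linear scale scale g" "submod L"
  shows "submod (g ` L)"
proof -
  interpret g: Vector_Spaces.linear scale scale g by fact
  show ?thesis
  proof (rule submodI)
    show "0 \<in> g ` L" using submod_zero[OF assms(2)] g.zero by (metis image_eqI)
    fix x y assume "x \<in> g ` L" "y \<in> g ` L"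
    then obtain x' y' where "x = g x'" "y = g y'" "x' \<in> L" "y' \<in> L" by blast
    then show "x + y \<in> g ` L"
      using submod_add[OF assms(2)] g.add[of x' y'] by (intro image_eqI[of _ _ "x' + y'"]) auto
  next
    fix c x assume "c \<in> R" "x \<in> g ` L"
    then obtain x' where "x = g x'" "x' \<in> L" by blast
    then show "c *s x \<in> g ` L"
      using submod_scale[OF assms(2) \<open>c \<in> R\<close>] g.scale[of c x'] by (intro image_eqI[of _ _ "c *s x'"]) auto
  qed
qed

lemma span_two_power:
  assumes L: "submod L" and "x \<in> span L"
  shows "\<exists>k. 2 ^ k *s x \<in> L"
proof -
  have up: "2 ^ (j + k) *s x \<in> L" if "2 ^ k *s x \<in> L" for j k x
    using submod_scale[OF L R_power[OF R_two, of j] that] by (simp add: power_add)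
  show ?thesis using assms(2)
  proof (induction rule: span_induct_alt)
    case base
    then show ?case using submod_zero[OF L] by simp
  next
    case (step c x y)
    obtain i j where ij: "2 ^ i *s y \<in> L" "2 ^ j * c \<in> R" using step two_power_absorbs by blast
    have 1: "2 ^ j *s (c *s x) \<in> L" using submod_scale[OF L ij(2) step(1)] by simp
    have "2 ^ (i + j) *s (c *s x) + 2 ^ (j + i) *s y \<in> L"
      using up[OF 1, of i] up[OF ij(1), of j] by (intro submod_add[OF L])
    then have "2 ^ (i + j) *s (c *s x + y) \<in> L"
      by (simp only: scale_right_distrib add.commute[of j i])
    then show ?case by blast
  qed
qed

text \<open>A generating set of least cardinality is independent: dividing a relation by a
  coefficient of least valuation shows the corresponding generator to be redundant over R.\<close>

lemma gen_basis:
  assumes "finite S"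
  shows "\<exists>E. finite E \<and> independent E \<and> gen E = gen S"
proof -
  obtain E where E: "finite E \<and> gen E = gen S" "\<And>T. finite T \<and> gen T = gen S \<Longrightarrow> card E \<le> card T"
    using ex_has_least_nat[of "\<lambda>T. finite T \<and> gen T = gen S" S card] assms by blast
  have "independent E"
  proof
    assume "dependent E"
    then obtain c s where c: "s \<in> E" "c s \<noteq> 0" "(\<Sum>x\<in>E. c x *s x) = 0"
      using dependent_finite[of E] E(1) by blast
    obtain t where t: "t \<in> E" "c t \<noteq> 0" "\<forall>s\<in>E. c s / c t \<in> R"
      using ex_divides_all[of E s c] E(1) c by blast
    have "c t *s t + (\<Sum>x\<in>E - {t}. c x *s x) = 0"
      using c(3) sum.remove[of E t "\<lambda>x. c x *s x"] E(1) t(1) by simp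
    then have "inverse (c t) *s (c t *s t + (\<Sum>x\<in>E - {t}. c x *s x)) = 0" by simp
    then have "t + (\<Sum>x\<in>E - {t}. (c x / c t) *s x) = 0"
      using t(2) by (simp add: scale_right_distrib scale_sum_right divide_inverse mult.commute)
    then have "t = - (\<Sum>x\<in>E - {t}. (c x / c t) *s x)" by (simp add: eq_neg_iff_add_eq_0)
    also have "\<dots> \<in> gen (E - {t})"
      using t gen_base by (intro submod_uminus[OF submod_gen] submod_sum[OF submod_gen] submod_scale[OF submod_gen]) auto
    finally have "t \<in> gen (E - {t})" .
    then have "E \<subseteq> gen (E - {t})" using gen_base[of _ "E - {t}"] by fast
    then have "gen E \<subseteq> gen (E - {t})" by (rule gen_minimal[OF submod_gen])
    then have "gen (E - {t}) = gen E"
      using gen_mono[of "E - {t}" E] by (intro subset_antisym) auto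
    then have "card E \<le> card (E - {t})" using E by (intro E(2)) auto
    then show False using E(1) t(1) card_Diff1_less[of E t] by simp
  qed
  then show ?thesis using E(1) by blast
qed

lemma gen_independent_coeff:
  assumes "finite E" "independent E" "(\<Sum>x\<in>E. c x *s x) \<in> gen E" "s \<in> E"
  shows "c s \<in> R"
proof -
  obtain d where d: "\<forall>x. d x \<in> R" "(\<Sum>x\<in>E. c x *s x) = (\<Sum>x\<in>E. d x *s x)"
    using assms(1,3) by (auto simp: gen_finite)
  then have "(\<Sum>x\<in>E. (c x - d x) *s x) = 0"
    by (simp add: scale_left_diff_distrib sum_subtractf)
  then have "c s - d s = 0"
    using assms(2,4) dependent_finite[OF assms(1)] by metis
  then show ?thesis using d by simp
qed

section \<open>Integral and maximal lattices\<close>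

definition integral :: "'v set \<Rightarrow> bool" where "integral L \<longleftrightarrow> (\<forall>x\<in>L. Q x \<in> R)"

lemma integral_b: "integral L \<Longrightarrow> submod L \<Longrightarrow> x \<in> L \<Longrightarrow> y \<in> L \<Longrightarrow> b x y \<in> R"
  unfolding b_eq_Q integral_def by (blast intro: R_diff submod_add)

lemma integral_adjoin:
  assumes "integral L" "submod L" "Q x \<in> R" "\<And>y. y \<in> L \<Longrightarrow> b x y \<in> R"
  shows "integral {c *s x + y | c y. c \<in> R \<and> y \<in> L}"
proof -
  have "Q (c *s x + y) \<in> R" if "c \<in> R" "y \<in> L" for c y
    unfolding Q_add Q_scale b_scale_left using assms that unfolding integral_def
    by (intro R_add R_mult R_square) auto
  then show ?thesis by (auto simp: integral_def)
qed

text \<open>A lattice is maximal iff it contains every vector that can be adjoined to it integrally.\<close>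

definition maxl :: "'v set \<Rightarrow> bool" where
  "maxl L \<longleftrightarrow> submod L \<and> integral L \<and>
     (\<forall>x\<in>span L. Q x \<in> R \<longrightarrow> (\<forall>y\<in>L. b x y \<in> R) \<longrightarrow> x \<in> L)"

lemma maxl_submod: "maxl L \<Longrightarrow> submod L"
  and maxl_integral: "maxl L \<Longrightarrow> integral L"
  and maxlD: "maxl L \<Longrightarrow> x \<in> span L \<Longrightarrow> Q x \<in> R \<Longrightarrow> (\<And>y. y \<in> L \<Longrightarrow> b x y \<in> R) \<Longrightarrow> x \<in> L"
  by (auto simp: maxl_def)

lemma maxl_linear_image:
  assumes g: "Vector_Spaces.linear scale scale g" "\<And>x. x \<in> span L \<Longrightarrow> Q (g x) = Q x" and L: "maxl L"
  shows "maxl (g ` L)"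
proof -
  interpret g: Vector_Spaces.linear scale scale g by fact
  have b: "b (g x) (g y) = b x y" if "x \<in> span L" "y \<in> span L" for x y
    using g(2)[OF that(1)] g(2)[OF that(2)] g(2)[OF span_add[OF that]] unfolding b_eq_Q g.add by simp
  have "g x \<in> g ` L" if "x \<in> span L" "Q (g x) \<in> R" "\<forall>y\<in>L. b (g x) (g y) \<in> R" for x
    using that g(2) b span_base by (intro imageI maxlD[OF L]) auto
  then show ?thesis
    using maxl_integral[OF L] g(2) span_base submod_linear_image[OF g(1) maxl_submod[OF L]]
    by (auto simp: maxl_def g.span_image integral_def)
qed

end

section \<open>Existence and uniqueness of maximal lattices\<close>

context dvr_quadratic
begin

lemma linearI:
  "(\<And>x y. f (x + y) = f x + f y) \<Longrightarrow> (\<And>c x. f (c *s x) = c *s f x) \<Longrightarrow>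
    Vector_Spaces.linear scale scale f"
  by (simp add: Vector_Spaces.linear_iff vector_space_axioms)

lemma linear_add: "Vector_Spaces.linear scale scale f \<Longrightarrow> f (x + y) = f x + f y"
  and linear_scale: "Vector_Spaces.linear scale scale f \<Longrightarrow> f (c *s x) = c *s f x"
  by (simp_all add: Vector_Spaces.linear_iff)

lemma linear_span_image: "Vector_Spaces.linear scale scale g \<Longrightarrow> span (g ` S) = g ` span S"
proof -
  assume "Vector_Spaces.linear scale scale g"
  then interpret g: Vector_Spaces.linear scale scale g .
  show ?thesis by (rule g.span_image)
qed

lemma linear_sum_b:
  "finite E \<Longrightarrow> Vector_Spaces.linear scale scale (\<lambda>x. \<Sum>e\<in>E. b x e *s e)"
  by (rule linearI)
    (simp_all add: b_add_left b_scale_left scale_left_distrib sum.distrib scale_sum_right)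

text \<open>
  The map sending \<open>x\<close> to the combination of a basis \<open>E\<close> with coefficients \<open>b x e\<close> is
  bijective, so it provides a dual basis.
\<close>

lemma dual_bounded:
  assumes S: "finite S" and nd: "nondeg (span S)"
  shows "\<exists>m. \<forall>x\<in>span S. (\<forall>y\<in>gen S. b x y \<in> R) \<longrightarrow> 2 ^ m *s x \<in> gen S"
proof -
  obtain E where E: "finite E" "independent E" "gen E = gen S" using gen_basis[OF S] by blast
  have spE: "span E = span S" using E(3) span_gen by metis
  define g where "g x = (\<Sum>e\<in>E. b x e *s e)" for x
  have g: "Vector_Spaces.linear scale scale g" unfolding g_def using linear_sum_b[OF E(1)] .
  have coeff: "c e = d e" if "(\<Sum>e\<in>E. c e *s e) = (\<Sum>e\<in>E. d e *s e)" "e \<in> E" for c d e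
  proof -
    have "(\<Sum>e\<in>E. (c e - d e) *s e) = 0"
      using that(1) by (simp add: scale_left_diff_distrib sum_subtractf)
    then show ?thesis using that(2) E(2) dependent_finite[OF E(1)] by (metis right_minus_eq)
  qed
  have "g ` span E = span E"
  proof (rule linear_inj_surj_on_subspace[OF g subspace_span E(1) order_refl])
    show "g ` span E \<subseteq> span E"
      unfolding g_def by (intro image_subsetI span_sum span_scale) (rule span_base)
    fix x assume x: "x \<in> span E" "g x = 0"
    have "b x e = 0" if "e \<in> E" for e
      using coeff[of "b x" "\<lambda>_. 0" e] that x(2) by (simp add: g_def)
    then show "x = 0" using nondegD[of E x] nd x(1) by (simp add: spE)
  qed
  then have "\<forall>e\<in>E. \<exists>f\<in>span E. e = g f" using span_base by blast
  then obtain f where f: "\<And>e. e \<in> E \<Longrightarrow> f e \<in> span E" "\<And>e. e \<in> E \<Longrightarrow> g (f e) = e" by metis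
  have fe: "b (f e) e' = (if e' = e then 1 else 0)" if "e \<in> E" "e' \<in> E" for e e'
  proof -
    have "(\<Sum>x\<in>E. b (f e) x *s x) = (\<Sum>x\<in>E. (if x = e then 1 else 0) *s x)"
      using f(2)[OF that(1)] that(1) E(1) by (simp add: g_def if_distrib[of "\<lambda>c. c *s _"] cong: if_cong)
    then show ?thesis using coeff[of "b (f e)" "\<lambda>x. if x = e then 1 else 0" e'] that(2) by simp
  qed
  have "\<exists>m. \<forall>e\<in>E. 2 ^ m *s f e \<in> gen S"
  proof (rule uniform_eventual_bound[OF E(1)])
    show "2 ^ Suc k *s f e \<in> gen S" if "2 ^ k *s f e \<in> gen S" for e k
      using submod_scale[OF submod_gen R_two that] by simp
    show "\<exists>k. 2 ^ k *s f e \<in> gen S" if "e \<in> E" for e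
      using span_two_power[OF submod_gen, of "f e" S] f(1)[OF that] by (simp add: span_gen spE)
  qed
  then obtain m where m: "\<And>e. e \<in> E \<Longrightarrow> 2 ^ m *s f e \<in> gen S" by blast
  have "2 ^ m *s x \<in> gen S" if x: "x \<in> span S" "\<forall>y\<in>gen S. b x y \<in> R" for x
  proof -
    \<comment> \<open>The expansion of \<open>x\<close> in the dual basis: both vectors have the
      same pairings with \<open>E\<close>, so non-degeneracy identifies them.\<close>
    define y where "y = (\<Sum>e\<in>E. b x e *s f e)"
    have ysp: "y \<in> span E" unfolding y_def using f(1) by (intro span_sum span_scale)
    have bsum: "b (\<Sum>e\<in>A. h e) z = (\<Sum>e\<in>A. b (h e) z)" for A :: "'v set" and h z
      by (induction A rule: infinite_finite_induct) (auto simp: b_add_left)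
    have "b y e = b x e" if "e \<in> E" for e
    proof -
      have "b y e = (\<Sum>e'\<in>E. if e = e' then b x e' else 0)"
        unfolding y_def bsum by (intro sum.cong) (auto simp: b_scale_left fe that)
      then show ?thesis using E(1) that by simp
    qed
    then have "x - y = 0" using x(1) ysp nd
      by (intro nondegD[of E]) (auto simp: spE b_diff_left intro: span_diff)
    then have "2 ^ m *s x = 2 ^ m *s y" by simp
    also have "\<dots> = (\<Sum>e\<in>E. b x e *s (2 ^ m *s f e))"
      by (simp add: y_def scale_sum_right mult.commute)
    also have "\<dots> \<in> gen S"
    proof (rule submod_sum[OF submod_gen], rule submod_scale[OF submod_gen])
      fix e assume e: "e \<in> E"
      then show "b x e \<in> R" using x(2) gen_base[OF e] E(3) by blast
      show "2 ^ m *s f e \<in> gen S" by (rule m[OF e])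
    qed
    finally show ?thesis .
  qed
  then show ?thesis by blast
qed

text \<open>The colour of \<open>x\<close> records the coordinates of \<open>2 ^ m *s x\<close>
  modulo \<open>2 ^ m\<close>. The colouring bounds the number of classes modulo
  \<open>gen S\<close> that an overlattice can meet.\<close>

lemma finite_intermediate_classes:
  assumes S: "finite S"
  shows "\<exists>\<phi> :: 'v \<Rightarrow> 'v \<Rightarrow> 'a. finite (\<phi> ` {x. 2 ^ m *s x \<in> gen S}) \<and>
    (\<forall>x y. 2 ^ m *s x \<in> gen S \<longrightarrow> 2 ^ m *s y \<in> gen S \<longrightarrow> \<phi> x = \<phi> y \<longrightarrow> x - y \<in> gen S)"
proof -
  obtain f :: "'a \<Rightarrow> 'a"
    where f: "finite (f ` R)" "\<And>x y. x \<in> R \<Longrightarrow> y \<in> R \<Longrightarrow> f x = f y \<Longrightarrow> (x - y) / 2 ^ m \<in> R"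
    using R_finite[of m] by metis
  have "\<exists>c. 2 ^ m *s x \<in> gen S \<longrightarrow> (\<forall>s. c s \<in> R) \<and> 2 ^ m *s x = (\<Sum>s\<in>S. c s *s s)" for x
    using gen_finite[OF S] by blast
  then obtain c where c: "\<And>x s. 2 ^ m *s x \<in> gen S \<Longrightarrow> c x s \<in> R"
    "\<And>x. 2 ^ m *s x \<in> gen S \<Longrightarrow> 2 ^ m *s x = (\<Sum>s\<in>S. c x s *s s)" by metis
  define \<phi> where "\<phi> x = restrict (\<lambda>s. f (c x s)) S" for x
  have "\<phi> ` {x. 2 ^ m *s x \<in> gen S} \<subseteq> S \<rightarrow>\<^sub>E f ` R" using c(1) by (auto simp: \<phi>_def)
  moreover have "finite (S \<rightarrow>\<^sub>E f ` R)" using S f(1) by (intro finite_PiE) auto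
  ultimately have "finite (\<phi> ` {x. 2 ^ m *s x \<in> gen S})" by (rule finite_subset)
  moreover have "x - y \<in> gen S" if "2 ^ m *s x \<in> gen S" "2 ^ m *s y \<in> gen S" "\<phi> x = \<phi> y" for x y
  proof -
    have r: "(c x s - c y s) / 2 ^ m \<in> R" if s: "s \<in> S" for s
    proof -
      have "\<phi> x s = \<phi> y s" using \<open>\<phi> x = \<phi> y\<close> by simp
      then have "f (c x s) = f (c y s)" using s by (simp add: \<phi>_def)
      then show ?thesis using f(2) c(1)[OF \<open>2 ^ m *s x \<in> gen S\<close>] c(1)[OF \<open>2 ^ m *s y \<in> gen S\<close>] by blast
    qed
    have "2 ^ m *s (x - y) = (\<Sum>s\<in>S. (c x s - c y s) *s s)"
      using c(2)[OF that(1)] c(2)[OF that(2)]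
      by (simp add: scale_right_diff_distrib scale_left_diff_distrib sum_subtractf)
    then have "inverse (2 ^ m) *s (2 ^ m *s (x - y)) = inverse (2 ^ m) *s (\<Sum>s\<in>S. (c x s - c y s) *s s)"
      by simp
    then have "x - y = (\<Sum>s\<in>S. ((c x s - c y s) / 2 ^ m) *s s)"
      by (simp add: scale_sum_right divide_inverse mult.commute)
    also have "\<dots> \<in> gen S"
      using r gen_base by (intro submod_sum[OF submod_gen] submod_scale[OF submod_gen]) auto
    finally show ?thesis .
  qed
  ultimately show ?thesis by blast
qed

lemma submod_adjoin: "submod L \<Longrightarrow> submod {c *s x + y | c y. c \<in> R \<and> y \<in> L}"
proof (rule submodI)
  assume L: "submod L"
  show "0 \<in> {c *s x + y | c y. c \<in> R \<and> y \<in> L}"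
    using R_zero submod_zero[OF L] by (intro CollectI exI[of _ 0]) auto
  fix u w assume "u \<in> {c *s x + y | c y. c \<in> R \<and> y \<in> L}" "w \<in> {c *s x + y | c y. c \<in> R \<and> y \<in> L}"
  then obtain c d y z where *: "u = c *s x + y" "w = d *s x + z" "c \<in> R" "d \<in> R" "y \<in> L" "z \<in> L"
    by blast
  then have "u + w = (c + d) *s x + (y + z)" by (simp add: scale_left_distrib)
  then show "u + w \<in> {c *s x + y | c y. c \<in> R \<and> y \<in> L}"
    using * R_add submod_add[OF L] by blast
next
  assume L: "submod L"
  fix r u assume r: "r \<in> R" "u \<in> {c *s x + y | c y. c \<in> R \<and> y \<in> L}"
  then obtain c y where *: "u = c *s x + y" "c \<in> R" "y \<in> L" by blast
  then have "r *s u = (r * c) *s x + r *s y" by (simp add: scale_right_distrib)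
  then show "r *s u \<in> {c *s x + y | c y. c \<in> R \<and> y \<in> L}"
    using * r R_mult submod_scale[OF L] by blast
qed

text \<open>An integral lattice containing \<open>gen S\<close> on the same space pairs integrally
  with \<open>gen S\<close>, so it meets only finitely many classes of the colouring. Once the
  number of colours is greatest, adjoining a vector adds no new colour, hence no new
  element.\<close>

lemma ex_maxl:
  assumes S: "finite S" "integral (gen S)" and nd: "nondeg (span S)"
  shows "\<exists>T. finite T \<and> gen S \<subseteq> gen T \<and> span T = span S \<and> maxl (gen T)"
proof -
  obtain m where m: "\<And>x. x \<in> span S \<Longrightarrow> (\<forall>y\<in>gen S. b x y \<in> R) \<Longrightarrow> 2 ^ m *s x \<in> gen S"
    using dual_bounded[OF S(1) nd] by blast
  obtain \<phi> :: "'v \<Rightarrow> 'v \<Rightarrow> 'a" where \<phi>: "finite (\<phi> ` {x. 2 ^ m *s x \<in> gen S})"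
    "\<And>x y. 2 ^ m *s x \<in> gen S \<Longrightarrow> 2 ^ m *s y \<in> gen S \<Longrightarrow> \<phi> x = \<phi> y \<Longrightarrow> x - y \<in> gen S"
    using finite_intermediate_classes[OF S(1), of m] by metis
  define \<L> where "\<L> L \<longleftrightarrow> submod L \<and> integral L \<and> gen S \<subseteq> L \<and> L \<subseteq> span S" for L
  have bd: "L \<subseteq> {x. 2 ^ m *s x \<in> gen S}" if "\<L> L" for L
  proof
    fix x assume x: "x \<in> L"
    have "b x y \<in> R" if y: "y \<in> gen S" for y
      using \<open>\<L> L\<close> x y integral_b[of L x y] unfolding \<L>_def by blast
    then show "x \<in> {x. 2 ^ m *s x \<in> gen S}" using m[of x] x that unfolding \<L>_def by blast
  qed
  have fin: "finite (\<phi> ` L)" if "\<L> L" for L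
    using \<phi>(1) by (rule finite_subset[OF image_mono[OF bd[OF that]]])
  have card: "card (\<phi> ` L) < card (\<phi> ` {x. 2 ^ m *s x \<in> gen S}) + 1" if "\<L> L" for L
    using card_mono[OF \<phi>(1) image_mono[OF bd[OF that]]] by simp
  have "\<L> (gen S)" using S(2) submod_gen gen_subset_span unfolding \<L>_def by blast
  then obtain L where L: "\<L> L" "\<And>L'. \<L> L' \<Longrightarrow> card (\<phi> ` L') \<le> card (\<phi> ` L)"
    using ex_has_greatest_nat[of \<L> "gen S" "\<lambda>L. card (\<phi> ` L)"] card by metis
  have subL: "submod L" and intL: "integral L" and gL: "gen S \<subseteq> L" and Lsp: "L \<subseteq> span S"
    using L(1) unfolding \<L>_def by auto
  have spL: "span L = span S"
  proof
    show "span L \<subseteq> span S" using Lsp by (intro span_minimal subspace_span)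
    show "span S \<subseteq> span L" using span_mono[OF gL] by (simp only: span_gen)
  qed
  have "x \<in> L" if x: "x \<in> span L" "Q x \<in> R" "\<forall>y\<in>L. b x y \<in> R" for x
  proof -
    let ?L = "{c *s x + y | c y. c \<in> R \<and> y \<in> L}"
    have sub: "L \<subseteq> ?L"
    proof
      fix y assume "y \<in> L"
      then show "y \<in> ?L" using R_zero by (intro CollectI exI[of _ 0] exI[of _ y]) auto
    qed
    have xL: "x \<in> ?L"
      using R_one submod_zero[OF subL] by (intro CollectI exI[of _ 1] exI[of _ 0]) auto
    have "?L \<subseteq> span S" using x(1) Lsp by (auto simp: spL intro!: span_add span_scale)
    moreover have "integral ?L" using x(2,3) by (intro integral_adjoin[OF intL subL]) auto
    ultimately have 1: "\<L> ?L" using submod_adjoin[OF subL] gL sub unfolding \<L>_def by blast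
    have "\<phi> ` L = \<phi> ` ?L"
      using L(2)[OF 1] by (intro card_seteq[OF fin[OF 1] image_mono[OF sub]])
    then have "\<phi> x \<in> \<phi> ` L" using imageI[OF xL, of \<phi>] by simp
    then obtain y where y: "y \<in> L" "\<phi> x = \<phi> y" by blast
    then have "x - y \<in> gen S" using \<phi>(2) subsetD[OF bd[OF 1] xL] subsetD[OF bd[OF L(1)] y(1)] by simp
    then have "(x - y) + y \<in> L" using gL y(1) by (intro submod_add[OF subL]) auto
    then show ?thesis by simp
  qed
  then have maxL: "maxl L" using subL intL unfolding maxl_def by blast
  define rep where "rep t = (SOME x. x \<in> L \<and> \<phi> x = t)" for t
  have rep: "rep (\<phi> x) \<in> L" "\<phi> (rep (\<phi> x)) = \<phi> x" if "x \<in> L" for x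
    using someI[of "\<lambda>y. y \<in> L \<and> \<phi> y = \<phi> x" x] that unfolding rep_def by auto
  \<comment> \<open>Finite generation is recovered by adding one representative per colour to
    \<open>S\<close>.\<close>
  define T where "T = S \<union> rep ` (\<phi> ` L)"
  have "T \<subseteq> L" using gL gen_base rep(1) by (auto simp: T_def)
  moreover have "L \<subseteq> gen T"
  proof
    fix x assume x: "x \<in> L"
    have "x - rep (\<phi> x) \<in> gen S"
      using \<phi>(2)[of x "rep (\<phi> x)"] rep[OF x] bd[OF L(1)] x by auto
    then have "x - rep (\<phi> x) \<in> gen T" using gen_mono[of S T] by (auto simp: T_def)
    moreover have "rep (\<phi> x) \<in> gen T" using x by (intro gen_base) (auto simp: T_def)
    ultimately have "(x - rep (\<phi> x)) + rep (\<phi> x) \<in> gen T" by (rule submod_add[OF submod_gen])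
    then show "x \<in> gen T" by simp
  qed
  ultimately have gT: "gen T = L" using gen_minimal[OF subL] by blast
  have "finite T" using S(1) fin[OF L(1)] by (simp add: T_def)
  moreover have "span T = span S" using spL gT span_gen by metis
  ultimately show ?thesis using gT gL maxL by blast
qed

section \<open>Hyperbolic planes in maximal lattices\<close>

lemma primitive_multiple:
  assumes L: "submod L" "integral L" and nd: "nondeg (span L)" and x: "x \<in> span L" "x \<noteq> 0"
  shows "\<exists>c. c \<noteq> 0 \<and> c *s x \<in> L \<and> (c / p) *s x \<notin> L"
proof -
  obtain k where k: "2 ^ k *s x \<in> L" using span_two_power[OF L(1) x(1)] by blast
  have ex: "\<exists>j. (2 ^ k / p ^ j) *s x \<notin> L"
  proof (rule ccontr)
    assume "\<nexists>j. (2 ^ k / p ^ j) *s x \<notin> L"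
    then have all: "(2 ^ k / p ^ j) *s x \<in> L" for j by blast
    \<comment> \<open>Divisibility of the vector by all powers of \<open>p\<close> would pass to its
      pairings, against non-degeneracy.\<close>
    have "b x y = 0" if y: "y \<in> L" for y
    proof (rule ccontr)
      assume "b x y \<noteq> 0"
      then obtain j where j: "(2 ^ k * b x y) / p ^ j \<notin> R" using p_separated[of "2 ^ k * b x y"] by auto
      then show False using integral_b[OF L(2,1) all[of j] y] by (simp add: b_scale_left)
    qed
    then show False using nondegD[OF nd x(1)] x(2) by blast
  qed
  define j where "j = (LEAST j. (2 ^ k / p ^ j) *s x \<notin> L)"
  have j: "(2 ^ k / p ^ j) *s x \<notin> L" unfolding j_def by (rule LeastI_ex[OF ex])
  then have "j \<noteq> 0" using k by (metis div_by_1 power_0)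
  then obtain i where i: "j = Suc i" by (cases j) auto
  have "(2 ^ k / p ^ i) *s x \<in> L"
    using not_less_Least[of i "\<lambda>j. (2 ^ k / p ^ j) *s x \<notin> L"] i unfolding j_def by simp
  moreover have "2 ^ k / p ^ i / p = 2 ^ k / p ^ j" by (simp add: i mult.commute)
  ultimately show ?thesis using j p_nonzero by (intro exI[of _ "2 ^ k / p ^ i"]) auto
qed

text \<open>The vector \<open>(1 / p) *s x\<close> has norm 0, so maximality excludes it from
  \<open>L\<close> only if some pairing of \<open>x\<close> with \<open>L\<close> is a unit. That
  pairing can be normalised to 1, and subtracting a multiple of \<open>x\<close> removes the norm of
  the partner.\<close>

lemma isotropic_partner:
  assumes L: "maxl L" and x: "x \<in> L" "Q x = 0" "(1 / p) *s x \<notin> L"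
  shows "\<exists>y\<in>L. b x y = 1 \<and> Q y = 0"
proof -
  note sub = maxl_submod[OF L] and int = maxl_integral[OF L]
  have "\<not> (\<forall>y\<in>L. b ((1 / p) *s x) y \<in> R)"
    using maxlD[OF L, of "(1 / p) *s x"] x span_scale[OF span_base[OF x(1)]]
    by (auto simp: Q_scale R_zero)
  then obtain y where y: "y \<in> L" "b x y \<notin> P" by (auto simp: b_scale_left P_def)
  have bR: "b x y \<in> R" using integral_b[OF int sub x(1) y(1)] .
  define z where "z = inverse (b x y) *s y"
  have z: "z \<in> L" unfolding z_def by (rule submod_scale[OF sub unit_inverse[OF bR y(2)] y(1)])
  have bz: "b x z = 1" using unit_nonzero[OF y(2)] by (simp add: z_def b_scale_right)
  define w where "w = z - Q z *s x"
  have "Q z \<in> R" using int z by (simp add: integral_def)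
  then have "w \<in> L" unfolding w_def by (intro submod_diff[OF sub] z submod_scale[OF sub] x(1))
  moreover have "b x w = 1" using bz x(2) by (simp add: w_def b_simps b_self)
  moreover have "Q w = 0" using bz x(2) by (simp add: w_def Q_diff Q_scale b_simps b_sym[of z x])
  ultimately show ?thesis by blast
qed

text \<open>
  The isometry is an Eichler transformation fixing \<open>x\<close> followed by a rescaling of a hyperbolic plane.
\<close>

lemma ex_isometry_hyperbolic_pair:
  assumes V: "subspace V" "x \<in> V" "y \<in> V" "y' \<in> V"
    and xy: "Q x = 0" "Q y = 0" "b x y = 1" and xy': "c \<noteq> 0" "Q y' = 0" "b (c *s x) y' = 1"
  shows "\<exists>g. Vector_Spaces.linear scale scale g \<and> g ` V \<subseteq> V \<and> (\<forall>z. Q (g z) = Q z) \<and>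
    g x = c *s x \<and> g y = y'"
proof -
  \<comment> \<open>Rescaled so that \<open>x, w\<close> is a hyperbolic pair just as
    \<open>x, y\<close> is.\<close>
  define w where "w = c *s y'"
  have w: "Q w = 0" "b x w = 1" "w \<in> V"
    using xy' V by (auto simp: w_def Q_scale b_simps intro: subspace_scale)
  define t where "t = b w y"
  define u where "u = w - y - t *s x"
  have bux: "b u x = 0" using w xy by (simp add: u_def b_simps b_self b_sym[of w x] b_sym[of y x])
  have buy: "b u y = 0" using xy by (simp add: u_def b_simps b_self t_def)
  have Qu: "Q u = - t"
    using w xy by (simp add: u_def Q_diff Q_scale b_simps b_sym[of w x] b_sym[of y x] t_def)
  have uV: "u \<in> V" unfolding u_def by (intro subspace_diff[OF V(1)] subspace_scale[OF V(1)] w V)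
  \<comment> \<open>The Eichler transformation belonging to \<open>u\<close>, which is orthogonal to
    \<open>x\<close> and \<open>y\<close>. It fixes \<open>x\<close> and sends \<open>y\<close> to
    \<open>w\<close>.\<close>
  define E where "E z = z + b z x *s u - b z u *s x - (Q u * b z x) *s x" for z
  \<comment> \<open>Multiplies \<open>x\<close> by \<open>c\<close> and \<open>w\<close> by its
    inverse, and is the identity on their orthogonal complement.\<close>
  define S where "S z = z + ((c - 1) * b z w) *s x + ((inverse c - 1) * b z x) *s w" for z
  have E: "Vector_Spaces.linear scale scale E"
    by (rule linearI) (simp_all add: E_def b_simps algebra_simps)
  have S: "Vector_Spaces.linear scale scale S"
    by (rule linearI) (simp_all add: S_def b_simps algebra_simps)
  have QE: "Q (E z) = Q z" for z
  proof -
    have "E z = z + (b z x *s u - (b z u + Q u * b z x) *s x)" by (simp add: E_def algebra_simps)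
    then have "Q (E z) = Q z + Q (b z x *s u - (b z u + Q u * b z x) *s x)
        + b z (b z x *s u - (b z u + Q u * b z x) *s x)" by (simp add: Q_add)
    also have "\<dots> = Q z"
      using bux xy by (simp add: Q_diff Q_add Q_scale b_simps b_self power2_eq_square algebra_simps)
    finally show ?thesis .
  qed
  have QS: "Q (S z) = Q z" for z
  proof -
    have "Q (S z) = Q z + ((c - 1) * b z w) * b z x + ((inverse c - 1) * b z x) * b z w
        + (c - 1) * b z w * ((inverse c - 1) * b z x)"
      using w xy by (simp add: S_def Q_add Q_scale b_simps distrib_left)
    also have "\<dots> = Q z + (c - 1 + (inverse c - 1) + (c - 1) * (inverse c - 1)) * b z w * b z x"
      by (simp add: algebra_simps)
    also have "c - 1 + (inverse c - 1) + (c - 1) * (inverse c - 1) = 0"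
      using xy'(1) by (simp add: algebra_simps)
    finally show ?thesis by simp
  qed
  have Ex: "E x = x" using xy bux by (simp add: E_def b_self b_sym[of x u])
  have "E y = y + u + t *s x" using xy buy Qu by (simp add: E_def b_sym[of y x] b_sym[of y u])
  then have Ey: "E y = w" by (simp add: u_def)
  have Sx: "S x = c *s x" using xy w by (simp add: S_def b_self algebra_simps)
  have Sw: "S w = inverse c *s w" using w by (simp add: S_def b_self b_sym[of w x] algebra_simps)
  let ?g = "S \<circ> E"
  have "Vector_Spaces.linear scale scale ?g"
    by (rule linearI) (simp_all add: linear_add[OF E] linear_add[OF S] linear_scale[OF E] linear_scale[OF S])
  moreover have "E z \<in> V" if "z \<in> V" for z
    unfolding E_def by (intro subspace_diff[OF V(1)] subspace_add[OF V(1)] subspace_scale[OF V(1)] that uV V(2))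
  moreover have "S z \<in> V" if "z \<in> V" for z
    unfolding S_def by (intro subspace_add[OF V(1)] subspace_scale[OF V(1)] that w(3) V(2))
  moreover have "inverse c *s w = y'" using xy'(1) by (simp add: w_def)
  ultimately show ?thesis
    using QE QS Ex Ey Sx Sw by (intro exI[of _ ?g]) auto
qed

text \<open>The coefficients of the projection are the pairings with \<open>x\<close> and
  \<open>y\<close>, hence integral, so the plane splits off from \<open>L\<close>. A vector of
  \<open>V1\<close> therefore pairs with \<open>L\<close> only through \<open>L \<inter> V1\<close>,
  which transfers maximality and non-degeneracy.\<close>

lemma hyperbolic_complement:
  assumes L: "maxl L" and nd: "nondeg (span L)" and xy: "x \<in> L" "y \<in> L" "Q x = 0" "Q y = 0" "b x y = 1"
  defines "V1 \<equiv> {z \<in> span L. b z x = 0 \<and> b z y = 0}"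
  shows "span (L \<inter> V1) = V1" "maxl (L \<inter> V1)" "nondeg V1"
    "\<And>z. z \<in> L \<Longrightarrow> z - b z y *s x - b z x *s y \<in> L \<inter> V1"
proof -
  note sub = maxl_submod[OF L] and int = maxl_integral[OF L]
  have sV: "subspace V1"
    unfolding V1_def subspace_def
    by (auto simp: b_simps span_add span_scale span_zero)
  have yx: "b y x = 1" using xy b_sym by metis
  have prV: "z - b z y *s x - b z x *s y \<in> V1" if "z \<in> span L" for z
    using that xy yx span_base[OF xy(1)] span_base[OF xy(2)]
    by (auto simp: V1_def b_simps b_self intro!: span_diff span_scale)
  show prL: "z - b z y *s x - b z x *s y \<in> L \<inter> V1" if "z \<in> L" for z
  proof
    show "z - b z y *s x - b z x *s y \<in> L"
      by (intro submod_diff[OF sub] submod_scale[OF sub] integral_b[OF int sub] that xy)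
  qed (rule prV[OF span_base[OF that]])
  show sp: "span (L \<inter> V1) = V1"
  proof
    show "span (L \<inter> V1) \<subseteq> V1" by (intro span_minimal sV) auto
    show "V1 \<subseteq> span (L \<inter> V1)"
    proof
      fix z assume z: "z \<in> V1"
      then obtain k where k: "2 ^ k *s z \<in> L" using span_two_power[OF sub, of z] by (auto simp: V1_def)
      then have "2 ^ k *s z \<in> L \<inter> V1" using subspace_scale[OF sV z] by blast
      then have "inverse (2 ^ k) *s (2 ^ k *s z) \<in> span (L \<inter> V1)" by (intro span_scale span_base)
      then show "z \<in> span (L \<inter> V1)" by simp
    qed
  qed
  have split: "b w z = b w (z - b z y *s x - b z x *s y)" if "b w x = 0" "b w y = 0" for w z
    using that by (simp add: b_simps)
  show "nondeg V1"
    unfolding nondeg_def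
  proof (intro ballI impI)
    fix w assume w: "w \<in> V1" "\<forall>z\<in>V1. b w z = 0"
    have "b w z = 0" if "z \<in> span L" for z
      using split[of w z] w prV[OF that] by (auto simp: V1_def)
    then show "w = 0" using nd w(1) unfolding nondeg_def V1_def by blast
  qed
  show "maxl (L \<inter> V1)"
    unfolding maxl_def sp
  proof (intro conjI ballI impI)
    show "submod (L \<inter> V1)"
      using sub subspace_submod[OF sV] unfolding submod_def by blast
    show "integral (L \<inter> V1)" using int by (auto simp: integral_def)
    fix w assume w: "w \<in> V1" "Q w \<in> R" "\<forall>z\<in>L \<inter> V1. b w z \<in> R"
    have "b w z \<in> R" if "z \<in> L" for z
      using split[of w z] w prL[OF that] by (auto simp: V1_def)
    then show "w \<in> L \<inter> V1" using w maxlD[OF L, of w] by (auto simp: V1_def)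
  qed
qed

text \<open>If \<open>b x y\<close> were not integral, the equation
  \<open>Q (a *s x + y) = 0\<close> would turn, with \<open>a = s * b x y / Q x\<close>, into the
  quadratic equation of \<open>hensel\<close> with constant term in \<open>P\<close>, and the
  solution would give an isotropic vector.\<close>

lemma anisotropic_b_integral:
  assumes an: "\<And>z. z \<in> span {x, y} \<Longrightarrow> Q z = 0 \<Longrightarrow> z = 0" and Q: "Q x \<in> R" "Q y \<in> R"
  shows "b x y \<in> R"
proof (rule ccontr)
  assume nR: "b x y \<notin> R"
  let ?b = "b x y"
  have b0: "?b \<noteq> 0" using nR R_zero by auto
  have iP: "inverse ?b \<in> P" using notin_R_inverse_P[OF nR] .
  have x0: "Q x \<noteq> 0" using an[of x] b0 span_base[of x "{x, y}"] by auto
  have "inverse ?b * (inverse ?b * (Q x * Q y)) \<in> P"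
    by (rule P_mult[OF iP]) (intro R_mult P_R[OF iP] Q)
  then obtain s where s: "s \<in> P" "s\<^sup>2 + s + inverse ?b * (inverse ?b * (Q x * Q y)) = 0"
    using hensel unfolding P_def by blast
  define a where "a = s * ?b / Q x"
  have "Q (a *s x + y) = (?b\<^sup>2 / Q x) * (s\<^sup>2 + s + inverse ?b * (inverse ?b * (Q x * Q y)))"
    using x0 b0 unfolding Q_add Q_scale b_scale_left a_def
    by (simp add: field_simps power2_eq_square)
  then have "Q (a *s x + y) = 0" using s(2) by simp
  moreover have "a *s x + y \<in> span {x, y}" by (intro span_add span_scale span_base) auto
  ultimately have "a *s x + y = 0" using an by blast
  \<comment> \<open>The vanishing of the vector would make \<open>2 * s + 1\<close> zero, although
    \<open>s\<close> lies in \<open>P\<close>.\<close>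
  then have "b (a *s x + y) x = 0" by simp
  then have "a * (2 * Q x) + ?b = 0" by (simp add: b_simps b_self b_sym[of y x])
  then have "(2 * s + 1) * ?b = 0" using x0 by (simp add: a_def algebra_simps)
  then have "- (2 * s) = 1" using b0 by (simp add: add_eq_0_iff)
  moreover have "- (2 * s) \<in> P" using P_mult'[OF R_two s(1)] by (rule P_uminus)
  ultimately show False using P_one by simp
qed

text \<open>An isotropic line contains a primitive vector of each lattice, and the two differ by a
  scalar; this is why the isometry of pairs must be able to rescale. It moves \<open>L\<close> so
  that both lattices contain the same hyperbolic pair, and the induction runs on the complements. In
  the anisotropic case \<open>anisotropic_b_integral\<close> gives the inclusion directly.\<close>

theorem maxl_embeds:
  assumes "finite F" "maxl L" "maxl M" "span L = span M" "span M \<subseteq> span F" "nondeg (span M)"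
  shows "\<exists>g. Vector_Spaces.linear scale scale g \<and> g ` span M \<subseteq> span M \<and>
    (\<forall>x\<in>span M. Q (g x) = Q x) \<and> g ` L \<subseteq> M"
  using assms(2-)
proof (induction "dim (span M)" arbitrary: L M rule: less_induct)
  case less
  note L = less.prems(1) and M = less.prems(2) and LM = less.prems(3) and F = less.prems(4)
    and nd = less.prems(5)
  show ?case
  proof (cases "\<exists>x\<in>span M. x \<noteq> 0 \<and> Q x = 0")
    case False
    have "L \<subseteq> M"
    proof
      fix x assume x: "x \<in> L"
      have xs: "x \<in> span M" using span_base[OF x] LM by simp
      have Qx: "Q x \<in> R" using maxl_integral[OF L] x by (simp add: integral_def)
      have "b x y \<in> R" if y: "y \<in> M" for y
      proof (rule anisotropic_b_integral)
        fix z assume z: "z \<in> span {x, y}" "Q z = 0"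
        have "span {x, y} \<subseteq> span M" using xs span_base[OF y] by (intro span_minimal subspace_span) auto
        then show "z = 0" using False z by blast
      qed (use Qx maxl_integral[OF M] y in \<open>auto simp: integral_def\<close>)
      then show "x \<in> M" by (rule maxlD[OF M xs Qx])
    qed
    then show ?thesis by (intro exI[of _ "\<lambda>x. x"]) (auto intro: linearI)
  next
    case True
    then obtain x0 where x0: "x0 \<in> span M" "x0 \<noteq> 0" "Q x0 = 0" by blast
    have ndL: "nondeg (span L)" and x0L: "x0 \<in> span L" using nd x0 LM by simp_all
    obtain c1 where c1: "c1 \<noteq> 0" "c1 *s x0 \<in> L" "(c1 / p) *s x0 \<notin> L"
      using primitive_multiple[OF maxl_submod[OF L] maxl_integral[OF L] ndL x0L x0(2)] by blast
    obtain c2 where c2: "c2 \<noteq> 0" "c2 *s x0 \<in> M" "(c2 / p) *s x0 \<notin> M"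
      using primitive_multiple[OF maxl_submod[OF M] maxl_integral[OF M] nd x0(1,2)] by blast
    define x where "x = c1 *s x0"
    define c where "c = c2 / c1"
    define x' where "x' = c *s x"
    have x': "x' = c2 *s x0" using c1(1) by (simp add: x'_def x_def c_def)
    have Qx: "Q x = 0" "Q x' = 0" using x0 by (simp_all add: x_def x' Q_scale)
    obtain y where y: "y \<in> L" "b x y = 1" "Q y = 0"
      using isotropic_partner[OF L, of x] c1 Qx by (auto simp: x_def)
    obtain y' where y': "y' \<in> M" "b x' y' = 1" "Q y' = 0"
      using isotropic_partner[OF M, of x'] c2 Qx by (auto simp: x')
    have xL: "x \<in> L" and x'M: "x' \<in> M" using c1 c2 by (simp_all add: x_def x')
    have inV: "x \<in> span M" "y \<in> span M" "y' \<in> span M"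
      using span_base[OF xL] span_base[OF y(1)] span_base[OF y'(1)] LM by simp_all
    have c0: "c \<noteq> 0" using c1 c2 by (simp add: c_def)
    obtain g where g: "Vector_Spaces.linear scale scale g" "g ` span M \<subseteq> span M" "\<And>z. Q (g z) = Q z"
      "g x = x'" "g y = y'"
      using ex_isometry_hyperbolic_pair[OF subspace_span inV Qx(1) y(3,2) c0 y'(3)] y'(2)
      unfolding x'_def by blast
    have gb: "b (g u) (g w) = b u w" for u w
      using g(3)[of "u + w"] by (simp add: b_eq_Q linear_add[OF g(1)] g(3))
    have gV: "g ` span M = span M"
    proof (rule linear_inj_surj_on_subspace[OF g(1) subspace_span assms(1) F g(2)])
      fix z assume z: "z \<in> span M" "g z = 0"
      have "b z w = 0" for w using gb[of z w] z(2) by simp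
      then show "z = 0" using nondegD[OF nd z(1)] by blast
    qed
    define L' where "L' = g ` L"
    have L': "maxl L'" unfolding L'_def by (rule maxl_linear_image[OF g(1) g(3) L])
    have spL': "span L' = span M" unfolding L'_def linear_span_image[OF g(1)] LM by (rule gV)
    have x'L: "x' \<in> L'" and y'L: "y' \<in> L'" using xL y(1) g(4,5) by (auto simp: L'_def)
    define V1 where "V1 = {z \<in> span M. b z x' = 0 \<and> b z y' = 0}"
    note hM = hyperbolic_complement[OF M nd x'M y'(1) Qx(2) y'(3,2), folded V1_def]
    have ndL': "nondeg (span L')" using nd spL' by simp
    note hL = hyperbolic_complement[OF L' ndL' x'L y'L Qx(2) y'(3,2), unfolded spL', folded V1_def]
    have V1M: "V1 \<subseteq> span M" by (auto simp: V1_def)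
    have "x' \<notin> V1" using y'(2) by (auto simp: V1_def)
    then have "dim V1 < dim (span M)"
      using dim_less_if_notin_span[OF assms(1) V1M F span_base[OF x'M]] hM(1) by (metis span_span)
    then have "\<exists>h. Vector_Spaces.linear scale scale h \<and> h ` span (M \<inter> V1) \<subseteq> span (M \<inter> V1) \<and>
        (\<forall>x\<in>span (M \<inter> V1). Q (h x) = Q x) \<and> h ` (L' \<inter> V1) \<subseteq> M \<inter> V1"
      using hM hL V1M F by (intro less.hyps) auto
    then obtain h where h: "Vector_Spaces.linear scale scale h" "h ` V1 \<subseteq> V1" "\<And>z. z \<in> V1 \<Longrightarrow> Q (h z) = Q z"
      "h ` (L' \<inter> V1) \<subseteq> M \<inter> V1"
      unfolding hM(1) by blast
    \<comment> \<open>The map \<open>h\<close> is controlled on \<open>V1\<close> only, so it is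
      applied after projecting to \<open>V1\<close> and completed by the identity on the plane of
      \<open>x'\<close> and \<open>y'\<close>.\<close>
    define pr where "pr z = z - b z y' *s x' - b z x' *s y'" for z
    define k where "k z = b z y' *s x' + b z x' *s y' + h (pr z)" for z
    have prV: "pr z \<in> V1" if "z \<in> span M" for z
    proof -
      have "b y' x' = 1" using y'(2) b_sym by metis
      then show ?thesis
        using that y'(2,3) Qx(2) span_base[OF x'M] inV(3)
        by (auto simp: V1_def pr_def b_simps b_self intro!: span_diff span_scale)
    qed
    have pr: "Vector_Spaces.linear scale scale pr"
      by (rule linearI) (simp_all add: pr_def b_simps algebra_simps)
    have k: "Vector_Spaces.linear scale scale k"
      by (rule linearI) (simp_all add: k_def linear_add[OF pr] linear_add[OF h(1)] linear_scale[OF pr]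
          linear_scale[OF h(1)] b_simps algebra_simps)
    have kV: "k z \<in> span M" if "z \<in> span M" for z
      using h(2) prV[OF that] V1M span_base[OF x'M] inV(3)
      by (auto simp: k_def intro!: span_add span_scale)
    have Qk: "Q (k z) = Q z" if z: "z \<in> span M" for z
    proof -
      let ?w = "h (pr z)" and ?u = "b z y' *s x' + b z x' *s y'"
      have w: "?w \<in> V1" using h(2) prV[OF z] by blast
      have "b ?u ?w = 0" using w by (simp add: b_simps b_sym[of x'] b_sym[of y'] V1_def)
      moreover have "b ?u (pr z) = 0"
        using prV[OF z] by (simp add: b_simps b_sym[of x' "pr z"] b_sym[of y' "pr z"] V1_def)
      moreover have "z = ?u + pr z" by (simp add: pr_def)
      ultimately show ?thesis using h(3)[OF prV[OF z]] by (metis Q_add k_def)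
    qed
    have kL: "k z \<in> M" if z: "z \<in> L'" for z
    proof -
      have "h (pr z) \<in> M" using hL(4)[OF z] h(4) unfolding pr_def by blast
      moreover have "b z y' \<in> R" "b z x' \<in> R"
        using integral_b[OF maxl_integral[OF L'] maxl_submod[OF L'] z] x'L y'L by auto
      ultimately show ?thesis unfolding k_def
        using x'M y'(1) by (intro submod_add[OF maxl_submod[OF M]] submod_scale[OF maxl_submod[OF M]])
    qed
    have "Vector_Spaces.linear scale scale (k \<circ> g)"
      by (rule linearI) (simp_all add: linear_add[OF k] linear_add[OF g(1)] linear_scale[OF k] linear_scale[OF g(1)])
    moreover have "(k \<circ> g) ` span M \<subseteq> span M" using kV g(2) by auto
    moreover have "\<forall>z\<in>span M. Q ((k \<circ> g) z) = Q z"
    proof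
      fix z assume "z \<in> span M"
      then have "g z \<in> span M" using g(2) by blast
      then show "Q ((k \<circ> g) z) = Q z" using Qk g(3) by simp
    qed
    moreover have "(k \<circ> g) ` L \<subseteq> M" using kL by (auto simp: L'_def)
    ultimately show ?thesis by blast
  qed
qed

end

section \<open>Splitting off planes\<close>

context henselian_dvr
begin

lemma P_mult_P: "x \<in> P \<Longrightarrow> y \<in> P \<Longrightarrow> x * y / p\<^sup>2 \<in> R"
  using R_mult[of "x / p" "y / p"] by (simp add: P_def power2_eq_square)

text \<open>Here \<open>u\<close> has valuation 0 and \<open>q\<close> valuation 1, so the two
  summands have valuations of different parity and cannot cancel. The proof compares the
  coefficients by division.\<close>

lemma coefficients_integral:
  assumes u: "u \<in> R" "u \<notin> P" and q: "q \<in> P" "q / p\<^sup>2 \<notin> R" and s: "\<alpha>\<^sup>2 * u + \<beta>\<^sup>2 * q \<in> R"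
  shows "\<alpha> \<in> R" "\<beta> \<in> R"
proof -
  let ?s = "\<alpha>\<^sup>2 * u + \<beta>\<^sup>2 * q"
  show \<alpha>: "\<alpha> \<in> R"
  proof (rule ccontr)
    assume n: "\<alpha> \<notin> R"
    have \<alpha>0: "\<alpha> \<noteq> 0" using n R_zero by auto
    have iP: "inverse \<alpha> \<in> P" by (rule notin_R_inverse_P[OF n])
    have "\<beta> / \<alpha> \<notin> R"
    proof
      assume c: "\<beta> / \<alpha> \<in> R"
      have "inverse \<alpha> * (inverse \<alpha> * ?s) - (\<beta> / \<alpha>)\<^sup>2 * q \<in> P"
        by (intro P_diff P_mult[OF iP] R_mult P_R[OF iP] s P_mult'[OF R_square[OF c]] q)
      also have "inverse \<alpha> * (inverse \<alpha> * ?s) - (\<beta> / \<alpha>)\<^sup>2 * q = u"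
        using \<alpha>0 by (simp add: field_simps power2_eq_square)
      finally show False using u by blast
    qed
    then have \<gamma>: "\<alpha> / \<beta> \<in> P" "\<beta> \<noteq> 0" using divide_notin_R[OF \<alpha>0] R_zero by auto
    have "inverse \<beta> = inverse \<alpha> * (\<alpha> / \<beta>)" using \<alpha>0 by (simp add: divide_inverse)
    then have i\<beta>: "inverse \<beta> \<in> P" using P_mult[OF iP P_R[OF \<gamma>(1)]] by simp
    have "(inverse \<beta> * inverse \<beta> / p\<^sup>2) * ?s - ((\<alpha> / \<beta>) * (\<alpha> / \<beta>) / p\<^sup>2) * u \<in> R"
      by (rule R_diff[OF R_mult[OF P_mult_P[OF i\<beta> i\<beta>] s] R_mult[OF P_mult_P[OF \<gamma>(1) \<gamma>(1)] u(1)]])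
    also have "(inverse \<beta> * inverse \<beta> / p\<^sup>2) * ?s - ((\<alpha> / \<beta>) * (\<alpha> / \<beta>) / p\<^sup>2) * u = q / p\<^sup>2"
      using \<gamma>(2) p_nonzero by (simp add: field_simps power2_eq_square)
    finally show False using q by blast
  qed
  show "\<beta> \<in> R"
  proof (rule ccontr)
    assume n: "\<beta> \<notin> R"
    have \<beta>0: "\<beta> \<noteq> 0" using n R_zero by auto
    have iP: "inverse \<beta> \<in> P" by (rule notin_R_inverse_P[OF n])
    have "?s - \<alpha>\<^sup>2 * u \<in> R" by (intro R_diff s R_mult R_square \<alpha> u)
    then have "(inverse \<beta> * inverse \<beta> / p\<^sup>2) * (?s - \<alpha>\<^sup>2 * u) \<in> R"
      by (rule R_mult[OF P_mult_P[OF iP iP]])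
    also have "(inverse \<beta> * inverse \<beta> / p\<^sup>2) * (?s - \<alpha>\<^sup>2 * u) = q / p\<^sup>2"
      using \<beta>0 by (simp add: field_simps power2_eq_square)
    finally show False using q by blast
  qed
qed

end

context dvr_quadratic
begin

section \<open>Orthogonal sums with lines and planes\<close>

lemma b_span_eq_0_left: "(\<And>s. s \<in> S \<Longrightarrow> b s x = 0) \<Longrightarrow> y \<in> span S \<Longrightarrow> b y x = 0"
  using b_span_eq_0[of S x y] by (simp add: b_sym)

lemma gen_insert2:
  "x \<in> gen (insert u (insert v S)) \<longleftrightarrow> (\<exists>c\<in>R. \<exists>d\<in>R. \<exists>w\<in>gen S. x = c *s u + (d *s v + w))"
  unfolding gen_insert[of x u] Bex_def gen_insert[of _ v] by auto

lemma nondeg_insert: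
  assumes nd: "nondeg (span S)" and u: "\<And>s. s \<in> S \<Longrightarrow> b u s = 0" "Q u \<noteq> 0"
  shows "nondeg (span (insert u S))" "u \<notin> span S"
proof -
  show "u \<notin> span S" using b_span_eq_0[of S u u] u by (auto simp: b_self)
  show "nondeg (span (insert u S))"
    unfolding nondeg_def
  proof (intro ballI impI)
    fix x assume x: "x \<in> span (insert u S)" "\<forall>y\<in>span (insert u S). b x y = 0"
    then obtain c where c: "x - c *s u \<in> span S" using span_breakdown_eq by blast
    have ux: "b x y = 0" if "y \<in> insert u S" for y using x(2) span_base[OF that] by blast
    have "b u (x - c *s u) = 0" using b_span_eq_0[OF u(1) c] .
    then have "c = 0" using u(2) ux[of u] b_sym[of u x] by (simp add: b_simps b_self)
    then show "x = 0" using nondegD[OF nd, of x] c ux by auto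
  qed
qed

text \<open>The Gram determinant of \<open>b\<close> at \<open>x\<close> and
  \<open>y\<close>.\<close>

definition plane_disc :: "'v \<Rightarrow> 'v \<Rightarrow> 'a" where "plane_disc x y = 4 * Q x * Q y - (b x y)\<^sup>2"

text \<open>Cramer's rule for the orthogonal projection to the plane of \<open>x\<close> and
  \<open>y\<close>.\<close>

lemma plane_projection:
  assumes "plane_disc x y \<noteq> 0"
  defines "\<alpha> \<equiv> \<lambda>z. (2 * Q y * b z x - b x y * b z y) / plane_disc x y"
    and "\<beta> \<equiv> \<lambda>z. (2 * Q x * b z y - b x y * b z x) / plane_disc x y"
  shows "b (z - \<alpha> z *s x - \<beta> z *s y) x = 0" "b (z - \<alpha> z *s x - \<beta> z *s y) y = 0"
proof -
  let ?D = "plane_disc x y"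
  have "?D * b (z - \<alpha> z *s x - \<beta> z *s y) x
      = ?D * b z x - (?D * \<alpha> z) * (2 * Q x) - (?D * \<beta> z) * b x y"
    by (simp add: b_simps b_self b_sym[of y x] algebra_simps)
  also have "\<dots> = 0"
    using assms(1) by (simp add: \<alpha>_def \<beta>_def) (simp add: plane_disc_def power2_eq_square algebra_simps)
  finally show "b (z - \<alpha> z *s x - \<beta> z *s y) x = 0" using assms(1) by simp
  have "?D * b (z - \<alpha> z *s x - \<beta> z *s y) y
      = ?D * b z y - (?D * \<alpha> z) * b x y - (?D * \<beta> z) * (2 * Q y)"
    by (simp add: b_simps b_self algebra_simps)
  also have "\<dots> = 0"
    using assms(1) by (simp add: \<alpha>_def \<beta>_def) (simp add: plane_disc_def power2_eq_square algebra_simps)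
  finally show "b (z - \<alpha> z *s x - \<beta> z *s y) y = 0" using assms(1) by simp
qed

lemma nondeg_insert_plane:
  assumes nd: "nondeg (span S)" and xs: "\<And>s. s \<in> S \<Longrightarrow> b x s = 0" and ys: "\<And>s. s \<in> S \<Longrightarrow> b y s = 0"
    and D: "plane_disc x y \<noteq> 0"
  shows "nondeg (span (insert x (insert y S)))" "y \<notin> span S" "x \<notin> span (insert y S)"
proof -
  show "y \<notin> span S"
  proof
    assume "y \<in> span S"
    then have "b y y = 0" "b x y = 0" using b_span_eq_0[OF ys] b_span_eq_0[OF xs] by blast+
    then show False using D by (simp add: plane_disc_def b_self)
  qed
  show "x \<notin> span (insert y S)"
  proof
    assume "x \<in> span (insert y S)"
    then obtain c where c: "x - c *s y \<in> span S" using span_breakdown_eq by blast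
    have "b x (x - c *s y) = 0" "b y (x - c *s y) = 0"
      using b_span_eq_0[OF xs c] b_span_eq_0[OF ys c] by auto
    then have "2 * Q x = c * b x y" "b x y = c * (2 * Q y)" by (auto simp: b_simps b_self b_sym[of y x])
    then have "(2 * Q x) * (2 * Q y) = b x y * b x y" by (metis mult.assoc mult.left_commute)
    then show False using D by (simp add: plane_disc_def power2_eq_square mult.assoc)
  qed
  show "nondeg (span (insert x (insert y S)))"
    unfolding nondeg_def
  proof (intro ballI impI)
    fix z assume z: "z \<in> span (insert x (insert y S))" "\<forall>w\<in>span (insert x (insert y S)). b z w = 0"
    then obtain c where "z - c *s x \<in> span (insert y S)" using span_breakdown_eq by blast
    then obtain d where w: "z - c *s x - d *s y \<in> span S" using span_breakdown_eq by blast
    have zw: "b z w = 0" if "w \<in> insert x (insert y S)" for w using z(2) span_base[OF that] by blast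
    have "b x (z - c *s x - d *s y) = - (c * (2 * Q x) + d * b x y)"
      "b y (z - c *s x - d *s y) = - (c * b x y + d * (2 * Q y))"
      using zw[of x] zw[of y] by (simp_all add: b_simps b_self b_sym[of y x] b_sym[of x z] b_sym[of y z])
    then have 1: "c * (2 * Q x) + d * b x y = 0" and 2: "c * b x y + d * (2 * Q y) = 0"
      using b_span_eq_0[OF xs w] b_span_eq_0[OF ys w] by (metis neg_equal_0_iff_equal)+
    have "c * plane_disc x y = 2 * Q y * (c * (2 * Q x) + d * b x y) - b x y * (c * b x y + d * (2 * Q y))"
      by (simp add: plane_disc_def power2_eq_square algebra_simps)
    then have c: "c = 0" using D 1 2 by simp
    have "d * plane_disc x y = 2 * Q x * (c * b x y + d * (2 * Q y)) - b x y * (c * (2 * Q x) + d * b x y)"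
      by (simp add: plane_disc_def power2_eq_square algebra_simps)
    then have d: "d = 0" using D 1 2 by simp
    show "z = 0" using nondegD[OF nd, of z] w zw c d by auto
  qed
qed

text \<open>Bases of orthogonal sums of binary lattices, not necessarily hyperbolic. Their Gram
  determinants are congruent to -1 modulo \<open>p\<close>, so the sums are unimodular for
  \<open>b\<close>.\<close>

inductive planes :: "'v set \<Rightarrow> bool" where
  planes_empty: "planes {}"
| planes_insert: "planes S \<Longrightarrow> (\<forall>s\<in>S. b x s = 0) \<Longrightarrow> (\<forall>s\<in>S. b y s = 0) \<Longrightarrow> b x y = 1 \<Longrightarrow>
    Q x \<in> R \<Longrightarrow> Q y \<in> R \<Longrightarrow> planes (insert x (insert y S))"

lemma plane_disc_unit:
  assumes "Q x \<in> R" "Q y \<in> R" "b x y \<in> R" "b x y \<notin> P"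
  shows "plane_disc x y \<in> R" "plane_disc x y \<notin> P" "plane_disc x y \<noteq> 0"
proof -
  have 4: "2 * (2 * (Q x * Q y)) \<in> P" using assms by (intro P_mult[OF P_two] R_mult R_two)
  have eq: "plane_disc x y = 2 * (2 * (Q x * Q y)) - b x y * b x y"
    by (simp add: plane_disc_def power2_eq_square)
  show "plane_disc x y \<in> R" unfolding eq by (intro R_diff P_R[OF 4] R_mult assms)
  show "plane_disc x y \<notin> P"
  proof
    assume "plane_disc x y \<in> P"
    then have "2 * (2 * (Q x * Q y)) - plane_disc x y \<in> P" by (rule P_diff[OF 4])
    then show False using unit_mult[OF assms(3,4,4)] by (simp add: eq)
  qed
  then show "plane_disc x y \<noteq> 0" by (rule unit_nonzero)
qed

lemma planes_disc:
  assumes "b x y = 1" "Q x \<in> R" "Q y \<in> R"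
  shows "plane_disc x y \<in> R" "plane_disc x y \<notin> P" "plane_disc x y \<noteq> 0"
  using plane_disc_unit[of x y] assms R_one P_one by auto

lemma planes_basic:
  assumes "planes S"
  shows "finite S \<and> independent S \<and> even (card S) \<and> nondeg (span S) \<and> integral (gen S)"
  using assms
proof (induction rule: planes.induct)
  case planes_empty
  have "gen {} = {0}" using gen_finite[of "{}"] R_zero by auto
  then show ?case using independent_empty by (auto simp: nondeg_def integral_def R_zero)
next
  case (planes_insert S x y)
  note D = planes_disc[OF planes_insert.hyps(4-6)]
  have IH: "finite S" "independent S" "even (card S)" "nondeg (span S)" "integral (gen S)"
    using planes_insert.IH by auto
  have nd: "nondeg (span (insert x (insert y S)))" "y \<notin> span S" "x \<notin> span (insert y S)"
    using nondeg_insert_plane[OF IH(4) _ _ D(3)] planes_insert.hyps by auto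
  have ind: "independent (insert x (insert y S))" using nd(2,3) IH(2) by (intro independent_insertI)
  have "y \<notin> S" "x \<notin> insert y S" using nd(2,3) span_base by blast+
  then have "even (card (insert x (insert y S)))" using IH(1,3) by simp
  moreover have "integral (gen (insert x (insert y S)))"
    unfolding integral_def
  proof
    fix z assume "z \<in> gen (insert x (insert y S))"
    then obtain c d w where z: "c \<in> R" "d \<in> R" "w \<in> gen S" "z = c *s x + (d *s y + w)"
      unfolding gen_insert2 by blast
    have wsp: "w \<in> span S" using z(3) gen_subset_span by blast
    have "b x w = 0" "b y w = 0"
      using b_span_eq_0[OF _ wsp, of x] b_span_eq_0[OF _ wsp, of y] planes_insert.hyps by auto
    then have "Q z = c\<^sup>2 * Q x + (d\<^sup>2 * Q y + Q w) + c * d"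
      using planes_insert.hyps(4) by (simp add: z(4) Q_add Q_scale b_simps)
    moreover have "Q w \<in> R" using IH(5) z(3) by (simp add: integral_def)
    ultimately show "Q z \<in> R" using z planes_insert.hyps by (simp add: R_add R_mult R_square)
  qed
  ultimately show ?case using IH(1) ind nd(1) by simp
qed

text \<open>The Gram determinant of each plane is a unit, so the projection to it has integral
  coefficients.\<close>

lemma planes_split:
  assumes "planes S" "\<forall>s\<in>S. b z s \<in> R"
  shows "\<exists>j\<in>gen S. \<forall>s\<in>S. b (z - j) s = 0"
  using assms
proof (induction arbitrary: z rule: planes.induct)
  case planes_empty
  then show ?case using submod_zero[OF submod_gen] by blast
next
  case (planes_insert S x y)
  note D = planes_disc[OF planes_insert.hyps(4-6)]
  obtain j where j: "j \<in> gen S" "\<forall>s\<in>S. b (z - j) s = 0" using planes_insert by blast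
  have jsp: "j \<in> span S" using j(1) gen_subset_span by blast
  have bj: "b x j = 0" "b y j = 0"
    using b_span_eq_0[OF _ jsp, of x] b_span_eq_0[OF _ jsp, of y] planes_insert.hyps by auto
  define \<alpha> where "\<alpha> = (2 * Q y * b z x - b x y * b z y) / plane_disc x y"
  define \<beta> where "\<beta> = (2 * Q x * b z y - b x y * b z x) / plane_disc x y"
  have pr: "b (z - \<alpha> *s x - \<beta> *s y) x = 0" "b (z - \<alpha> *s x - \<beta> *s y) y = 0"
    unfolding \<alpha>_def \<beta>_def by (rule plane_projection[OF D(3)])+
  have zR: "b z x \<in> R" "b z y \<in> R" using planes_insert.prems by auto
  have iD: "inverse (plane_disc x y) \<in> R" by (rule unit_inverse[OF D(1,2)])
  have \<alpha>R: "\<alpha> \<in> R" unfolding \<alpha>_def divide_inverse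
    using zR planes_insert.hyps R_one by (intro R_mult[OF _ iD] R_diff R_mult R_two) auto
  have \<beta>R: "\<beta> \<in> R" unfolding \<beta>_def divide_inverse
    using zR planes_insert.hyps R_one by (intro R_mult[OF _ iD] R_diff R_mult R_two) auto
  let ?j = "\<alpha> *s x + (\<beta> *s y + j)"
  have jg: "?j \<in> gen (insert x (insert y S))" using \<alpha>R \<beta>R j(1) unfolding gen_insert2 by blast
  have "b (z - ?j) s = 0" if "s \<in> insert x (insert y S)" for s
    using that pr bj j(2) planes_insert.hyps(2,3)
    by (auto simp: b_simps b_sym[of j x] b_sym[of j y] algebra_simps)
  then show ?case using jg by (intro bexI[of _ ?j]) blast
qed

text \<open>A unimodular lattice is its own dual: removing the integral projection leaves a vector
  orthogonal to the whole space.\<close>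

lemma planes_unimodular:
  assumes "planes S" "x \<in> span S" "\<And>s. s \<in> S \<Longrightarrow> b x s \<in> R"
  shows "x \<in> gen S"
proof -
  obtain j where j: "j \<in> gen S" "\<forall>s\<in>S. b (x - j) s = 0" using planes_split[OF assms(1)] assms(3) by blast
  have "x - j \<in> span S" using assms(2) j(1) gen_subset_span by (intro span_diff) auto
  then have "x - j = 0" using nondegD[of S "x - j"] j(2) planes_basic[OF assms(1)] by blast
  then show ?thesis using j(1) by simp
qed

text \<open>As the lattice is its own dual, such a vector is \<open>p\<close> times a lattice
  vector.\<close>

lemma planes_P:
  assumes S: "planes S" and x: "x \<in> span S" "\<And>s. s \<in> S \<Longrightarrow> b x s \<in> P"
  shows "Q x \<in> P"
proof -
  have "(1 / p) *s x \<in> gen S"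
    using x by (intro planes_unimodular[OF S] span_scale) (auto simp: b_scale_left P_def)
  then have "Q ((1 / p) *s x) \<in> R" using planes_basic[OF S] by (simp add: integral_def)
  then have "p * (p * Q ((1 / p) *s x)) \<in> P" by (intro P_p_mult R_mult p_mem)
  then show ?thesis using p_nonzero by (simp add: Q_scale power2_eq_square)
qed

lemma planes_maxl:
  assumes S: "planes S"
  shows "maxl (gen S)"
  unfolding maxl_def span_gen
proof (intro conjI ballI impI submod_gen)
  show "integral (gen S)" using planes_basic[OF S] by blast
  fix x assume "x \<in> span S" "\<forall>y\<in>gen S. b x y \<in> R"
  then show "x \<in> gen S" using gen_base by (intro planes_unimodular[OF S]) auto
qed

text \<open>Equality of two radicals in the reduction modulo \<open>p\<close>: that of the quadratic
  form and that of its polar form.\<close>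

definition good :: "'v set \<Rightarrow> bool" where
  "good N \<longleftrightarrow> (\<forall>x\<in>N. (\<forall>y\<in>N. b x y \<in> P) \<longrightarrow> Q x \<in> P)"

lemma planes_good:
  assumes S: "planes S"
  shows "good (gen S)"
  unfolding good_def
proof (intro ballI impI)
  fix x assume "x \<in> gen S" "\<forall>y\<in>gen S. b x y \<in> P"
  then show "Q x \<in> P" using gen_subset_span gen_base by (intro planes_P[OF S]) auto
qed

section \<open>Orthogonal complements in lattices\<close>

lemma orthogonal_union_independent:
  assumes S: "independent S" "nondeg (span S)" and E: "finite E" "independent E" "\<And>e s. e \<in> E \<Longrightarrow> s \<in> S \<Longrightarrow> b e s = 0"
  shows "independent (S \<union> E) \<and> S \<inter> E = {}"
  using E
proof (induction E)
  case empty
  then show ?case using S by simp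
next
  case (insert e E)
  have ind: "independent E" and esp: "e \<notin> span E" using insert.prems(1) insert.hyps(2) by (auto simp: independent_insert)
  then have IH: "independent (S \<union> E)" "S \<inter> E = {}" using insert.IH insert.prems(2) by auto
  have "e \<notin> span (S \<union> E)"
  proof
    assume "e \<in> span (S \<union> E)"
    then obtain u w where uw: "u \<in> span S" "w \<in> span E" "e = u + w" unfolding span_Un by blast
    have "b u s = 0" if "s \<in> S" for s
    proof -
      have "b w s = 0" using b_span_eq_0_left[OF _ uw(2)] insert.prems(2) that by blast
      moreover have "b e s = 0" using insert.prems(2) that by blast
      ultimately show ?thesis by (simp add: uw(3) b_add_left)
    qed
    then have "u = 0" by (rule nondegD[OF S(2) uw(1)])
    then show False using esp uw by simp
  qed
  then show ?case using IH span_base[of e "S \<union> E"] independent_insertI[of e "S \<union> E"] by auto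
qed

text \<open>Subtracting from each generator of \<open>gen F\<close> its component in
  \<open>gen S\<close> gives finitely many generators of the complement. The count of ranks is what
  decides the parity of the rank of the complement later.\<close>

lemma complement_basis:
  assumes F: "finite F" and S: "finite S" "independent S" "S \<subseteq> gen F" "nondeg (span S)"
    and split: "\<And>z. z \<in> gen F \<Longrightarrow> \<exists>j\<in>gen S. \<forall>s\<in>S. b (z - j) s = 0"
  shows "\<exists>E. finite E \<and> independent E \<and> gen E = {z \<in> gen F. \<forall>s\<in>S. b z s = 0} \<and>
    card S + card E = dim (span F)"
proof -
  define C where "C = {z \<in> gen F. \<forall>s\<in>S. b z s = 0}"
  have subC: "submod C"
    by (rule submodI) (auto simp: C_def b_simps intro: submod_zero submod_add submod_scale submod_gen)
  have gS: "gen S \<subseteq> gen F" using S(3) by (rule gen_minimal[OF submod_gen])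
  have "\<forall>g\<in>F. \<exists>t. t \<in> C \<and> g - t \<in> gen S"
  proof
    fix g assume g: "g \<in> F"
    obtain j where j: "j \<in> gen S" "\<forall>s\<in>S. b (g - j) s = 0" using split[OF gen_base[OF g]] by blast
    have "g - j \<in> gen F" using gen_base[OF g] j(1) gS by (intro submod_diff[OF submod_gen]) auto
    then show "\<exists>t. t \<in> C \<and> g - t \<in> gen S" using j by (intro exI[of _ "g - j"]) (auto simp: C_def)
  qed
  then obtain t where t: "\<And>g. g \<in> F \<Longrightarrow> t g \<in> C" "\<And>g. g \<in> F \<Longrightarrow> g - t g \<in> gen S" by metis
  define D where "D = {z. \<exists>u\<in>gen (t ` F). z - u \<in> gen S}"
  have "submod D"
  proof (rule submodI)
    show "0 \<in> D" unfolding D_def using submod_zero[OF submod_gen] by (intro CollectI bexI[of _ 0]) auto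
  next
    fix x y assume "x \<in> D" "y \<in> D"
    then obtain u w where uw: "u \<in> gen (t ` F)" "w \<in> gen (t ` F)" "x - u \<in> gen S" "y - w \<in> gen S"
      unfolding D_def by blast
    have "x + y - (u + w) = (x - u) + (y - w)" by simp
    then have "x + y - (u + w) \<in> gen S" using submod_add[OF submod_gen uw(3,4)] by metis
    then show "x + y \<in> D" unfolding D_def using submod_add[OF submod_gen uw(1,2)] by blast
  next
    fix c x assume "c \<in> R" "x \<in> D"
    then obtain u where u: "u \<in> gen (t ` F)" "x - u \<in> gen S" unfolding D_def by blast
    have "c *s x - c *s u = c *s (x - u)" by (simp add: scale_right_diff_distrib)
    then have "c *s x - c *s u \<in> gen S" using submod_scale[OF submod_gen \<open>c \<in> R\<close> u(2)] by simp
    then show "c *s x \<in> D" unfolding D_def using submod_scale[OF submod_gen \<open>c \<in> R\<close> u(1)] by blast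
  qed
  moreover have "F \<subseteq> D"
  proof
    fix g assume "g \<in> F"
    then show "g \<in> D" unfolding D_def using t(2) gen_base[of "t g" "t ` F"] by blast
  qed
  ultimately have FD: "gen F \<subseteq> D" by (rule gen_minimal)
  have tC: "gen (t ` F) \<subseteq> C" using t(1) by (intro gen_minimal[OF subC]) auto
  have "C \<subseteq> gen (t ` F)"
  proof
    fix z assume z: "z \<in> C"
    then obtain u where u: "u \<in> gen (t ` F)" "z - u \<in> gen S" using FD by (auto simp: C_def D_def)
    have "z - u \<in> C" using z u(1) tC by (intro submod_diff[OF subC]) auto
    then have "z - u = 0"
      using nondegD[OF S(4), of "z - u"] u(2) gen_subset_span by (auto simp: C_def)
    then show "z \<in> gen (t ` F)" using u(1) by simp
  qed
  then have gt: "gen (t ` F) = C" using tC by blast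
  obtain E where E: "finite E" "independent E" "gen E = gen (t ` F)" using gen_basis[of "t ` F"] F by blast
  have EC: "E \<subseteq> C" using gen_base[of _ E] E(3) gt by blast
  have ind: "independent (S \<union> E)" "S \<inter> E = {}"
    using orthogonal_union_independent[OF S(2,4) E(1,2)] EC by (auto simp: C_def)
  have "span (S \<union> E) = span F"
  proof
    have "S \<union> E \<subseteq> span F" using S(3) EC gen_subset_span[of F] by (auto simp: C_def)
    then show "span (S \<union> E) \<subseteq> span F" by (intro span_minimal subspace_span)
    have "F \<subseteq> span (S \<union> E)"
    proof
      fix g assume g: "g \<in> F"
      have "t g \<in> gen E" using t(1)[OF g] E(3) gt by simp
      then have "t g \<in> span (S \<union> E)" using gen_subset_span span_mono[of E "S \<union> E"] by blast
      moreover have "g - t g \<in> span (S \<union> E)"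
        using t(2)[OF g] gen_subset_span span_mono[of S "S \<union> E"] by blast
      ultimately have "(g - t g) + t g \<in> span (S \<union> E)" by (intro span_add)
      then show "g \<in> span (S \<union> E)" by simp
    qed
    then show "span F \<subseteq> span (S \<union> E)" by (intro span_minimal subspace_span)
  qed
  then have "dim (span F) = card (S \<union> E)" using dim_span_eq_card_independent[OF ind(1)] by simp
  then have "card S + card E = dim (span F)" using card_Un_disjoint[OF S(1) E(1) ind(2)] by simp
  then show ?thesis using E gt unfolding C_def by blast
qed

text \<open>A vector orthogonal to \<open>S\<close> pairs with \<open>L\<close> only through the
  complement, so the maximality of \<open>L\<close> applies to it.\<close>

lemma maxl_complement:
  assumes L: "maxl L" and S: "S \<subseteq> L"
    and split: "\<And>z. z \<in> L \<Longrightarrow> \<exists>j\<in>gen S. \<forall>s\<in>S. b (z - j) s = 0"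
  shows "maxl {z \<in> L. \<forall>s\<in>S. b z s = 0}"
proof -
  let ?C = "{z \<in> L. \<forall>s\<in>S. b z s = 0}"
  note sub = maxl_submod[OF L]
  have subC: "submod ?C"
    by (rule submodI) (auto simp: b_simps intro: submod_zero submod_add submod_scale sub)
  have "x \<in> ?C" if x: "x \<in> span ?C" "Q x \<in> R" "\<forall>y\<in>?C. b x y \<in> R" for x
  proof -
    have xs: "b x s = 0" if "s \<in> S" for s using b_span_eq_0_left[OF _ x(1), of s] that by blast
    have "b x z \<in> R" if z: "z \<in> L" for z
    proof -
      obtain j where j: "j \<in> gen S" "\<forall>s\<in>S. b (z - j) s = 0" using split[OF z] by blast
      have "gen S \<subseteq> L" by (rule gen_minimal[OF sub S])
      then have "z - j \<in> ?C" using j z by (auto intro: submod_diff[OF sub])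
      then have "b x (z - j) \<in> R" using x(3) by blast
      moreover have "b x j = 0" using b_span_eq_0[OF xs] j(1) gen_subset_span by blast
      ultimately show ?thesis by (simp add: b_diff_right)
    qed
    moreover have "x \<in> span L" using x(1) span_mono[of ?C L] by blast
    ultimately have "x \<in> L" using x(2) by (intro maxlD[OF L]) auto
    then show ?thesis using xs by blast
  qed
  moreover have "integral ?C" using maxl_integral[OF L] by (auto simp: integral_def)
  ultimately show ?thesis using subC unfolding maxl_def by blast
qed

text \<open>In a system of planes of greatest cardinality, two vectors orthogonal to it with unit
  pairing would span one more plane.\<close>

lemma ex_planes_decomposition:
  assumes F: "finite F" "integral (gen F)"
  shows "\<exists>S. planes S \<and> S \<subseteq> gen F \<and>
    (\<forall>x\<in>gen F. \<forall>y\<in>gen F. (\<forall>s\<in>S. b x s = 0) \<longrightarrow> (\<forall>s\<in>S. b y s = 0) \<longrightarrow> b x y \<in> P)"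
proof -
  define \<Phi> where "\<Phi> S \<longleftrightarrow> planes S \<and> S \<subseteq> gen F" for S
  have bound: "card S < card F + 1" if "\<Phi> S" for S
  proof -
    have "independent S" "S \<subseteq> span F"
      using that planes_basic[of S] gen_subset_span[of F] unfolding \<Phi>_def by auto
    then show ?thesis using independent_span_bound[OF F(1)] by (simp add: less_Suc_eq_le)
  qed
  have "\<Phi> {}" by (simp add: \<Phi>_def planes_empty)
  then obtain S where S: "\<Phi> S" "\<And>T. \<Phi> T \<Longrightarrow> card T \<le> card S"
    using ex_has_greatest_nat[of \<Phi> "{}" card "card F + 1"] bound by metis
  have "b x y \<in> P" if x: "x \<in> gen F" "\<forall>s\<in>S. b x s = 0" and y: "y \<in> gen F" "\<forall>s\<in>S. b y s = 0" for x y
  proof (rule ccontr)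
    assume n: "b x y \<notin> P"
    have bR: "b x y \<in> R" by (rule integral_b[OF F(2) submod_gen x(1) y(1)])
    define z where "z = inverse (b x y) *s y"
    have z: "z \<in> gen F" unfolding z_def by (rule submod_scale[OF submod_gen unit_inverse[OF bR n] y(1)])
    have zs: "\<forall>s\<in>S. b z s = 0" using y(2) by (simp add: z_def b_scale_left)
    have bz: "b x z = 1" using unit_nonzero[OF n] by (simp add: z_def b_scale_right)
    have QR: "Q x \<in> R" "Q z \<in> R" using F(2) x(1) z by (auto simp: integral_def)
    have pl: "planes S" "S \<subseteq> gen F" using S(1) by (auto simp: \<Phi>_def)
    have "planes (insert x (insert z S))" by (rule planes_insert[OF pl(1) x(2) zs bz QR])
    then have le: "card (insert x (insert z S)) \<le> card S" using x(1) z pl(2) by (intro S(2)) (auto simp: \<Phi>_def)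
    have "z \<notin> span S" "x \<notin> span (insert z S)"
      using nondeg_insert_plane[of S x z] planes_basic[OF pl(1)] x(2) zs planes_disc(3)[OF bz QR] by auto
    then have "z \<notin> S" "x \<notin> insert z S" using span_base by blast+
    then show False using le planes_basic[OF pl(1)] by simp
  qed
  then show ?thesis using S(1) unfolding \<Phi>_def by (intro exI[of _ S]) simp
qed

lemma maxl_divide_p:
  assumes "maxl T" "\<And>y. y \<in> T \<Longrightarrow> b x y \<in> P" "x \<in> T" "Q x / p\<^sup>2 \<in> R"
  shows "(1 / p) *s x \<in> T"
proof (rule maxlD[OF assms(1)])
  show "(1 / p) *s x \<in> span T" by (rule span_scale[OF span_base[OF assms(3)]])
  show "Q ((1 / p) *s x) \<in> R" using assms(4) by (simp add: Q_scale power_divide)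
  show "b ((1 / p) *s x) y \<in> R" if "y \<in> T" for y
    using assms(2)[OF that] by (simp add: b_scale_left P_def)
qed

text \<open>The norms of \<open>u\<close> and \<open>q\<close> have valuations 0 and 1, so
  \<open>coefficients_integral\<close> shows that integral norms force integral coordinates. The
  vector \<open>u\<close> is in the radical of \<open>b\<close> modulo \<open>p\<close> because
  \<open>b u u = 2 * Q u\<close>.\<close>

lemma bad_lattice:
  assumes S: "planes S" and u: "\<And>s. s \<in> S \<Longrightarrow> b u s = 0" "Q u \<in> R" "Q u \<notin> P"
    and q: "\<And>s. s \<in> S \<Longrightarrow> b q s = 0" "Q q \<in> P" "Q q / p\<^sup>2 \<notin> R" and uq: "b u q = 0"
  defines "E \<equiv> insert u (insert q S)"
  shows "finite E" "independent E" "card E = card S + 2" "nondeg (span E)" "maxl (gen E)"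
    "\<forall>y\<in>gen E. b u y \<in> P"
proof -
  have pS: "finite S" "independent S" "nondeg (span S)" "integral (gen S)"
    using planes_basic[OF S] by auto
  have q0: "Q q \<noteq> 0" using q(3) R_zero by auto
  have nq: "nondeg (span (insert q S))" "q \<notin> span S" using nondeg_insert[OF pS(3) q(1) q0] by auto
  have us: "b u s = 0" if "s \<in> insert q S" for s using u(1) uq that by blast
  have nu: "nondeg (span E)" "u \<notin> span (insert q S)"
    using nondeg_insert[OF nq(1) us unit_nonzero[OF u(3)]] by (auto simp: E_def)
  show "finite E" using pS by (simp add: E_def)
  show "independent E" unfolding E_def by (intro independent_insertI nu nq pS)
  have "q \<notin> S" "u \<notin> insert q S" using nq(2) nu(2) span_base by blast+
  then show "card E = card S + 2" using pS(1) by (simp add: E_def)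
  show "nondeg (span E)" by (rule nu)
  have Qsum: "Q (c *s u + (d *s q + w)) = c\<^sup>2 * Q u + d\<^sup>2 * Q q + Q w" if "w \<in> span S" for c d w
    using b_span_eq_0[OF u(1) that] b_span_eq_0[OF q(1) that] uq by (simp add: Q_add Q_scale b_simps)
  have "integral (gen E)"
    unfolding integral_def
  proof
    fix x assume "x \<in> gen E"
    then obtain c d w where x: "c \<in> R" "d \<in> R" "w \<in> gen S" "x = c *s u + (d *s q + w)"
      unfolding E_def gen_insert2 by blast
    have "w \<in> span S" "Q w \<in> R" using x(3) gen_subset_span pS(4) by (auto simp: integral_def)
    then show "Q x \<in> R" using x u(2) P_R[OF q(2)] by (simp add: Qsum R_add R_mult R_square)
  qed
  moreover have "x \<in> gen E" if x: "x \<in> span E" "Q x \<in> R" "\<forall>y\<in>gen E. b x y \<in> R" for x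
  proof -
    obtain c where "x - c *s u \<in> span (insert q S)" using x(1) unfolding E_def span_breakdown_eq by blast
    then obtain d where w: "x - c *s u - d *s q \<in> span S" using span_breakdown_eq by blast
    define w where "w = x - c *s u - d *s q"
    have xw: "x = c *s u + (d *s q + w)" by (simp add: w_def)
    have "b w s \<in> R" if s: "s \<in> S" for s
    proof -
      have "b x s \<in> R" using x(3) gen_base[of s E] s by (auto simp: E_def)
      then show ?thesis using u(1)[OF s] q(1)[OF s] by (simp add: w_def b_simps)
    qed
    then have wg: "w \<in> gen S" using w by (intro planes_unimodular[OF S]) (auto simp: w_def)
    have "Q x - Q w \<in> R" using pS(4) wg x(2) by (intro R_diff) (auto simp: integral_def)
    then have "c\<^sup>2 * Q u + d\<^sup>2 * Q q \<in> R" using w by (simp add: xw Qsum w_def[symmetric])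
    then have "c \<in> R" "d \<in> R" using coefficients_integral[OF u(2,3) q(2,3)] by blast+
    then show ?thesis using wg xw unfolding E_def gen_insert2 by blast
  qed
  ultimately show "maxl (gen E)" unfolding maxl_def span_gen using submod_gen by blast
  show "\<forall>y\<in>gen E. b u y \<in> P"
  proof
    fix y assume "y \<in> gen E"
    then obtain c d w where y: "c \<in> R" "d \<in> R" "w \<in> gen S" "y = c *s u + (d *s q + w)"
      unfolding E_def gen_insert2 by blast
    have "b u w = 0" using b_span_eq_0[OF u(1)] y(3) gen_subset_span by blast
    then have "b u y = 2 * (c * Q u)" by (simp add: y(4) b_simps b_self uq)
    then show "b u y \<in> P" using P_mult[OF P_two R_mult[OF y(1) u(2)]] by simp
  qed
qed

end

section \<open>Reductions of maximal lattices of corank one\<close>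

context dvr_quadratic
begin

lemma gen_coeff:
  assumes E: "finite E" "independent E" "e \<in> E" and w: "w \<in> span (E - {e})" "c *s e + w \<in> gen E"
  shows "c \<in> R"
proof -
  have "finite (E - {e})" using E(1) by simp
  then obtain k where k: "w = (\<Sum>i\<in>E - {e}. k i *s i)" using w(1) span_finite[of "E - {e}"] by auto
  have "c *s e + w = (\<Sum>i\<in>E. (k(e := c)) i *s i)"
    using E(1,3) by (simp add: sum.remove[of E e] k)
  then have "(\<Sum>i\<in>E. (k(e := c)) i *s i) \<in> gen E" using w(2) by simp
  then have "(k(e := c)) e \<in> R" by (rule gen_independent_coeff[OF E(1,2) _ E(3)])
  then show ?thesis by simp
qed

lemma inverse_p_notin_R: "1 / p \<notin> R"
  using p_nonunit by (simp add: divide_inverse)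

text \<open>In the space spanned by one plane of \<open>S\<close> and \<open>a\<close> there are
  orthogonal vectors with norms of valuations 0 and 1. They replace that plane in
  \<open>bad_lattice\<close>.\<close>

lemma rank_one_bad:
  assumes S: "planes S" "S \<noteq> {}" and a: "\<And>s. s \<in> S \<Longrightarrow> b a s = 0" "Q a \<in> R" "Q a / p\<^sup>2 \<notin> R"
  shows "\<exists>E u. finite E \<and> independent E \<and> card E = card S \<and> E \<subseteq> span (insert a S) \<and> nondeg (span E) \<and>
    maxl (gen E) \<and> u \<in> gen E \<and> Q u \<notin> P \<and> (\<forall>y\<in>gen E. b u y \<in> P)"
proof -
  from S(1) obtain S1 x y where S1: "S = insert x (insert y S1)" "planes S1" "\<forall>s\<in>S1. b x s = 0"
    "\<forall>s\<in>S1. b y s = 0" and xy: "b x y = 1" "Q x \<in> R" "Q y \<in> R"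
    using S(2) by (cases rule: planes.cases) auto
  have pS1: "finite S1" "nondeg (span S1)" using planes_basic[OF S1(2)] by auto
  have "y \<notin> span S1" "x \<notin> span (insert y S1)"
    using nondeg_insert_plane[OF pS1(2) _ _ planes_disc(3)[OF xy]] S1(3,4) by auto
  then have "y \<notin> S1" "x \<notin> insert y S1" using span_base by blast+
  then have card: "card S = card S1 + 2" using pS1(1) by (simp add: S1(1))
  have ax: "b a x = 0" and ay: "b a y = 0" and aS1: "\<And>s. s \<in> S1 \<Longrightarrow> b a s = 0"
    using a(1) by (auto simp: S1(1))
  have xa: "b x a = 0" and ya: "b y a = 0" using ax ay by (simp_all add: b_sym)
  have insp: "a \<in> span (insert a S)" "x \<in> span (insert a S)" "y \<in> span (insert a S)" "S1 \<subseteq> span (insert a S)"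
    by (auto simp: S1(1) intro: span_base)
  have concl: ?thesis if u: "\<And>s. s \<in> S1 \<Longrightarrow> b u s = 0" "Q u \<in> R" "Q u \<notin> P" "u \<in> span (insert a S)"
    and q: "\<And>s. s \<in> S1 \<Longrightarrow> b q s = 0" "Q q \<in> P" "Q q / p\<^sup>2 \<notin> R" "q \<in> span (insert a S)"
    and uq: "b u q = 0" for u q
  proof -
    note bl = bad_lattice[OF S1(2) u(1-3) q(1-3) uq]
    have "insert u (insert q S1) \<subseteq> span (insert a S)" using u(4) q(4) insp(4) by blast
    moreover have "u \<in> gen (insert u (insert q S1))" by (rule gen_base) simp
    ultimately show ?thesis using bl u(3) card
      by (intro exI[of _ "insert u (insert q S1)"] exI[of _ u]) simp
  qed
  show ?thesis
  proof (cases "Q a \<in> P")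
    case True
    \<comment> \<open>Since \<open>b x y = 1\<close>, these three norms cannot all lie in
      \<open>P\<close>. The vector of valuation 1 is \<open>a\<close> itself.\<close>
    have "\<exists>u\<in>{x, y, x + y}. Q u \<notin> P"
    proof (rule ccontr)
      assume "\<not> ?thesis"
      then have "Q (x + y) - Q x - Q y \<in> P" by (intro P_diff) auto
      then show False using xy(1) P_one by (simp add: Q_add)
    qed
    then obtain u where u: "u \<in> {x, y, x + y}" "Q u \<notin> P" by blast
    show ?thesis
    proof (rule concl[of u a])
      show "b u s = 0" if "s \<in> S1" for s using u(1) S1(3,4) that by (auto simp: b_add_left)
      show "Q u \<in> R" using u(1) xy R_one by (auto simp: Q_add intro!: R_add)
      show "u \<in> span (insert a S)" using u(1) insp by (auto intro: span_add)
      show "b u a = 0" using u(1) xa ya by (auto simp: b_add_left)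
    qed (use u True a(3) aS1 insp in auto)
  next
    case False
    \<comment> \<open>Now \<open>Q a\<close> is a unit, and a multiple of \<open>a\<close> moves the
      norm of \<open>x\<close> into \<open>P\<close>.\<close>
    obtain c where c: "c \<in> R" "Q x + c\<^sup>2 * Q a \<in> P" using perfect_solve[OF xy(2) a(2) False] by blast
    define x1 where "x1 = x + c *s a"
    have x1: "Q x1 \<in> P" "b x1 y = 1" "b a x1 = 2 * (c * Q a)"
      using c xa ay xy by (simp_all add: x1_def Q_add Q_scale b_simps b_self ax)
    \<comment> \<open>If \<open>p\<^sup>2\<close> divides \<open>Q x1\<close>, adding
      \<open>p *s y\<close> changes the norm by \<open>p\<close> modulo \<open>p\<^sup>2\<close>,
      because \<open>b x1 y = 1\<close>.\<close>
    obtain e where e: "e \<in> R" "Q (x1 + e *s y) \<in> P" "Q (x1 + e *s y) / p\<^sup>2 \<notin> R"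
    proof (cases "Q x1 / p\<^sup>2 \<in> R")
      case True
      have Qp: "Q (x1 + p *s y) = Q x1 + p * (p * Q y + 1)"
        using x1(2) by (simp add: Q_add Q_scale b_simps power2_eq_square algebra_simps)
      have inR: "p * Q y + 1 \<in> R" by (intro R_add R_mult p_mem xy R_one)
      have "Q (x1 + p *s y) \<in> P" unfolding Qp by (intro P_add x1(1) P_p_mult inR)
      moreover have "Q (x1 + p *s y) / p\<^sup>2 \<notin> R"
      proof
        assume "Q (x1 + p *s y) / p\<^sup>2 \<in> R"
        then have "Q (x1 + p *s y) / p\<^sup>2 - Q x1 / p\<^sup>2 - Q y \<in> R" using True xy by (intro R_diff)
        also have "Q (x1 + p *s y) / p\<^sup>2 - Q x1 / p\<^sup>2 - Q y = 1 / p"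
          unfolding Qp using p_nonzero by (simp add: field_simps power2_eq_square)
        finally show False using inverse_p_notin_R by blast
      qed
      ultimately show ?thesis using that p_mem by blast
    next
      case False
      then show ?thesis using that[of 0] x1(1) R_zero by simp
    qed
    define z where "z = x1 + e *s y"
    have Qz: "Q z \<in> P" "Q z / p\<^sup>2 \<notin> R" using e by (simp_all add: z_def)
    have bzy: "b z y = 1 + 2 * (e * Q y)" using x1(2) by (simp add: z_def b_simps b_self)
    have 2: "2 * (e * Q y) \<in> P" by (intro P_mult[OF P_two] R_mult e xy)
    have bzyR: "b z y \<in> R" unfolding bzy by (intro R_add R_one P_R[OF 2])
    have bzyP: "b z y \<notin> P"
    proof
      assume "b z y \<in> P"
      then have "b z y - 2 * (e * Q y) \<in> P" using 2 by (rule P_diff)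
      then show False using P_one by (simp add: bzy)
    qed
    note D = plane_disc_unit[OF P_R[OF Qz(1)] xy(3) bzyR bzyP]
    have iD: "inverse (plane_disc z y) \<in> R" by (rule unit_inverse[OF D(1,2)])
    have baz: "b a z \<in> P"
      using P_mult[OF P_two R_mult[OF c(1) a(2)]] by (simp add: z_def b_simps x1(3) ay)
    \<comment> \<open>Projecting \<open>a\<close> away from the plane of \<open>z\<close> and
      \<open>y\<close> makes it orthogonal to \<open>z\<close>. The coefficients lie in
      \<open>P\<close>, so the norm remains a unit.\<close>
    define \<alpha> where "\<alpha> = (2 * Q y * b a z - b z y * b a y) / plane_disc z y"
    define \<beta> where "\<beta> = (2 * Q z * b a y - b z y * b a z) / plane_disc z y"
    have \<alpha>P: "\<alpha> \<in> P" unfolding \<alpha>_def ay divide_inverse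
      using P_mult[OF P_mult'[OF R_mult[OF R_two xy(3)] baz] iD] by simp
    have \<beta>P: "\<beta> \<in> P" unfolding \<beta>_def ay divide_inverse
      using P_mult[OF P_uminus[OF P_mult'[OF bzyR baz]] iD] by simp
    define a' where "a' = a - \<alpha> *s z - \<beta> *s y"
    have pr: "b a' z = 0" "b a' y = 0"
      unfolding a'_def \<alpha>_def \<beta>_def by (rule plane_projection[OF D(3)])+
    have zS1: "b z s = 0" if "s \<in> S1" for s
      using that S1(3,4) aS1 by (simp add: z_def x1_def b_simps)
    have a'S1: "b a' s = 0" if "s \<in> S1" for s
      using that zS1[OF that] S1(4) aS1 by (simp add: a'_def b_simps)
    define w where "w = \<alpha> *s z + \<beta> *s y"
    have aw: "a' = a - w" by (simp add: a'_def w_def)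
    have "Q w = \<alpha> * (\<alpha> * Q z) + \<beta> * (\<beta> * Q y) + \<alpha> * (\<beta> * b z y)"
      by (simp add: w_def Q_add Q_scale b_simps power2_eq_square)
    also have "\<dots> \<in> P"
      by (intro P_add P_mult[OF \<alpha>P] P_mult[OF \<beta>P] R_mult P_R[OF \<alpha>P] P_R[OF \<beta>P] P_R[OF Qz(1)] xy bzyR)
    finally have Qw: "Q w \<in> P" .
    have baw: "b a w \<in> P" using P_mult[OF \<alpha>P P_R[OF baz]] by (simp add: w_def b_simps ay)
    have Qa': "Q a' = Q a + Q w - b a w" unfolding aw by (rule Q_diff)
    have inz: "z \<in> span (insert a S)" unfolding z_def x1_def by (intro span_add span_scale insp)
    show ?thesis
    proof (rule concl[of a' z])
      show "Q a' \<in> R" unfolding Qa' by (intro R_diff R_add a P_R[OF Qw] P_R[OF baw])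
      show "Q a' \<notin> P"
      proof
        assume "Q a' \<in> P"
        then have "Q a' - Q w + b a w \<in> P" by (intro P_add P_diff Qw baw)
        then show False using False by (simp add: Qa')
      qed
      show "a' \<in> span (insert a S)" unfolding a'_def by (intro span_diff span_scale insp inz)
    qed (use a'S1 zS1 Qz pr inz in auto)
  qed
qed

text \<open>
  Here \<open>L = J \<perp> T\<close> with \<open>J\<close> a sum of unimodular planes and \<open>b\<close> vanishing modulo \<open>p\<close> on the part
  \<open>T\<close> of rank at least 3. Perfectness of the residue field forces \<open>T\<close> to have rank 3 and to be the
  sum of a \<open>p\<close>-modular plane spanned by \<open>x, y\<close> and a line spanned by a vector of unit norm.
\<close>

lemma rank_three_good_bad:
  assumes F: "finite F" and L: "maxl (gen F)" and S: "planes S" "S \<subseteq> gen F"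
    and E: "finite E" "independent E" "gen E = {z \<in> gen F. \<forall>s\<in>S. b z s = 0}" "3 \<le> card E"
    and bT: "\<And>x y. x \<in> gen E \<Longrightarrow> y \<in> gen E \<Longrightarrow> b x y \<in> P"
    and n: "dim (span F) = n + 1" "even n"
  shows "\<exists>N N' u. finite N \<and> independent N \<and> card N = n \<and> N \<subseteq> span F \<and> nondeg (span N) \<and> maxl (gen N) \<and>
    good (gen N) \<and> finite N' \<and> independent N' \<and> card N' = n \<and> N' \<subseteq> span F \<and> nondeg (span N') \<and>
    maxl (gen N') \<and> u \<in> gen N' \<and> Q u \<notin> P \<and> (\<forall>y\<in>gen N'. b u y \<in> P)"
proof -
  have pS: "finite S" "independent S" "even (card S)" "nondeg (span S)" "integral (gen S)"
    using planes_basic[OF S(1)] by auto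
  have intF: "integral (gen F)" by (rule maxl_integral[OF L])
  have gS: "gen S \<subseteq> gen F" by (rule gen_minimal[OF submod_gen S(2)])
  have splitS: "\<exists>j\<in>gen S. \<forall>s\<in>S. b (z - j) s = 0" if "z \<in> gen F" for z
    using S(2) that by (intro planes_split[OF S(1)] ballI integral_b[OF intF submod_gen]) auto
  have maxT: "maxl (gen E)" unfolding E(3) using splitS by (rule maxl_complement[OF L S(2)])
  have TF: "x \<in> gen F" "\<And>s. s \<in> S \<Longrightarrow> b x s = 0" if "x \<in> gen E" for x using that unfolding E(3) by auto
  have QT: "Q x \<in> R" if "x \<in> gen E" for x using maxl_integral[OF maxT] that by (simp add: integral_def)
  have divp: "(1 / p) *s x \<in> gen E" if "x \<in> gen E" "Q x / p\<^sup>2 \<in> R" for x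
    using maxl_divide_p[OF maxT _ that] bT[OF that(1)] by blast
  \<comment> \<open>Pairings on \<open>gen E\<close> lie in \<open>P\<close>, so \<open>Q\<close> is
    additive there modulo \<open>P\<close>, and a unit norm at \<open>e'\<close> can cancel the norm
    of \<open>e\<close>.\<close>
  have mix: "\<exists>c\<in>R. Q (e - c *s e') \<in> P" if ee: "e \<in> gen E" "e' \<in> gen E" "Q e' \<notin> P \<or> Q e \<in> P" for e e'
  proof (cases "Q e \<in> P")
    case True
    then show ?thesis using R_zero by (intro bexI[of _ 0]) auto
  next
    case False
    obtain c where c: "c \<in> R" "Q e + c\<^sup>2 * Q e' \<in> P"
      using perfect_solve[OF QT[OF ee(1)] QT[OF ee(2)]] ee(3) False by blast
    have "Q (e - c *s e') = (Q e + c\<^sup>2 * Q e') - c * b e e'" by (simp add: Q_diff Q_scale b_simps)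
    also have "\<dots> \<in> P" by (intro P_diff c P_mult'[OF c(1)] bT ee)
    finally show ?thesis using c(1) by blast
  qed
  \<comment> \<open>The vector \<open>e3\<close> has unit norm as soon as some basis vector has, so
    \<open>mix\<close> applies to the other two.\<close>
  obtain e1 e2 e3 where e: "e1 \<in> E" "e2 \<in> E" "e3 \<in> E" "e1 \<noteq> e2" "e1 \<noteq> e3" "e2 \<noteq> e3"
    and e3: "\<And>e. e \<in> E \<Longrightarrow> Q e3 \<notin> P \<or> Q e \<in> P"
  proof -
    obtain e3 where e3: "e3 \<in> E" "\<And>e. e \<in> E \<Longrightarrow> Q e3 \<notin> P \<or> Q e \<in> P"
    proof (cases "\<exists>e\<in>E. Q e \<notin> P")
      case True
      then show ?thesis using that by blast
    next
      case False
      moreover have "E \<noteq> {}" using E(4) by auto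
      ultimately show ?thesis using that by blast
    qed
    have "card (E - {e3}) \<ge> 2" using E(1,4) e3(1) by simp
    then have "E - {e3} \<noteq> {}" by (metis card.empty not_numeral_le_zero)
    then obtain e1 where e1: "e1 \<in> E - {e3}" by blast
    then have "card (E - {e3} - {e1}) \<ge> 1" using E(1,4) e3(1) by simp
    then have "E - {e3} - {e1} \<noteq> {}" by (metis card.empty not_one_le_zero)
    then obtain e2 where "e2 \<in> E - {e3} - {e1}" by blast
    then show ?thesis using that e1 e3 by blast
  qed
  have eg: "e1 \<in> gen E" "e2 \<in> gen E" "e3 \<in> gen E" using e by (auto intro: gen_base)
  obtain c1 where c1: "c1 \<in> R" "Q (e1 - c1 *s e3) \<in> P" using mix[OF eg(1,3) e3[OF e(1)]] by blast
  obtain c2 where c2: "c2 \<in> R" "Q (e2 - c2 *s e3) \<in> P" using mix[OF eg(2,3) e3[OF e(2)]] by blast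
  define x where "x = e1 - c1 *s e3"
  define y where "y = e2 - c2 *s e3"
  have xT: "x \<in> gen E" and yT: "y \<in> gen E"
    unfolding x_def y_def by (intro submod_diff[OF submod_gen] submod_scale[OF submod_gen] eg c1 c2)+
  have Qx: "Q x \<in> P" and Qy: "Q y \<in> P" using c1 c2 by (simp_all add: x_def y_def)
  \<comment> \<open>The coordinates of the combination at \<open>e1\<close> and \<open>e2\<close>
    are its coefficients, because both corrections involve \<open>e3\<close> only.\<close>
  have coeff: "\<alpha> / p \<in> R" "\<beta> / p \<in> R" if "(1 / p) *s (\<alpha> *s x + \<beta> *s y) \<in> gen E" for \<alpha> \<beta>
  proof -
    have sp: "e1 \<in> span (E - {e2})" "e3 \<in> span (E - {e2})" "e2 \<in> span (E - {e1})" "e3 \<in> span (E - {e1})"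
      using e by (auto intro: span_base)
    have "(1 / p) *s (\<alpha> *s x + \<beta> *s y) = (\<alpha> / p) *s e1 + ((\<beta> / p) *s e2 - ((\<alpha> * c1 + \<beta> * c2) / p) *s e3)"
      by (simp add: x_def y_def algebra_simps add_divide_distrib)
    then show "\<alpha> / p \<in> R"
      using that by (intro gen_coeff[OF E(1,2) e(1), of "(\<beta> / p) *s e2 - ((\<alpha> * c1 + \<beta> * c2) / p) *s e3"])
        (auto intro: span_diff span_scale sp)
    have "(1 / p) *s (\<alpha> *s x + \<beta> *s y) = (\<beta> / p) *s e2 + ((\<alpha> / p) *s e1 - ((\<alpha> * c1 + \<beta> * c2) / p) *s e3)"
      by (simp add: x_def y_def algebra_simps add_divide_distrib)
    then show "\<beta> / p \<in> R"
      using that by (intro gen_coeff[OF E(1,2) e(2), of "(\<alpha> / p) *s e1 - ((\<alpha> * c1 + \<beta> * c2) / p) *s e3"])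
        (auto intro: span_diff span_scale sp)
  qed
  have Qx2: "Q x / p\<^sup>2 \<notin> R"
  proof
    assume "Q x / p\<^sup>2 \<in> R"
    then have "(1 / p) *s (1 *s x + 0 *s y) \<in> gen E" using divp[OF xT] by simp
    then show False using coeff(1) inverse_p_notin_R by blast
  qed
  have bxy: "b x y \<in> P" by (rule bT[OF xT yT])
  \<comment> \<open>Otherwise the norms divided by \<open>p\<close> would be additive modulo
    \<open>p\<close> on \<open>x\<close> and \<open>y\<close>, and perfectness would give a
    combination with coefficient 1 at \<open>y\<close> that is divisible by \<open>p\<close> in the
    maximal lattice.\<close>
  have bxy2: "b x y / p\<^sup>2 \<notin> R"
  proof
    assume *: "b x y / p\<^sup>2 \<in> R"
    have "Q y / p \<in> R" "Q x / p \<in> R" using Qx Qy by (simp_all add: P_def)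
    moreover have "Q x / p \<notin> P" using Qx2 by (simp add: P_def power2_eq_square)
    ultimately obtain t where t: "t \<in> R" "Q y / p + t\<^sup>2 * (Q x / p) \<in> P" using perfect_solve by blast
    have "Q (t *s x + 1 *s y) / p\<^sup>2 = (Q y / p + t\<^sup>2 * (Q x / p)) / p + t * (b x y / p\<^sup>2)"
      using p_nonzero by (simp add: Q_add Q_scale b_simps b_sym[of y x] field_simps power2_eq_square)
    also have "\<dots> \<in> R" using t * by (intro R_add R_mult) (auto simp: P_def)
    finally have "(1 / p) *s (t *s x + 1 *s y) \<in> gen E"
      using t(1) xT yT R_one
      by (intro divp submod_add[OF submod_gen] submod_scale[OF submod_gen])
    then show False using coeff(2) inverse_p_notin_R by blast
  qed
  \<comment> \<open>The Gram determinant rescaled to a unit, which expresses that the plane of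
    \<open>x\<close> and \<open>y\<close> is \<open>p\<close>-modular.\<close>
  define \<delta> where "\<delta> = plane_disc x y / p\<^sup>2"
  have \<delta>eq: "\<delta> = 2 * (2 * (Q x / p * (Q y / p))) - (b x y / p) * (b x y / p)"
    using p_nonzero by (simp add: \<delta>_def plane_disc_def field_simps power2_eq_square)
  have bp: "b x y / p \<in> R" "b x y / p \<notin> P" using bxy bxy2 by (simp_all add: P_def power2_eq_square)
  have \<delta>4: "2 * (2 * (Q x / p * (Q y / p))) \<in> P"
    using Qx Qy by (intro P_mult[OF P_two] R_mult R_two) (auto simp: P_def)
  have \<delta>R: "\<delta> \<in> R" unfolding \<delta>eq by (intro R_diff P_R[OF \<delta>4] R_mult bp)
  have \<delta>P: "\<delta> \<notin> P"
  proof
    assume "\<delta> \<in> P"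
    then have "2 * (2 * (Q x / p * (Q y / p))) - \<delta> \<in> P" by (rule P_diff[OF \<delta>4])
    then show False using unit_mult[OF bp bp(2)] by (simp add: \<delta>eq)
  qed
  have \<delta>0: "\<delta> \<noteq> 0" by (rule unit_nonzero[OF \<delta>P])
  then have D0: "plane_disc x y \<noteq> 0" by (auto simp: \<delta>_def)
  have i\<delta>: "inverse \<delta> \<in> R" by (rule unit_inverse[OF \<delta>R \<delta>P])
  define S2 where "S2 = insert x (insert y S)"
  have xS: "\<And>s. s \<in> S \<Longrightarrow> b x s = 0" and yS: "\<And>s. s \<in> S \<Longrightarrow> b y s = 0" using TF(2)[OF xT] TF(2)[OF yT] by auto
  have nd2: "nondeg (span S2)" "y \<notin> span S" "x \<notin> span (insert y S)"
    using nondeg_insert_plane[OF pS(4) xS yS D0] by (auto simp: S2_def)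
  have ind2: "independent S2" unfolding S2_def by (intro independent_insertI nd2 pS)
  have "y \<notin> S" "x \<notin> insert y S" using nd2(2,3) span_base by blast+
  then have card2: "card S2 = card S + 2" using pS(1) by (simp add: S2_def)
  have fin2: "finite S2" using pS(1) by (simp add: S2_def)
  have S2F: "S2 \<subseteq> gen F" using S(2) TF(1)[OF xT] TF(1)[OF yT] by (auto simp: S2_def)
  \<comment> \<open>On \<open>gen E\<close> all pairings lie in \<open>P\<close>, so the numerators
    in Cramer's rule absorb the factor \<open>p\<^sup>2\<close> of the determinant.\<close>
  have split2: "\<exists>j\<in>gen S2. \<forall>s\<in>S2. b (z - j) s = 0" if z: "z \<in> gen F" for z
  proof -
    obtain j where j: "j \<in> gen S" "\<forall>s\<in>S. b (z - j) s = 0" using splitS[OF z] by blast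
    define w where "w = z - j"
    have "w \<in> gen F" using z j(1) gS unfolding w_def by (intro submod_diff[OF submod_gen]) auto
    then have wT: "w \<in> gen E" using j(2) unfolding E(3) w_def by blast
    define \<alpha> where "\<alpha> = (2 * Q y * b w x - b x y * b w y) / plane_disc x y"
    define \<beta> where "\<beta> = (2 * Q x * b w y - b x y * b w x) / plane_disc x y"
    have pr: "b (w - \<alpha> *s x - \<beta> *s y) x = 0" "b (w - \<alpha> *s x - \<beta> *s y) y = 0"
      unfolding \<alpha>_def \<beta>_def by (rule plane_projection[OF D0])+
    have wP: "b w x \<in> P" "b w y \<in> P" using bT wT xT yT by auto
    have D\<delta>: "plane_disc x y = p\<^sup>2 * \<delta>" using p_nonzero by (simp add: \<delta>_def)
    have "\<alpha> = (2 * (Q y * b w x / p\<^sup>2) - b x y * b w y / p\<^sup>2) * inverse \<delta>"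
      unfolding \<alpha>_def D\<delta> using p_nonzero \<delta>0 by (simp add: field_simps)
    also have "\<dots> \<in> R"
      by (rule R_mult[OF R_diff[OF R_mult[OF R_two P_mult_P[OF Qy wP(1)]] P_mult_P[OF bxy wP(2)]] i\<delta>])
    finally have \<alpha>R: "\<alpha> \<in> R" .
    have "\<beta> = (2 * (Q x * b w y / p\<^sup>2) - b x y * b w x / p\<^sup>2) * inverse \<delta>"
      unfolding \<beta>_def D\<delta> using p_nonzero \<delta>0 by (simp add: field_simps)
    also have "\<dots> \<in> R"
      by (rule R_mult[OF R_diff[OF R_mult[OF R_two P_mult_P[OF Qx wP(2)]] P_mult_P[OF bxy wP(1)]] i\<delta>])
    finally have \<beta>R: "\<beta> \<in> R" .
    let ?j = "\<alpha> *s x + (\<beta> *s y + j)"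
    have zj: "z - ?j = w - \<alpha> *s x - \<beta> *s y" by (simp add: w_def)
    have jg: "?j \<in> gen S2" using \<alpha>R \<beta>R j(1) unfolding S2_def gen_insert2 by blast
    have "b (z - ?j) s = 0" if "s \<in> S2" for s
      using that pr TF(2)[OF wT] xS yS unfolding zj S2_def by (auto simp: b_simps)
    then show ?thesis using jg by blast
  qed
  obtain E1 where E1: "finite E1" "independent E1" "gen E1 = {z \<in> gen F. \<forall>s\<in>S2. b z s = 0}"
    "card S2 + card E1 = dim (span F)"
    using complement_basis[OF F fin2 ind2 S2F nd2(1) split2] by blast
  have E1T: "z \<in> gen E" "b z x = 0" "b z y = 0" if "z \<in> gen E1" for z
    using that unfolding E1(3) E(3) S2_def by auto
  \<comment> \<open>A norm of valuation 1 at \<open>z\<close> could be cancelled against that of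
    \<open>x\<close>, making \<open>x + t *s z\<close> divisible by \<open>p\<close>. Pairing with
    \<open>y\<close> would then put \<open>b x y / p\<close> into \<open>P\<close>.\<close>
  have E1div: "(1 / p) *s z \<in> gen E1" if z: "z \<in> gen E1" "Q z \<in> P" for z
  proof -
    have "Q z / p\<^sup>2 \<in> R"
    proof (rule ccontr)
      assume "Q z / p\<^sup>2 \<notin> R"
      then have 1: "Q z / p \<notin> P" by (simp add: P_def power2_eq_square)
      have "Q z / p \<in> R" "Q x / p \<in> R" using z(2) Qx by (simp_all add: P_def)
      then obtain t where t: "t \<in> R" "Q x / p + t\<^sup>2 * (Q z / p) \<in> P" using perfect_solve 1 by blast
      have "Q (x + t *s z) / p\<^sup>2 = (Q x / p + t\<^sup>2 * (Q z / p)) / p"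
        using p_nonzero E1T(2)[OF z(1)]
        by (simp add: Q_add Q_scale b_simps b_sym[of x z] field_simps power2_eq_square)
      also have "\<dots> \<in> R" using t(2) by (simp add: P_def)
      finally have "(1 / p) *s (x + t *s z) \<in> gen E"
        using t(1) xT E1T(1)[OF z(1)]
        by (intro divp submod_add[OF submod_gen] submod_scale[OF submod_gen])
      then have "b ((1 / p) *s (x + t *s z)) y \<in> P" using yT by (rule bT)
      then have "b x y / p \<in> P" using E1T(3)[OF z(1)] by (simp add: b_simps)
      then show False using bp by blast
    qed
    then have "(1 / p) *s z \<in> gen E" by (rule divp[OF E1T(1)[OF z(1)]])
    then have "(1 / p) *s z \<in> gen F" by (rule TF(1))
    then show ?thesis using z(1) unfolding E1(3) by (simp add: b_scale_left)
  qed
  have E1unit: "Q z \<notin> P" if "z \<in> E1" for z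
  proof
    assume "Q z \<in> P"
    then have "(1 / p) *s z + 0 \<in> gen E1" using E1div[OF gen_base[OF that]] by simp
    then have "1 / p \<in> R" by (rule gen_coeff[OF E1(1,2) that span_zero])
    then show False using inverse_p_notin_R by blast
  qed
  \<comment> \<open>Two basis vectors of unit norm would combine to a vector of norm in
    \<open>P\<close>, which is divisible by \<open>p\<close> although one of its coordinates is
    1.\<close>
  have "card E1 < 2"
  proof (rule ccontr)
    assume "\<not> card E1 < 2"
    then obtain f1 where f1: "f1 \<in> E1" by fastforce
    have "card (E1 - {f1}) \<noteq> 0" using \<open>\<not> card E1 < 2\<close> f1 E1(1) by simp
    then obtain f2 where f2: "f2 \<in> E1" "f2 \<noteq> f1" by (metis card.empty insertCI DiffE ex_in_conv)
    have g12: "f1 \<in> gen E1" "f2 \<in> gen E1" using f1 f2 gen_base by auto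
    obtain c where c: "c \<in> R" "Q (f1 - c *s f2) \<in> P"
      using mix[OF E1T(1)[OF g12(1)] E1T(1)[OF g12(2)]] E1unit[OF f2(1)] by blast
    have "f1 - c *s f2 \<in> gen E1" by (intro submod_diff[OF submod_gen] submod_scale[OF submod_gen] g12 c)
    then have "(1 / p) *s (f1 - c *s f2) \<in> gen E1" using c(2) by (rule E1div)
    moreover have "(1 / p) *s (f1 - c *s f2) = (1 / p) *s f1 + - (c / p) *s f2"
      by (simp add: scale_right_diff_distrib)
    ultimately have "(1 / p) *s f1 + - (c / p) *s f2 \<in> gen E1" by simp
    moreover have "- (c / p) *s f2 \<in> span (E1 - {f1})" using f2 by (intro span_scale span_base) auto
    ultimately have "1 / p \<in> R" using gen_coeff[OF E1(1,2) f1] by blast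
    then show False using inverse_p_notin_R by blast
  qed
  moreover have "odd (card E1)"
    using E1(4) n card2 pS(3) by (metis even_add even_numeral odd_one)
  ultimately have cE1: "card E1 = 1" by (metis even_zero less_2_cases_iff One_nat_def)
  then obtain \<epsilon> where \<epsilon>: "E1 = {\<epsilon>}" by (metis card_1_singletonE)
  have \<epsilon>g: "\<epsilon> \<in> gen E1" using \<epsilon> gen_base by simp
  have n2: "card S2 = n" using E1(4) cE1 n(1) by simp
  have S2sp: "S2 \<subseteq> span F" using S2F gen_subset_span by blast
  have gS2: "gen S2 \<subseteq> gen F" by (rule gen_minimal[OF submod_gen S2F])
  have "maxl (gen S2)"
    unfolding maxl_def span_gen
  proof (intro conjI ballI impI submod_gen)
    show "integral (gen S2)" using intF gS2 by (auto simp: integral_def)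
    fix w assume w: "w \<in> span S2" "Q w \<in> R" "\<forall>z\<in>gen S2. b w z \<in> R"
    have "b w z \<in> R" if z: "z \<in> gen F" for z
    proof -
      obtain j where j: "j \<in> gen S2" "\<forall>s\<in>S2. b (z - j) s = 0" using split2[OF z] by blast
      have "b (z - j) w = 0" using b_span_eq_0[of S2 "z - j" w] j(2) w(1) by blast
      then have "b w z = b w j" by (simp add: b_sym[of "z - j" w] b_diff_right)
      then show ?thesis using w(3) j(1) by simp
    qed
    moreover have "w \<in> span (gen F)" using w(1) S2sp span_minimal[OF _ subspace_span, of S2 F] by (auto simp: span_gen)
    ultimately have "w \<in> gen F" using w(2) by (intro maxlD[OF L]) auto
    then obtain j where j: "j \<in> gen S2" "\<forall>s\<in>S2. b (w - j) s = 0" using split2 by blast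
    have "w - j \<in> span S2" using w(1) j(1) gen_subset_span[of S2] by (intro span_diff) auto
    then have "w - j = 0" using nondegD[OF nd2(1), of "w - j"] j(2) by blast
    then show "w \<in> gen S2" using j(1) by simp
  qed
  moreover have "good (gen S2)"
    unfolding good_def
  proof (intro ballI impI)
    fix w assume w: "w \<in> gen S2" "\<forall>z\<in>gen S2. b w z \<in> P"
    then obtain \<alpha> \<beta> j where j: "\<alpha> \<in> R" "\<beta> \<in> R" "j \<in> gen S" "w = \<alpha> *s x + (\<beta> *s y + j)"
      unfolding S2_def gen_insert2 by blast
    have jsp: "j \<in> span S" using j(3) gen_subset_span by blast
    have "b j s \<in> P" if s: "s \<in> S" for s
    proof -
      have "b w s \<in> P" using w(2) gen_base[of s S2] s by (auto simp: S2_def)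
      then show ?thesis using xS[OF s] yS[OF s] by (simp add: j(4) b_simps)
    qed
    then have "Q j \<in> P" by (rule planes_P[OF S(1) jsp])
    moreover have "b x j = 0" "b y j = 0" using b_span_eq_0[OF xS jsp] b_span_eq_0[OF yS jsp] by auto
    ultimately show "Q w \<in> P"
      using j(1,2) Qx Qy bxy by (auto simp: j(4) Q_add Q_scale b_simps intro!: P_add P_mult' R_square)
  qed
  moreover have "insert \<epsilon> (insert x S) \<subseteq> span F"
    using S2F TF(1)[OF E1T(1)[OF \<epsilon>g]] gen_subset_span[of F] by (auto simp: S2_def)
  moreover have "b \<epsilon> s = 0" if "s \<in> S" for s using TF(2)[OF E1T(1)[OF \<epsilon>g] that] .
  moreover have "Q \<epsilon> \<in> R" "Q \<epsilon> \<notin> P" using QT[OF E1T(1)[OF \<epsilon>g]] E1unit[of \<epsilon>] \<epsilon> by auto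
  \<comment> \<open>The second lattice leaves out \<open>y\<close>: it takes
    \<open>\<epsilon>\<close> for the unit norm and \<open>x\<close> for the norm of valuation
    1.\<close>
  ultimately show ?thesis
    using bad_lattice[OF S(1), of \<epsilon> x] xS Qx Qx2 E1T(2)[OF \<epsilon>g] fin2 ind2 n2 card2 nd2(1) S2sp
      gen_base[of \<epsilon> "insert \<epsilon> (insert x S)"]
    by (intro exI[of _ S2] exI[of _ "insert \<epsilon> (insert x S)"] exI[of _ \<epsilon>]) simp
qed

text \<open>The planes have even rank and n + 1 is odd, so the complement has odd rank. If this rank
  is 1, the planes themselves form the good lattice.\<close>

theorem ex_good_bad:
  assumes F: "finite F" and L: "maxl (gen F)" and n: "dim (span F) = n + 1" "even n" "2 \<le> n"
  shows "\<exists>N N' u. finite N \<and> independent N \<and> card N = n \<and> N \<subseteq> span F \<and> nondeg (span N) \<and> maxl (gen N) \<and>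
    good (gen N) \<and> finite N' \<and> independent N' \<and> card N' = n \<and> N' \<subseteq> span F \<and> nondeg (span N') \<and>
    maxl (gen N') \<and> u \<in> gen N' \<and> Q u \<notin> P \<and> (\<forall>y\<in>gen N'. b u y \<in> P)"
proof -
  have intF: "integral (gen F)" by (rule maxl_integral[OF L])
  obtain S where S: "planes S" "S \<subseteq> gen F"
    "\<forall>x\<in>gen F. \<forall>y\<in>gen F. (\<forall>s\<in>S. b x s = 0) \<longrightarrow> (\<forall>s\<in>S. b y s = 0) \<longrightarrow> b x y \<in> P"
    using ex_planes_decomposition[OF F intF] by blast
  have pS: "finite S" "independent S" "even (card S)" "nondeg (span S)"
    using planes_basic[OF S(1)] by auto
  have splitS: "\<exists>j\<in>gen S. \<forall>s\<in>S. b (z - j) s = 0" if "z \<in> gen F" for z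
    using S(2) that by (intro planes_split[OF S(1)] ballI integral_b[OF intF submod_gen]) auto
  obtain E where E: "finite E" "independent E" "gen E = {z \<in> gen F. \<forall>s\<in>S. b z s = 0}"
    "card S + card E = dim (span F)"
    using complement_basis[OF F pS(1,2) S(2) pS(4) splitS] by blast
  have bT: "b x y \<in> P" if "x \<in> gen E" "y \<in> gen E" for x y using S(3) that unfolding E(3) by blast
  show ?thesis
  proof (cases "3 \<le> card E")
    case True
    then show ?thesis by (rule rank_three_good_bad[OF F L S(1,2) E(1-3) _ bT n(1,2)])
  next
    case False
    have "odd (card E)" using E(4) n pS(3) by (metis even_add odd_one)
    then have cE: "card E = 1" using False by (cases "card E = 0 \<or> card E = 1 \<or> card E = 2") auto
    then obtain a where a: "E = {a}" by (metis card_1_singletonE)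
    have aE: "a \<in> gen E" using a gen_base by simp
    have aF: "a \<in> gen F" and aS: "\<And>s. s \<in> S \<Longrightarrow> b a s = 0" using aE unfolding E(3) by auto
    have maxT: "maxl (gen E)" unfolding E(3) using splitS by (rule maxl_complement[OF L S(2)])
    have "Q a / p\<^sup>2 \<notin> R"
    proof
      assume "Q a / p\<^sup>2 \<in> R"
      then have "(1 / p) *s a + 0 \<in> gen E" using maxl_divide_p[OF maxT bT[OF aE] aE] by simp
      moreover have "a \<in> E" by (simp add: a)
      ultimately have "1 / p \<in> R" using gen_coeff[OF E(1,2) _ span_zero] by blast
      then show False using inverse_p_notin_R by blast
    qed
    moreover have "Q a \<in> R" using intF aF by (simp add: integral_def)
    moreover have cS: "card S = n" using E(4) cE n(1) by simp
    moreover have "S \<noteq> {}" using cS n(3) by auto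
    ultimately obtain N' u where N': "finite N'" "independent N'" "card N' = n" "N' \<subseteq> span (insert a S)"
      "nondeg (span N')" "maxl (gen N')" "u \<in> gen N'" "Q u \<notin> P" "\<forall>y\<in>gen N'. b u y \<in> P"
      using rank_one_bad[OF S(1), of a] aS by metis
    have "insert a S \<subseteq> span F" using aF S(2) gen_subset_span[of F] by auto
    then have "N' \<subseteq> span F" "S \<subseteq> span F" using N'(4) span_minimal[OF _ subspace_span] by blast+
    then show ?thesis
      using N' pS cS planes_maxl[OF S(1)] planes_good[OF S(1)]
      by (intro exI[of _ S] exI[of _ N'] exI[of _ u]) simp
  qed
qed

text \<open>
  A maximal \<open>N\<close> of corank 1 is a direct summand of \<open>gen F\<close>, so a proper sublattice containing it
  has the same reduction modulo \<open>p\<close> as \<open>N\<close>.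
\<close>

lemma proper_sublattice_mod_p:
  assumes F: "finite F" "integral (gen F)" and N: "maxl N" "N \<subseteq> M" "dim (span F) = dim N + 1"
    and M: "submod M" "M \<subseteq> gen F" "M \<noteq> gen F" and m: "m \<in> M"
  shows "\<exists>x\<in>N. \<exists>l\<in>gen F. m = x + p *s l"
proof -
  have NF: "N \<subseteq> gen F" using N(2) M(2) by blast
  have Nsp: "N \<subseteq> span F" using NF gen_subset_span by blast
  \<comment> \<open>Maximality makes \<open>N\<close> the intersection of \<open>gen F\<close> with
    its span, so that the quotient is torsion-free.\<close>
  have prim: "x \<in> N" if x: "x \<in> gen F" "x \<in> span N" for x
  proof (rule maxlD[OF N(1) x(2)])
    show "Q x \<in> R" using F(2) x(1) by (simp add: integral_def)
    show "b x y \<in> R" if "y \<in> N" for y using integral_b[OF F(2) submod_gen x(1)] NF that by blast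
  qed
  have "\<not> F \<subseteq> span N"
  proof
    assume "F \<subseteq> span N"
    then have "span F \<subseteq> span N" by (intro span_minimal subspace_span)
    then have "span F = span N" using Nsp span_minimal[OF _ subspace_span] by blast
    then have "dim (span F) = dim N" by simp
    then show False using N(3) by simp
  qed
  then obtain z0 where z0: "z0 \<in> F" "z0 \<notin> span N" by blast
  have "dim N < dim (insert z0 N)"
    using z0 Nsp span_base[OF z0(1)] by (intro dim_less_if_notin_span[OF F(1), of N "insert z0 N" z0]) auto
  moreover have "\<not> dim (insert z0 N) < dim (span F)" using calculation N(3) by simp
  ultimately have "span F \<subseteq> span (insert z0 N)"
    using dim_less_if_notin_span[OF F(1), of "insert z0 N" "span F"] Nsp span_base[OF z0(1)] by blast
  then have "\<forall>s\<in>F. \<exists>c. s - c *s z0 \<in> span N" using span_base span_breakdown_eq by blast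
  then obtain c where c: "\<And>s. s \<in> F \<Longrightarrow> s - c s *s z0 \<in> span N" by metis
  have "c z0 \<noteq> 0" using c[OF z0(1)] z0(2) by auto
  \<comment> \<open>The coordinate of \<open>z\<close> modulo the span of \<open>N\<close> has least
    valuation, so \<open>z\<close> generates \<open>gen F\<close> modulo \<open>N\<close>.\<close>
  then obtain z where z: "z \<in> F" "c z \<noteq> 0" "\<forall>s\<in>F. c s / c z \<in> R"
    using ex_divides_all[OF F(1) z0(1), of c] by blast
  have zg: "z \<in> gen F" by (rule gen_base[OF z(1)])
  note subN = maxl_submod[OF N(1)]
  let ?D = "{l. \<exists>r\<in>R. l - r *s z \<in> N}"
  have "submod ?D"
  proof (rule submodI)
    show "0 \<in> ?D" using R_zero submod_zero[OF subN] by (intro CollectI bexI[of _ 0]) auto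
  next
    fix x y assume "x \<in> ?D" "y \<in> ?D"
    then obtain r s where rs: "r \<in> R" "s \<in> R" "x - r *s z \<in> N" "y - s *s z \<in> N" by blast
    have "x + y - (r + s) *s z = (x - r *s z) + (y - s *s z)" by (simp add: algebra_simps)
    then have "x + y - (r + s) *s z \<in> N" using submod_add[OF subN rs(3,4)] by metis
    then show "x + y \<in> ?D" using R_add[OF rs(1,2)] by blast
  next
    fix d x assume d: "d \<in> R" and "x \<in> ?D"
    then obtain r where r: "r \<in> R" "x - r *s z \<in> N" by blast
    have "d *s x - (d * r) *s z = d *s (x - r *s z)" by (simp add: algebra_simps)
    then have "d *s x - (d * r) *s z \<in> N" using submod_scale[OF subN d r(2)] by metis
    then show "d *s x \<in> ?D" using R_mult[OF d r(1)] by blast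
  qed
  moreover have "F \<subseteq> ?D"
  proof
    fix s assume s: "s \<in> F"
    let ?r = "c s / c z"
    have r: "?r \<in> R" using z(3) s by blast
    have "s - ?r *s z = (s - c s *s z0) - ?r *s (z - c z *s z0)"
      using z(2) by (simp add: scale_right_diff_distrib)
    also have "\<dots> \<in> span N" by (rule span_diff[OF c[OF s] span_scale[OF c[OF z(1)]]])
    finally have "s - ?r *s z \<in> span N" .
    moreover have "s - ?r *s z \<in> gen F"
      by (intro submod_diff[OF submod_gen] submod_scale[OF submod_gen] gen_base[OF s] zg r)
    ultimately have "s - ?r *s z \<in> N" by (intro prim)
    then show "s \<in> ?D" using r by blast
  qed
  ultimately have D: "gen F \<subseteq> ?D" by (rule gen_minimal)
  obtain r where r: "r \<in> R" "m - r *s z \<in> N" using D M(2) m by blast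
  \<comment> \<open>A unit \<open>r\<close> would put \<open>z\<close>, and with it all of
    \<open>gen F\<close>, into \<open>M\<close>.\<close>
  have "r \<in> P"
  proof (rule ccontr)
    assume n: "r \<notin> P"
    have "m - (m - r *s z) \<in> M" by (rule submod_diff[OF M(1) m]) (use r(2) N(2) in blast)
    then have "r *s z \<in> M" by simp
    then have "inverse r *s (r *s z) \<in> M" by (rule submod_scale[OF M(1) unit_inverse[OF r(1) n]])
    then have zM: "z \<in> M" using unit_nonzero[OF n] by simp
    have "gen F \<subseteq> M"
    proof
      fix l assume "l \<in> gen F"
      then obtain s where s: "s \<in> R" "l - s *s z \<in> N" using D by blast
      then have "(l - s *s z) + s *s z \<in> M"
        using N(2) zM by (intro submod_add[OF M(1)] submod_scale[OF M(1)]) auto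
      then show "l \<in> M" by simp
    qed
    then show False using M(2,3) by blast
  qed
  then have rp: "r / p \<in> R" by (simp add: P_def)
  have "(r / p) *s z \<in> gen F" by (rule submod_scale[OF submod_gen rp zg])
  moreover have "m = (m - r *s z) + p *s ((r / p) *s z)" using p_nonzero by simp
  ultimately show ?thesis using r(2) by blast
qed

text \<open>Modulo \<open>p\<close> the vector \<open>u\<close> is congruent to some
  \<open>x\<close> in \<open>N\<close>, and each vector of \<open>N\<close> to one of
  \<open>N'\<close>. So \<open>x\<close> inherits a norm outside \<open>P\<close> and pairings in
  \<open>P\<close>, against \<open>good\<close>.\<close>

lemma no_proper_sublattice:
  assumes F: "finite F" "integral (gen F)" and M: "submod M" "M \<subseteq> gen F" "M \<noteq> gen F"
    and N: "maxl N" "N \<subseteq> M" "dim (span F) = dim N + 1" "good N"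
    and N': "maxl N'" "N' \<subseteq> M" "dim (span F) = dim N' + 1"
    and u: "u \<in> N'" "Q u \<notin> P" "\<And>y. y \<in> N' \<Longrightarrow> b u y \<in> P"
  shows False
proof -
  have bF: "b x y \<in> R" if "x \<in> gen F" "y \<in> gen F" for x y
    by (rule integral_b[OF F(2) submod_gen that])
  have QF: "Q x \<in> R" if "x \<in> gen F" for x using F(2) that by (simp add: integral_def)
  have NF: "N \<subseteq> gen F" "N' \<subseteq> gen F" using N(2) N'(2) M(2) by auto
  obtain x l where x: "x \<in> N" "l \<in> gen F" "u = x + p *s l"
    using proper_sublattice_mod_p[OF F N(1-3) M] u(1) N'(2) by blast
  have xF: "x \<in> gen F" using x(1) NF by blast
  have "Q u = Q x + p * (p * Q l + b x l)"
    by (simp add: x(3) Q_add Q_scale b_simps power2_eq_square algebra_simps)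
  moreover have "p * (p * Q l + b x l) \<in> P"
    by (intro P_p_mult R_add R_mult p_mem QF bF x(2) xF)
  ultimately have Qx: "Q x \<notin> P" using u(2) P_add by metis
  have "b x y \<in> P" if y: "y \<in> N" for y
  proof -
    obtain y' k where k: "y' \<in> N'" "k \<in> gen F" "y = y' + p *s k"
      using proper_sublattice_mod_p[OF F N'(1-3) M] y N(2) by blast
    have y'F: "y' \<in> gen F" "y \<in> gen F" using k(1) y NF by auto
    have uF: "u \<in> gen F" using u(1) NF by blast
    have "b x y = b u y' + p * (b u k - b l y)"
      by (simp add: x(3) k(3) b_simps algebra_simps)
    moreover have "p * (b u k - b l y) \<in> P" by (intro P_p_mult R_diff bF uF k(2) x(2) y'F)
    ultimately show ?thesis using u(3)[OF k(1)] P_add by simp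
  qed
  then show False using N(4) x(1) Qx unfolding good_def by blast
qed

end

section \<open>The theorem\<close>

lemma subset_span_linear_image:
  assumes f: "Vector_Spaces.linear s1 s2 f" and S: "finite S" "inj_on f S" and R: "0 \<in> R"
  shows "subset_span R s2 (f ` S) = f ` subset_span R s1 S"
proof -
  interpret f: Vector_Spaces.linear s1 s2 f by fact
  have 1: "subset_span R s2 (f ` S) = {(\<Sum>x\<in>f ` S. s2 (c x) x) | c. \<forall>x. c x \<in> R}"
    using S R by (intro subset_span_finite) auto
  have 2: "subset_span R s1 S = {(\<Sum>x\<in>S. s1 (c x) x) | c. \<forall>x. c x \<in> R}"
    using S R by (intro subset_span_finite) auto
  have f_sum: "f (\<Sum>x\<in>S. s1 (c x) x) = (\<Sum>x\<in>S. s2 (c x) (f x))" for c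
    by (simp add: f.sum f.scale)
  show ?thesis
  proof (intro subset_antisym subsetI)
    fix y assume "y \<in> subset_span R s2 (f ` S)"
    then obtain c where c: "\<forall>x. c x \<in> R" "y = (\<Sum>x\<in>f ` S. s2 (c x) x)" unfolding 1 by blast
    have "y = f (\<Sum>x\<in>S. s1 (c (f x)) x)" unfolding f_sum c(2) by (simp add: sum.reindex[OF S(2)])
    moreover have "(\<Sum>x\<in>S. s1 (c (f x)) x) \<in> subset_span R s1 S"
      unfolding 2 using c(1) by (intro CollectI exI[of _ "\<lambda>x. c (f x)"]) auto
    ultimately show "y \<in> f ` subset_span R s1 S" by blast
  next
    fix y assume "y \<in> f ` subset_span R s1 S"
    then obtain c where c: "\<forall>x. c x \<in> R" "y = (\<Sum>x\<in>S. s2 (c x) (f x))" unfolding 2 using f_sum by auto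
    have "y = (\<Sum>x\<in>f ` S. s2 (c (inv_into S f x)) x)"
      unfolding c(2) by (simp add: sum.reindex[OF S(2)] inv_into_f_f[OF S(2)])
    then show "y \<in> subset_span R s2 (f ` S)" unfolding 1 using c(1)
      by (intro CollectI exI[of _ "\<lambda>x. c (inv_into S f x)"]) auto
  qed
qed

context henselian_dvr
begin

lemma norm_ideal_subset_iff: "norm_ideal R C N \<subseteq> R \<longleftrightarrow> (\<forall>x\<in>N. C x x \<in> R)"
proof
  assume *: "norm_ideal R C N \<subseteq> R"
  show "\<forall>x\<in>N. C x x \<in> R"
  proof
    fix x assume x: "x \<in> N"
    have "C x x \<in> norm_ideal R C N"
      unfolding norm_ideal_def subset_span_def using x R_one
      by (intro CollectI exI[of _ "{C x x}"] exI[of _ "\<lambda>_. 1"]) auto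
    then show "C x x \<in> R" using * by blast
  qed
next
  assume *: "\<forall>x\<in>N. C x x \<in> R"
  have sumR: "(\<Sum>x\<in>T. c x * x) \<in> R" if "finite T" "\<And>x. x \<in> T \<Longrightarrow> c x \<in> R \<and> x \<in> R" for T c
    using that by (induction T) (auto intro: R_zero R_add R_mult)
  show "norm_ideal R C N \<subseteq> R"
    unfolding norm_ideal_def subset_span_def
  proof (intro subsetI)
    fix y assume "y \<in> {\<Sum>x\<in>T. c x * x |T c. finite T \<and> T \<subseteq> {C x x |x. x \<in> N} \<and> c ` T \<subseteq> R}"
    then obtain T c where T: "finite T" "T \<subseteq> {C x x |x. x \<in> N}" "c ` T \<subseteq> R" "y = (\<Sum>x\<in>T. c x * x)" by blast
    have "x \<in> R" if "x \<in> T" for x using T(2) * that by auto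
    then show "y \<in> R" unfolding T(4) using T(1,3) sumR by (simp add: image_subset_iff)
  qed
qed

end

text \<open>\<open>B\<close> is an extension to the whole space of the form \<open>A\<close>, which is meaningful only on \<open>V\<close>.\<close>

locale extended_form = dvr_quadratic R p scale B
  for R :: "'a::field_char_0 set" and p :: 'a
    and scale :: "'a \<Rightarrow> 'v::ab_group_add \<Rightarrow> 'v" (infixr \<open>*s\<close> 75) and B +
  fixes A :: "'v \<Rightarrow> 'v \<Rightarrow> 'a" and S :: "'v set" and V :: "'v set"
  assumes agree: "x \<in> V \<Longrightarrow> y \<in> V \<Longrightarrow> A x y = B x y"
    and finite_S: "finite S" and V_eq: "V = span S" and nondeg_V: "nondeg V"
begin

lemma subspace_V: "subspace V"
  by (simp add: V_eq subspace_span)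

lemma quadratic_space_if_nondeg:
  assumes "finite N" "N \<subseteq> V" "nondeg (span N)"
  shows "quadratic_space scale (span N) A"
proof -
  have NV: "span N \<subseteq> V" using assms(2) subspace_V by (rule span_minimal)
  have ag: "A x y = B x y" if "x \<in> span N" "y \<in> span N" for x y using agree NV that by blast
  show ?thesis
  proof unfold_locales
    show "subspace (span N)" by (rule subspace_span)
    show "\<exists>S. finite S \<and> span S = span N" using assms(1) by blast
    show "A x y = A y x" if xy: "x \<in> span N" "y \<in> span N" for x y
      unfolding ag[OF xy] ag[OF xy(2,1)] by (rule B_sym)
    show "A (x + y) z = A x z + A y z" if xyz: "x \<in> span N" "y \<in> span N" "z \<in> span N" for x y z
      unfolding ag[OF span_add[OF xyz(1,2)] xyz(3)] ag[OF xyz(1,3)] ag[OF xyz(2,3)] by (rule B_add)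
    show "A (c *s x) y = c * A x y" if xy: "x \<in> span N" "y \<in> span N" for x y c
      unfolding ag[OF span_scale[OF xy(1)] xy(2)] ag[OF xy] by (rule B_scale)
    show "x = 0" if x: "x \<in> span N" "\<And>y. y \<in> span N \<Longrightarrow> A x y = 0" for x
    proof -
      have "b x y = 0" if "y \<in> span N" for y using x(2)[OF that] ag[OF x(1) that] by (simp add: b_def)
      then show ?thesis using assms(3) x(1) unfolding nondeg_def by blast
    qed
  qed
qed

text \<open>A vector meeting the criterion of \<open>maxl\<close> generates an integral overlattice
  together with \<open>gen S\<close>; conversely every vector of an integral overlattice meets
  it.\<close>

lemma maximal_lattice_iff_maxl:
  assumes int: "integral (gen S)"
  shows "maximal_lattice R scale A (gen S) \<longleftrightarrow> maxl (gen S)"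
proof -
  have "S \<subseteq> V" unfolding V_eq by (rule span_superset)
  then have quad: "quadratic_space scale (span S) A"
    using nondeg_V unfolding V_eq by (rule quadratic_space_if_nondeg[OF finite_S, unfolded V_eq])
  show ?thesis
  proof
    assume M: "maximal_lattice R scale A (gen S)"
    show "maxl (gen S)"
      unfolding maxl_def span_gen
    proof (intro conjI ballI impI submod_gen int)
      fix x assume x: "x \<in> span S" "Q x \<in> R" "\<forall>y\<in>gen S. b x y \<in> R"
      let ?L = "gen (insert x S)"
      have L: "?L = {c *s x + y | c y. c \<in> R \<and> y \<in> gen S}" using gen_insert[of _ x S] by blast
      have sp: "span (insert x S) = span S" by (rule span_redundant[OF x(1)])
      have "integral ?L" unfolding L using x by (intro integral_adjoin[OF int submod_gen]) auto
      moreover have "?L \<subseteq> V" using gen_subset_span[of "insert x S"] sp V_eq by simp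
      ultimately have "norm_ideal R A ?L \<subseteq> R"
        unfolding norm_ideal_subset_iff integral_def Q_def using agree by (metis subsetD)
      moreover have "lattice_in R scale A ?L"
        unfolding lattice_in_def span_gen sp
        using quad finite.insertI[OF finite_S, of x] by blast
      moreover have "gen S \<subseteq> ?L" by (rule gen_mono) blast
      moreover have "span ?L = span (gen S)" unfolding span_gen by (rule sp)
      ultimately have "?L = gen S" using M unfolding maximal_lattice_def by blast
      then show "x \<in> gen S" using gen_base[of x "insert x S"] by auto
    qed
  next
    assume M: "maxl (gen S)"
    have gV: "gen S \<subseteq> V" using gen_subset_span V_eq by simp
    have "lattice_in R scale A (gen S)"
      unfolding lattice_in_def span_gen using quad finite_S by blast
    moreover have "norm_ideal R A (gen S) \<subseteq> R"
      using agree gV int unfolding norm_ideal_subset_iff integral_def Q_def by (metis subsetD)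
    moreover have "L = gen S"
      if L: "lattice_in R scale A L" "span L = span (gen S)" "norm_ideal R A L \<subseteq> R" "gen S \<subseteq> L" for L
    proof -
      obtain T where T: "L = gen T" using L(1) unfolding lattice_in_def by blast
      have LV: "L \<subseteq> V" using span_superset[of L] L(2) by (simp add: span_gen V_eq)
      have intL: "integral L"
        unfolding integral_def Q_def
      proof
        fix x assume x: "x \<in> L"
        then have "A x x = B x x" using LV agree by blast
        then show "B x x \<in> R" using L(3) x unfolding norm_ideal_subset_iff by metis
      qed
      have "L \<subseteq> gen S"
      proof
        fix x assume x: "x \<in> L"
        show "x \<in> gen S"
        proof (rule maxlD[OF M])
          show "x \<in> span (gen S)" using span_base[OF x] L(2) by simp
          show "Q x \<in> R" using intL x by (simp add: integral_def)
          show "b x y \<in> R" if "y \<in> gen S" for y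
            using integral_b[OF intL _ x, of y] submod_gen T L(4) that by blast
        qed
      qed
      then show ?thesis using L(4) by blast
    qed
    ultimately show "maximal_lattice R scale A (gen S)" unfolding maximal_lattice_def by blast
  qed
qed

text \<open>The lattices tested by \<open>ADC\<close> live in the space of sequences. An isometry
  carries \<open>N\<close> there, and its composition with the representation obtained is a map of
  the original space.\<close>

lemma ADC_embeds:
  assumes adc: "ADC n R scale A (gen S)"
    and N: "finite N" "independent N" "card N = n" "N \<subseteq> V" "nondeg (span N)" "integral (gen N)"
  shows "\<exists>g. Vector_Spaces.linear scale scale g \<and> (\<forall>x\<in>span N. Q (g x) = Q x) \<and> g ` gen N \<subseteq> gen S"
proof -
  have NV: "span N \<subseteq> V" using N(4) subspace_V by (rule span_minimal)
  interpret S: vector_space "seq_scale :: 'a \<Rightarrow> _" by (rule vector_space_seq_scale)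
  interpret VS: vector_space_pair scale "seq_scale :: 'a \<Rightarrow> _" ..
  obtain W C \<phi> where \<phi>: "quadratic_space (seq_scale :: 'a \<Rightarrow> _) W C" "Vector_Spaces.linear scale seq_scale \<phi>"
    "bij_betw \<phi> (span N) W" "\<forall>x\<in>span N. \<forall>y\<in>span N. C (\<phi> x) (\<phi> y) = A x y"
    using quadratic_space_iso_sequences[OF quadratic_space_if_nondeg[OF N(1,4,5)]] by blast
  interpret \<phi>: Vector_Spaces.linear scale seq_scale \<phi> by (rule \<phi>(2))
  have inj: "inj_on \<phi> (span N)" and W: "\<phi> ` span N = W" using \<phi>(3) by (auto simp: bij_betw_def)
  have injN: "inj_on \<phi> N" by (rule inj_on_subset[OF inj span_superset])
  define M where "M = \<phi> ` gen N"
  have Mgen: "M = subset_span R seq_scale (\<phi> ` N)"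
    unfolding M_def by (rule subset_span_linear_image[OF \<phi>(2) N(1) injN R_zero, symmetric])
  have spM: "S.span M = W" unfolding M_def \<phi>.span_image span_gen by (rule W)
  have CQ: "C (\<phi> x) (\<phi> x) = Q x" if "x \<in> span N" for x
  proof -
    have "C (\<phi> x) (\<phi> x) = A x x" using \<phi>(4) that by blast
    also have "\<dots> = Q x" unfolding Q_def using agree NV that by blast
    finally show ?thesis .
  qed
  have "C y y \<in> R" if y: "y \<in> M" for y
  proof -
    obtain x where x: "x \<in> gen N" "y = \<phi> x" using y unfolding M_def by blast
    have "x \<in> span N" using x(1) gen_subset_span by blast
    then show ?thesis using CQ x N(6) by (simp add: integral_def)
  qed
  then have "integral_lattice R seq_scale C M"
    unfolding integral_lattice_def lattice_in_def norm_ideal_subset_iff spM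
    using \<phi>(1) N(1) Mgen by blast
  moreover have "lattice_rank seq_scale M = n"
  proof -
    have "S.independent (\<phi> ` N)" by (rule \<phi>.independent_injective_image[OF N(2) inj])
    then have "S.dim (S.span (\<phi> ` N)) = card (\<phi> ` N)" by (rule S.dim_span_eq_card_independent)
    moreover have "S.span (\<phi> ` N) = S.span M" unfolding spM \<phi>.span_image by (rule W)
    moreover have "card (\<phi> ` N) = n" using card_image[OF injN] N(3) by simp
    ultimately show ?thesis unfolding lattice_rank_def using S.dim_span[of M] by simp
  qed
  moreover have "space_represents scale A (span (gen S)) seq_scale C (S.span M)"
  proof -
    \<comment> \<open>A left inverse of the isometry represents the transported space in that of
      \<open>gen S\<close>.\<close>
    obtain \<psi> where \<psi>: "Vector_Spaces.linear seq_scale scale \<psi>" "\<forall>v\<in>span N. \<psi> (\<phi> v) = v"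
      using VS.linear_exists_left_inverse_on[OF \<phi>(2) subspace_span inj] by blast
    have "\<psi> y \<in> span (gen S) \<and> A (\<psi> y) (\<psi> y) = C y y" if y: "y \<in> W" for y
    proof -
      obtain x where x: "x \<in> span N" "y = \<phi> x" using y W by blast
      then show ?thesis using \<psi>(2) \<phi>(4) NV by (auto simp: span_gen V_eq)
    qed
    then show ?thesis unfolding space_represents_def is_representation_def spM using \<psi>(1) by blast
  qed
  ultimately have "lattice_represents scale A (gen S) seq_scale C M"
    using adc unfolding ADC_def by blast
  then obtain \<sigma> where \<sigma>: "Vector_Spaces.linear seq_scale scale \<sigma>" "\<sigma> ` W \<subseteq> span (gen S)"
    "\<forall>x\<in>W. A (\<sigma> x) (\<sigma> x) = C x x" "\<sigma> ` M \<subseteq> gen S"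
    unfolding lattice_represents_def is_representation_def spM by blast
  have "Vector_Spaces.linear scale scale (\<sigma> \<circ> \<phi>)" by (rule Vector_Spaces.linear_compose[OF \<phi>(2) \<sigma>(1)])
  moreover have "Q ((\<sigma> \<circ> \<phi>) x) = Q x" if x: "x \<in> span N" for x
  proof -
    have w: "\<phi> x \<in> W" using x W by blast
    then have "\<sigma> (\<phi> x) \<in> V" using \<sigma>(2) by (auto simp: span_gen V_eq)
    then have "Q (\<sigma> (\<phi> x)) = A (\<sigma> (\<phi> x)) (\<sigma> (\<phi> x))" unfolding Q_def by (simp add: agree)
    then show ?thesis using \<sigma>(3) w CQ[OF x] by simp
  qed
  moreover have "(\<sigma> \<circ> \<phi>) ` gen N \<subseteq> gen S" using \<sigma>(4) unfolding M_def by (simp add: image_comp)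
  ultimately show ?thesis by blast
qed

lemma ADC_imp_maxl:
  assumes adc: "ADC n R scale A (gen S)" and int: "integral (gen S)"
    and n: "dim V = n + 1" "even n" "2 \<le> n"
  shows "maxl (gen S)"
proof (rule ccontr)
  assume nm: "\<not> maxl (gen S)"
  obtain T where T: "finite T" "gen S \<subseteq> gen T" "span T = span S" "maxl (gen T)"
    using ex_maxl[OF finite_S int] nondeg_V V_eq by auto
  have ne: "gen S \<noteq> gen T" using T(4) nm by auto
  have dT: "dim (span T) = n + 1" using n(1) T(3) V_eq by simp
  obtain N N' u where N: "finite N" "independent N" "card N = n" "N \<subseteq> span T" "nondeg (span N)"
      "maxl (gen N)" "good (gen N)"
    and N': "finite N'" "independent N'" "card N' = n" "N' \<subseteq> span T" "nondeg (span N')" "maxl (gen N')"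
    and u: "u \<in> gen N'" "Q u \<notin> P" "\<forall>y\<in>gen N'. b u y \<in> P"
    using ex_good_bad[OF T(1,4) dT n(2,3)] by metis
  have TV: "span T = V" using T(3) V_eq by simp
  obtain g where g: "Vector_Spaces.linear scale scale g" "\<forall>x\<in>span N. Q (g x) = Q x" "g ` gen N \<subseteq> gen S"
    using ADC_embeds[OF adc N(1-3) N(4)[unfolded TV] N(5) maxl_integral[OF N(6)]] by blast
  obtain h where h: "Vector_Spaces.linear scale scale h" "\<forall>x\<in>span N'. Q (h x) = Q x" "h ` gen N' \<subseteq> gen S"
    using ADC_embeds[OF adc N'(1-3) N'(4)[unfolded TV] N'(5) maxl_integral[OF N'(6)]] by blast
  \<comment> \<open>Isometric images of the two lattices are again maximal of rank \<open>n\<close>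
    with the same pairings, so both can be compared inside \<open>gen S\<close>.\<close>
  have img: "maxl (k ` gen J) \<and> dim (k ` gen J) = n \<and> (\<forall>x\<in>gen J. \<forall>y\<in>gen J. b (k x) (k y) = b x y)"
    if k: "Vector_Spaces.linear scale scale k" "\<forall>x\<in>span J. Q (k x) = Q x"
      and J: "finite J" "independent J" "card J = n" "nondeg (span J)" "maxl (gen J)" for k J
  proof -
    have bk: "b (k x) (k y) = b x y" if "x \<in> span J" "y \<in> span J" for x y
      using k(2) that span_add[OF that] unfolding b_eq_Q linear_add[OF k(1), symmetric] by simp
    have "maxl (k ` gen J)" using k(2) by (intro maxl_linear_image[OF k(1) _ J(5)]) (simp add: span_gen)
    moreover have "dim (k ` gen J) = dim (gen J)"
    proof (rule dim_linear_image_eq[OF k(1) J(1) gen_subset_span])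
      fix x assume x: "x \<in> span (gen J)" "k x = 0"
      have xs: "x \<in> span J" using x(1) by (simp add: span_gen)
      have "b x y = 0" if "y \<in> J" for y using bk[OF xs span_base[OF that]] x(2) by simp
      then show "x = 0" by (rule nondegD[OF J(4) xs])
    qed
    moreover have "dim (gen J) = n"
      using dim_span_eq_card_independent[OF J(2)] dim_span[of "gen J"] J(3) by (simp add: span_gen)
    moreover have "\<forall>x\<in>gen J. \<forall>y\<in>gen J. b (k x) (k y) = b x y" using bk gen_subset_span by blast
    ultimately show ?thesis by simp
  qed
  have gi: "maxl (g ` gen N)" "dim (g ` gen N) = n" "\<And>x y. x \<in> gen N \<Longrightarrow> y \<in> gen N \<Longrightarrow> b (g x) (g y) = b x y"
    using img[OF g(1,2) N(1-3,5,6)] by auto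
  have hi: "maxl (h ` gen N')" "dim (h ` gen N') = n" "\<And>x y. x \<in> gen N' \<Longrightarrow> y \<in> gen N' \<Longrightarrow> b (h x) (h y) = b x y"
    using img[OF h(1,2) N'(1-3,5,6)] by auto
  have gQ: "Q (g x) = Q x" if "x \<in> gen N" for x using g(2) gen_subset_span that by blast
  have hQ: "Q (h x) = Q x" if "x \<in> gen N'" for x using h(2) gen_subset_span that by blast
  have "good (g ` gen N)"
    unfolding good_def
  proof (intro ballI impI)
    fix w assume "w \<in> g ` gen N" and w: "\<forall>y\<in>g ` gen N. b w y \<in> P"
    then obtain x where x: "x \<in> gen N" "w = g x" by blast
    have "b x y \<in> P" if "y \<in> gen N" for y using w that gi(3)[OF x(1) that] x(2) by auto
    then have "Q x \<in> P" using N(7) x(1) unfolding good_def by blast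
    then show "Q w \<in> P" using gQ[OF x(1)] x(2) by simp
  qed
  moreover have "b (h u) y \<in> P" if "y \<in> h ` gen N'" for y using that u(1,3) hi(3)[OF u(1)] by auto
  moreover have "Q (h u) \<notin> P" using u(2) hQ[OF u(1)] by simp
  ultimately show False
    using gi(1,2) hi(1,2) g(3) h(3) dT T(2) ne u(1)
    by (intro no_proper_sublattice[OF T(1) maxl_integral[OF T(4)] submod_gen T(2) ne,
          of "g ` gen N" "h ` gen N'" "h u"]) auto
qed

text \<open>The image of \<open>N\<close> may span a proper subspace, while
  \<open>maxl_embeds\<close> compares lattices on one space. A multiple of \<open>gen S\<close>,
  small enough to keep norms integral, is therefore added before enlarging to a maximal
  lattice.\<close>

lemma maxl_imp_ADC:
  assumes M: "maxl (gen S)"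
  shows "ADC n R scale A (gen S)"
  unfolding ADC_def
proof (intro allI impI, elim conjE)
  fix C and N :: "(nat \<Rightarrow> 'a) set"
  interpret W: vector_space "seq_scale :: 'a \<Rightarrow> _" by (rule vector_space_seq_scale)
  assume N: "integral_lattice R seq_scale C N"
    and rep: "space_represents scale A (span (gen S)) seq_scale C (W.span N)"
  note intM = maxl_integral[OF M]
  obtain G where G: "finite G" "N = subset_span R seq_scale G"
    using N unfolding integral_lattice_def lattice_in_def by blast
  have CN: "C x x \<in> R" if "x \<in> N" for x
    using N that unfolding integral_lattice_def norm_ideal_subset_iff by blast
  obtain \<sigma> where \<sigma>: "Vector_Spaces.linear seq_scale scale \<sigma>" "\<sigma> ` W.span N \<subseteq> V"
    "\<forall>x\<in>W.span N. A (\<sigma> x) (\<sigma> x) = C x x"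
    using rep unfolding space_represents_def is_representation_def span_gen V_eq by blast
  interpret \<sigma>: Vector_Spaces.linear seq_scale scale \<sigma> by (rule \<sigma>(1))
  have Gsum: "N = {(\<Sum>x\<in>G. seq_scale (c x) x) | c. \<forall>x. c x \<in> R}"
    unfolding G(2) by (rule subset_span_finite[OF G(1) R_zero]) simp
  have GN: "G \<subseteq> N"
    unfolding G(2) subset_span_def using R_one
    by (intro subsetI CollectI, rule_tac x = "{x}" in exI, rule_tac x = "\<lambda>_. 1" in exI) auto
  have \<sigma>N: "\<sigma> ` N = gen (\<sigma> ` G)"
  proof (rule subset_antisym)
    show "\<sigma> ` N \<subseteq> gen (\<sigma> ` G)"
    proof (rule image_subsetI)
      fix y assume "y \<in> N"
      then obtain c where c: "\<forall>x. c x \<in> R" "y = (\<Sum>x\<in>G. seq_scale (c x) x)" unfolding Gsum by blast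
      have "\<sigma> y = (\<Sum>x\<in>G. c x *s \<sigma> x)" unfolding c(2) by (simp add: \<sigma>.sum \<sigma>.scale)
      also have "\<dots> \<in> gen (\<sigma> ` G)"
        using c(1) by (intro submod_sum[OF submod_gen] submod_scale[OF submod_gen] gen_base) auto
      finally show "\<sigma> y \<in> gen (\<sigma> ` G)" .
    qed
    have "submod (\<sigma> ` N)"
    proof (rule submodI)
      show "0 \<in> \<sigma> ` N" unfolding Gsum using R_zero \<sigma>.zero
        by (intro image_eqI[of _ _ 0] CollectI exI[of _ "\<lambda>_. 0"]) auto
    next
      fix x y assume "x \<in> \<sigma> ` N" "y \<in> \<sigma> ` N"
      then obtain c d where c: "\<forall>x. c x \<in> R" "x = \<sigma> (\<Sum>x\<in>G. seq_scale (c x) x)"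
        and d: "\<forall>x. d x \<in> R" "y = \<sigma> (\<Sum>x\<in>G. seq_scale (d x) x)" unfolding Gsum by blast
      have "x + y = \<sigma> (\<Sum>x\<in>G. seq_scale (c x + d x) x)"
        unfolding c d \<sigma>.add[symmetric] by (simp add: W.scale_left_distrib sum.distrib)
      moreover have "(\<Sum>x\<in>G. seq_scale (c x + d x) x) \<in> N" unfolding Gsum using c(1) d(1) R_add
        by (intro CollectI exI[of _ "\<lambda>x. c x + d x"]) auto
      ultimately show "x + y \<in> \<sigma> ` N" by blast
    next
      fix r x assume r: "r \<in> R" and "x \<in> \<sigma> ` N"
      then obtain c where c: "\<forall>x. c x \<in> R" "x = \<sigma> (\<Sum>x\<in>G. seq_scale (c x) x)" unfolding Gsum by blast
      have "r *s x = \<sigma> (\<Sum>x\<in>G. seq_scale (r * c x) x)"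
        unfolding c \<sigma>.scale[symmetric] by (simp add: W.scale_sum_right)
      moreover have "(\<Sum>x\<in>G. seq_scale (r * c x) x) \<in> N" unfolding Gsum using c(1) r R_mult
        by (intro CollectI exI[of _ "\<lambda>x. r * c x"]) auto
      ultimately show "r *s x \<in> \<sigma> ` N" by blast
    qed
    then show "gen (\<sigma> ` G) \<subseteq> \<sigma> ` N" using GN by (intro gen_minimal) auto
  qed
  have Q\<sigma>: "Q (\<sigma> x) = C x x" if x: "x \<in> W.span N" for x
  proof -
    have "\<sigma> x \<in> V" using \<sigma>(2) x by blast
    then have "A (\<sigma> x) (\<sigma> x) = Q (\<sigma> x)" unfolding Q_def by (intro agree)
    then show ?thesis using \<sigma>(3) x by simp
  qed
  have int\<sigma>: "integral (gen (\<sigma> ` G))"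
    unfolding \<sigma>N[symmetric] integral_def using Q\<sigma> CN W.span_base by auto
  have \<sigma>V: "gen (\<sigma> ` G) \<subseteq> V" unfolding \<sigma>N[symmetric] using \<sigma>(2) W.span_superset[of N] by blast
  \<comment> \<open>Denominators of the finitely many pairings of generators; bilinearity extends
    the bound to both lattices.\<close>
  have "\<exists>k. \<forall>(s, t)\<in>\<sigma> ` G \<times> S. 2 ^ k * b s t \<in> R"
  proof (rule uniform_eventual_bound)
    show "case st of (s, t) \<Rightarrow> 2 ^ Suc k * b s t \<in> R" if "case st of (s, t) \<Rightarrow> 2 ^ k * b s t \<in> R" for st k
      using that R_mult[OF R_two] by (auto simp: mult.assoc)
    show "\<exists>k. case st of (s, t) \<Rightarrow> 2 ^ k * b s t \<in> R" for st
      using two_power_absorbs by (cases st) auto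
  qed (use G(1) finite_S in auto)
  then obtain k where k: "\<And>s t. s \<in> \<sigma> ` G \<Longrightarrow> t \<in> S \<Longrightarrow> 2 ^ k * b s t \<in> R" by blast
  have k1: "2 ^ k * b s y \<in> R" if "s \<in> \<sigma> ` G" "y \<in> gen S" for s y
  proof -
    have "submod {y. 2 ^ k * b s y \<in> R}"
      by (rule submodI) (auto simp: b_simps distrib_left R_zero mult.left_commute intro: R_add R_mult)
    then have "gen S \<subseteq> {y. 2 ^ k * b s y \<in> R}" using k[OF that(1)] by (intro gen_minimal) auto
    then show ?thesis using that(2) by blast
  qed
  have k2: "2 ^ k * b x y \<in> R" if "x \<in> gen (\<sigma> ` G)" "y \<in> gen S" for x y
  proof -
    have "submod {x. 2 ^ k * b x y \<in> R}"
      by (rule submodI) (auto simp: b_simps distrib_left R_zero mult.left_commute intro: R_add R_mult)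
    then have "gen (\<sigma> ` G) \<subseteq> {x. 2 ^ k * b x y \<in> R}" using k1[OF _ that(2)] by (intro gen_minimal) auto
    then show ?thesis using that(1) by blast
  qed
  define F where "F = \<sigma> ` G \<union> (\<lambda>t. 2 ^ k *s t) ` S"
  have finF: "finite F" using G(1) finite_S by (simp add: F_def)
  let ?D = "{x + 2 ^ k *s y | x y. x \<in> gen (\<sigma> ` G) \<and> y \<in> gen S}"
  have "submod ?D"
  proof (rule submodI)
    have "0 + 2 ^ k *s 0 \<in> ?D" using submod_zero[OF submod_gen] by blast
    then show "0 \<in> ?D" by simp
  next
    fix u w assume "u \<in> ?D" "w \<in> ?D"
    then obtain x y x' y' where *: "u = x + 2 ^ k *s y" "w = x' + 2 ^ k *s y'"
      "x \<in> gen (\<sigma> ` G)" "y \<in> gen S" "x' \<in> gen (\<sigma> ` G)" "y' \<in> gen S" by blast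
    have "u + w = (x + x') + 2 ^ k *s (y + y')" by (simp add: * scale_right_distrib)
    then show "u + w \<in> ?D" using submod_add[OF submod_gen] * by blast
  next
    fix r u assume r: "r \<in> R" and "u \<in> ?D"
    then obtain x y where *: "u = x + 2 ^ k *s y" "x \<in> gen (\<sigma> ` G)" "y \<in> gen S" by blast
    have "r *s u = r *s x + 2 ^ k *s (r *s y)" by (simp add: * scale_right_distrib mult.commute)
    then show "r *s u \<in> ?D" using submod_scale[OF submod_gen r] * by blast
  qed
  moreover have "F \<subseteq> ?D"
  proof
    fix f assume "f \<in> F"
    then consider "f \<in> \<sigma> ` G" | t where "t \<in> S" "f = 2 ^ k *s t" unfolding F_def by blast
    then show "f \<in> ?D"
    proof cases
      case 1
      then have "f + 2 ^ k *s 0 \<in> ?D" using submod_zero[OF submod_gen] gen_base by blast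
      then show ?thesis by simp
    next
      case 2
      then have "0 + 2 ^ k *s t \<in> ?D" using submod_zero[OF submod_gen] gen_base by blast
      then show ?thesis using 2 by simp
    qed
  qed
  ultimately have FD: "gen F \<subseteq> ?D" by (rule gen_minimal)
  have "integral (gen F)"
    unfolding integral_def
  proof
    fix f assume "f \<in> gen F"
    then obtain x y where xy: "f = x + 2 ^ k *s y" "x \<in> gen (\<sigma> ` G)" "y \<in> gen S" using FD by blast
    have "Q x \<in> R" "Q y \<in> R" using int\<sigma> intM xy(2,3) by (simp_all add: integral_def)
    then show "Q f \<in> R" unfolding xy(1) Q_add Q_scale b_scale_right
      by (intro R_add R_mult R_square R_power R_two k2 xy)
  qed
  moreover have spF: "span F = V"
  proof
    have "F \<subseteq> V"
      using \<sigma>V gen_base span_base[of _ S] subspace_scale[OF subspace_V] unfolding F_def V_eq by blast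
    then show "span F \<subseteq> V" using subspace_V by (rule span_minimal)
    have "S \<subseteq> span F"
    proof
      fix t assume "t \<in> S"
      then have "inverse (2 ^ k) *s (2 ^ k *s t) \<in> span F" by (intro span_scale span_base) (simp add: F_def)
      then show "t \<in> span F" by simp
    qed
    then show "V \<subseteq> span F" unfolding V_eq by (intro span_minimal subspace_span)
  qed
  ultimately obtain T where T: "finite T" "gen F \<subseteq> gen T" "span T = span F" "maxl (gen T)"
    using ex_maxl[OF finF] nondeg_V by auto
  obtain g where g: "Vector_Spaces.linear scale scale g" "g ` V \<subseteq> V" "\<forall>x\<in>V. Q (g x) = Q x" "g ` gen T \<subseteq> gen S"
    using maxl_embeds[OF finite_S T(4) M] T(3) spF nondeg_V unfolding span_gen V_eq by auto
  have "is_representation scale A (span (gen S)) seq_scale C (W.span N) (g \<circ> \<sigma>)"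
    unfolding is_representation_def span_gen V_eq[symmetric]
  proof (intro conjI ballI)
    show "Vector_Spaces.linear seq_scale scale (g \<circ> \<sigma>)" by (rule Vector_Spaces.linear_compose[OF \<sigma>(1) g(1)])
    show "(g \<circ> \<sigma>) ` W.span N \<subseteq> V" using \<sigma>(2) g(2) by auto
    fix x assume x: "x \<in> W.span N"
    have v: "\<sigma> x \<in> V" using \<sigma>(2) x by blast
    then have "g (\<sigma> x) \<in> V" using g(2) by blast
    then have "A (g (\<sigma> x)) (g (\<sigma> x)) = Q (g (\<sigma> x))" unfolding Q_def by (simp add: agree)
    then show "A ((g \<circ> \<sigma>) x) ((g \<circ> \<sigma>) x) = C x x" using g(3) v Q\<sigma>[OF x] by simp
  qed
  moreover have "(g \<circ> \<sigma>) ` N \<subseteq> gen S"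
  proof -
    have "\<sigma> ` N \<subseteq> gen T" unfolding \<sigma>N using gen_mono[of "\<sigma> ` G" F] T(2) by (auto simp: F_def)
    then show ?thesis using g(4) by auto
  qed
  ultimately show "lattice_represents scale A (gen S) seq_scale C N"
    unfolding lattice_represents_def by blast
qed

end

theorem theorem4p1:
  fixes K :: "'a::field_char_0 set" and v :: "'a \<Rightarrow> real"
    and scale :: "'a \<Rightarrow> 'v::ab_group_add \<Rightarrow> 'v" and B :: "'v \<Rightarrow> 'v \<Rightarrow> 'a"
    and M :: "'v set" and n :: nat
  assumes "dyadic_local_field K v"
    and "n \<ge> 2" and "even n"
    and "integral_lattice (ring_of_integers K v) scale B M"
    and "lattice_rank scale M = n + 1"
  shows "ADC n (ring_of_integers K v) scale B M \<longleftrightarrow>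
         maximal_lattice (ring_of_integers K v) scale B M"
proof -
  define R where "R = ring_of_integers K v"
  obtain p where p: "henselian_dvr R p"
    using dyadic_local_field.ring_of_integers_henselian_dvr[OF assms(1)] unfolding R_def by blast
  interpret R: henselian_dvr R p by (rule p)
  have lat: "lattice_in R scale B M" "norm_ideal R B M \<subseteq> R"
    using assms(4) unfolding R_def integral_lattice_def by auto
  obtain S where S: "finite S" "M = subset_span R scale S" using lat(1) unfolding lattice_in_def by blast
  interpret V: quadratic_space scale "module.span scale M" B using lat(1) unfolding lattice_in_def by blast
  interpret VV: vector_space_pair scale scale ..
  \<comment> \<open>A linear projection onto the span of \<open>M\<close>, obtained as a left
    inverse of the identity there. Composing \<open>B\<close> with it gives a form on the whole
    space.\<close>
  obtain \<pi> where \<pi>: "\<pi> ` UNIV \<subseteq> V.span M" "Vector_Spaces.linear scale scale \<pi>" "\<forall>x\<in>V.span M. \<pi> x = x"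
    using VV.linear_exists_left_inverse_on[OF V.linear_id V.subspace_V] by (auto simp: id_def)
  interpret \<pi>: Vector_Spaces.linear scale scale \<pi> by (rule \<pi>(2))
  have \<pi>V: "\<pi> x \<in> V.span M" for x using \<pi>(1) by blast
  define B' where "B' x y = B (\<pi> x) (\<pi> y)" for x y
  interpret D: dvr_quadratic R p scale B'
    by unfold_locales
      (auto simp: B'_def \<pi>.add \<pi>.scale \<pi>V V.form_add V.form_scale intro: V.form_sym)
  have MS: "V.span M = V.span S" unfolding S(2) by (rule D.span_gen)
  have agree: "B x y = B' x y" if "x \<in> V.span M" "y \<in> V.span M" for x y
    using \<pi>(3) that by (simp add: B'_def)
  interpret E: extended_form R p scale B' B S "V.span M"
  proof unfold_locales
    show "B x y = B' x y" if "x \<in> V.span M" "y \<in> V.span M" for x y by (rule agree[OF that])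
    show "finite S" by (rule S)
    show "V.span M = V.span S" by (rule MS)
    show "D.nondeg (V.span M)"
      unfolding D.nondeg_def D.b_def using V.nondegenerate agree by auto
  qed
  have MV: "M \<subseteq> V.span M" by (rule V.span_superset)
  have int: "D.integral (subset_span R scale S)"
    using lat(2) MV agree unfolding R.norm_ideal_subset_iff D.integral_def D.Q_def S(2)[symmetric]
    by (metis subsetD)
  have dim: "V.dim (V.span M) = n + 1" using assms(5) by (simp add: lattice_rank_def)
  have "ADC n R scale B M \<longleftrightarrow> maximal_lattice R scale B M"
    unfolding S(2) E.maximal_lattice_iff_maxl[OF int]
    using E.ADC_imp_maxl[OF _ int dim assms(3,2)] E.maxl_imp_ADC by blast
  then show ?thesis unfolding R_def .
qed

end
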